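(* Let $M$ be a connected, compact PL $n$-manifold, and let $\mu_1,\mu_2$ be two simplicial measures on $M$ with the same total volume. Then there is a PL homeomorphism $h:M\to M$ with $h_*\mu_1=\mu_2$. Moreover, any simplicial measure $\mu$ on $M$ is locally PL-Lebesgue: every point of $M$ has a neighborhood $U$ and a PL homeomorphism from $U$ onto an open subset of an orthant or of $\mathbb{R}^n$ carrying $\mu$ to Lebesgue measure.
   Context: A measure $\mu$ on a PL manifold $M$ is simplicial relative to a triangulation $T$ of $M$ if for each top-dimensional simplex $\Delta$ of $T$ the restriction of $\mu$ to $\Delta$ is the pullback of Lebesgue measure under some affine (linear) embedding of $\Delta$ into $\mathbb{R}^n$. A measure is simplicial if it is simplicial relative to some triangulation (the two measures may be simplicial relative to different triangulations). *)

theory Defs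
  imports "HOL-Analysis.Analysis"
begin

definition affine_on :: "'a::euclidean_space set \<Rightarrow> ('a \<Rightarrow> 'b::euclidean_space) \<Rightarrow> bool" where
  "affine_on S f \<equiv> (\<exists>l c. linear l \<and> (\<forall>x\<in>S. f x = l x + c))"

definition pl_map :: "'a::euclidean_space set \<Rightarrow> ('a \<Rightarrow> 'b::euclidean_space) \<Rightarrow> bool" where
  "pl_map S f \<equiv>
     (\<forall>K. simplicial_complex K \<and> \<Union>K \<subseteq> S \<longrightarrow>
        (\<exists>L. simplicial_complex L \<and> \<Union>L = \<Union>K \<and>
             (\<forall>\<sigma>\<in>L. \<exists>\<tau>\<in>K. \<sigma> \<subseteq> \<tau>) \<and>
             (\<forall>\<sigma>\<in>L. affine_on \<sigma> f)))"

definition pl_homeomorphism ::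
  "'a::euclidean_space set \<Rightarrow> 'b::euclidean_space set \<Rightarrow> ('a \<Rightarrow> 'b) \<Rightarrow> ('b \<Rightarrow> 'a) \<Rightarrow> bool" where
  "pl_homeomorphism S T f g \<equiv> homeomorphism S T f g \<and> pl_map S f \<and> pl_map T g"

definition orthant :: "'b::euclidean_space set" where
  "orthant = {x. \<forall>i\<in>Basis. 0 \<le> x \<bullet> i}"

text \<open>M (a subset of the ambient Euclidean space 'a) is a compact PL manifold of dimension
  DIM('b): a compact polyhedron (union of a finite triangulation) in which every point has a
  relatively open neighbourhood PL homeomorphic to an open subset of 'b = R^n or to a
  relatively open subset of the orthant.\<close>
definition compact_pl_manifold :: "'b::euclidean_space itself \<Rightarrow> 'a::euclidean_space set \<Rightarrow> bool" where
  "compact_pl_manifold _ M \<equiv>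
     compact M \<and> (\<exists>\<T>. triangulation \<T> \<and> \<Union>\<T> = M) \<and>
     (\<forall>x\<in>M. \<exists>U (V::'b set) h k. openin (top_of_set M) U \<and> x \<in> U \<and>
        (open V \<or> openin (top_of_set orthant) V) \<and> pl_homeomorphism U V h k)"

definition simplicial_measure_rel ::
  "'b::euclidean_space itself \<Rightarrow> 'a::euclidean_space set \<Rightarrow> 'a set set \<Rightarrow> 'a measure \<Rightarrow> bool" where
  "simplicial_measure_rel _ M \<T> \<mu> \<equiv>
     triangulation \<T> \<and> \<Union>\<T> = M \<and>
     sets \<mu> = sets (restrict_space borel M) \<and>
     (\<forall>\<Delta>\<in>\<T>. aff_dim \<Delta> = int DIM('b) \<longrightarrow>
        (\<exists>\<phi>::'a \<Rightarrow> 'b. affine_on \<Delta> \<phi> \<and> inj_on \<phi> \<Delta> \<and>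
           (\<forall>A\<in>sets \<mu>. A \<subseteq> \<Delta> \<longrightarrow> emeasure \<mu> A = emeasure lebesgue (\<phi> ` A))))"

definition simplicial_measure ::
  "'b::euclidean_space itself \<Rightarrow> 'a::euclidean_space set \<Rightarrow> 'a measure \<Rightarrow> bool" where
  "simplicial_measure n M \<mu> \<equiv> (\<exists>\<T>. simplicial_measure_rel n M \<T> \<mu>)"

end

theory Submission
  imports Defs
begin

text \<open>
  Pass to a common subdivision on whose top-dimensional simplices both measures are multiples of
  Lebesgue measure; such a measure is determined by the volumes of these simplices.  Volume is moved
  between two simplices with a common facet \<open>F\<close> as follows.  Map the simplex with apex \<open>p\<close> and volume
  \<open>a\<close> and the simplex with apex \<open>q\<close> and volume \<open>b\<close> to the two halves of the bipyramid
  \<open>- b \<lambda>(y) \<le> s \<le> a \<lambda>(y)\<close> over \<open>F\<close>, where \<open>\<lambda>\<close> is a multiple of the smallest barycentric coordinate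
  of \<open>y \<in> F\<close>.  If \<open>a' + b' = a + b\<close>, then the piecewise affine shear \<open>(y, s) \<mapsto> (y, s + (a' - a) \<lambda>(y))\<close> preserves
  Lebesgue measure and maps this bipyramid onto the one with parameters \<open>a'\<close> and \<open>b'\<close>.  Read in the
  two simplices, it fixes the boundary of their union and changes the volumes \<open>(a, b)\<close> to \<open>(a', b')\<close>.

  In a connected PL manifold any two top-dimensional simplices are joined by a chain of simplices with
  common facets, since a set of codimension two does not separate a chart, so finitely many
  such moves turn one volume vector into the other.

  For the local statement, apply the first part to a box in a chart, with the transported measure and
  a multiple of Lebesgue measure of the same total.  Every point of a box has a neighbourhood that an
  affine map identifies with an open subset of the orthant, so it does not matter which point of the
  box is the image of the given one.
\<close>


subsection \<open>Affine maps and convex sets\<close>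

text \<open>The ambient space may have larger dimension than \<open>M\<close>, so two adjacent
  simplices need not lie in a common flat in which they could be sheared; the shear takes place in a
  model inside \<open>'b\<close> and is read back through one affine map per simplex. The function
  \<lambda> is affine on finitely many polyhedra and describes the outer faces of the bipyramid
  exactly: they are the graphs of its multiples by a and -b, which the shear carries to the
  multiples by a' and -b'. Extending a move by the identity is consistent only if no third simplex
  contains the facet; here the manifold structure enters through invariance of domain. The dimension
  counts in charts rest on one fact: a convex set covered by finitely many sets has at most the
  dimension of one of them. No determinant is computed: the factor by which a linear map scales
  volume comes from the uniqueness of translation invariant measures, and a shear has factor 1
  because it is conjugate to its own square.\<close>

lemma affine_onI: "linear l \<Longrightarrow> (\<And>x. x \<in> S \<Longrightarrow> f x = l x + c) \<Longrightarrow> affine_on S f"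
  unfolding affine_on_def by blast

lemma affine_on_empty [simp]: "affine_on {} f"
  unfolding affine_on_def using linear_zero by blast

lemma affine_on_subset: "affine_on S f \<Longrightarrow> T \<subseteq> S \<Longrightarrow> affine_on T f"
  unfolding affine_on_def by blast

lemma affine_on_cong: "(\<And>x. x \<in> S \<Longrightarrow> f x = g x) \<Longrightarrow> affine_on S f \<longleftrightarrow> affine_on S g"
  unfolding affine_on_def by simp

lemma affine_on_ident: "affine_on S (\<lambda>x. x)"
  by (rule affine_onI [of "\<lambda>x. x" _ _ 0]) (auto simp: linear_ident)

lemma affine_on_compose:
  assumes "affine_on S f" "affine_on T g" "f ` S \<subseteq> T"
  shows "affine_on S (\<lambda>x. g (f x))"
proof -
  obtain l c l' c' where "linear l" "\<And>x. x \<in> S \<Longrightarrow> f x = l x + c"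
     "linear l'" "\<And>x. x \<in> T \<Longrightarrow> g x = l' x + c'"
    using assms unfolding affine_on_def by metis
  then show ?thesis
    using assms(3)
    by (intro affine_onI [of "l' \<circ> l" _ _ "l' c + c'"])
       (auto simp: linear_compose linear_add image_subset_iff)
qed

lemma affine_on_continuous:
  assumes "affine_on S f"
  shows "continuous_on S f"
proof -
  obtain l c where l: "linear l" "\<And>x. x \<in> S \<Longrightarrow> f x = l x + c"
    using assms unfolding affine_on_def by metis
  have "continuous_on S (\<lambda>x. l x + c)"
    by (intro continuous_intros linear_continuous_on linear_conv_bounded_linear[THEN iffD1] l(1))
  then show ?thesis
    using l(2) continuous_on_cong by fastforce
qed

lemma affine_on_image:
  assumes "affine_on S f"
  obtains l c where "linear l" "\<And>T. T \<subseteq> S \<Longrightarrow> f ` T = (+) c ` l ` T"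
proof -
  obtain l c where l: "linear l" "\<And>x. x \<in> S \<Longrightarrow> f x = l x + c"
    using assms unfolding affine_on_def by metis
  have "f ` T = (+) c ` l ` T" if "T \<subseteq> S" for T
  proof -
    have "f ` T = (\<lambda>x. c + l x) ` T"
      using l(2) that by (intro image_cong) (auto simp: add.commute)
    then show ?thesis
      by (simp add: image_image)
  qed
  with l(1) that show ?thesis by blast
qed

lemma polytope_affine_image:
  assumes "polytope P" "affine_on P f"
  shows "polytope (f ` P)"
  by (metis affine_on_image assms order_refl polytope_linear_image polytope_translation_eq)

lemma convex_affine_image:
  assumes "convex P" "affine_on P f"
  shows "convex (f ` P)"
  by (metis affine_on_image assms order_refl convex_linear_image convex_translation)

lemma aff_dim_affine_image_le:
  assumes "affine_on S f"
  shows "aff_dim (f ` S) \<le> aff_dim S"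
  by (metis affine_on_image assms order_refl aff_dim_translation_eq aff_dim_linear_image_le)

lemma polytope_affine_preimage:
  assumes P: "polytope P" "affine_on P f" and Q: "polytope Q"
  shows "polytope {x \<in> P. f x \<in> Q}"
proof -
  obtain l c where l: "linear l" "\<And>x. x \<in> P \<Longrightarrow> f x = l x + c"
    using P unfolding affine_on_def by metis
  obtain F where F: "finite F" "Q = \<Inter>F" "\<And>h. h \<in> F \<Longrightarrow> \<exists>a b. a \<noteq> 0 \<and> h = {x. a \<bullet> x \<le> b}"
    using Q polytope_imp_polyhedron unfolding polyhedron_def by metis
  have ph: "polyhedron {x. l x + c \<in> h}" if hF: "h \<in> F" for h
  proof -
    obtain a b where h: "h = {x. a \<bullet> x \<le> b}" using F(3) [OF hF] by blast
    have "{x. l x + c \<in> h} = {x. adjoint l a \<bullet> x \<le> b - a \<bullet> c}"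
      using adjoint_works [OF l(1), of _ a] by (auto simp: h inner_add_right inner_commute algebra_simps)
    then show ?thesis by (simp add: polyhedron_halfspace_le)
  qed
  have "{x \<in> P. f x \<in> Q} = P \<inter> \<Inter>((\<lambda>h. {x. l x + c \<in> h}) ` F)"
    using l(2) by (auto simp: F(2))
  then show ?thesis
    using P F(1) ph by (auto intro!: polytope_Int_polyhedron polyhedron_Inter)
qed

text \<open>A left inverse forces the linear part of \<open>f\<close> to be injective on the
  directions of \<open>S\<close>: from a relative interior point one can move a little in any such
  direction \<open>v\<close> without leaving \<open>S\<close>, and a \<open>v\<close> in the kernel
  would not change \<open>f\<close>. A linear left inverse on this subspace then gives
  \<open>g\<close>.\<close>

lemma affine_on_inverse:
  assumes "convex S" "affine_on S f" and gf: "\<And>x. x \<in> S \<Longrightarrow> g (f x) = x"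
  shows "affine_on (f ` S) g"
proof (cases "S = {}")
  case False
  obtain l c where l: "linear l" "\<And>x. x \<in> S \<Longrightarrow> f x = l x + c"
    using assms unfolding affine_on_def by metis
  obtain x0 where x0: "x0 \<in> rel_interior S"
    using False assms(1) rel_interior_eq_empty by blast
  then have x0S: "x0 \<in> S" using rel_interior_subset by blast
  define V where "V = span ((+) (-x0) ` S)"
  have hull: "affine hull S = (+) x0 ` V"
    unfolding V_def by (rule affine_hull_span_gen) (rule hull_inc [OF x0S])
  have inj: "inj_on l V"
  proof (subst linear_injective_on_subspace_0 [OF l(1)])
    show "subspace V" by (simp add: V_def)
    show "\<forall>v\<in>V. l v = 0 \<longrightarrow> v = 0"
    proof (intro ballI impI)
      fix v assume v: "v \<in> V" "l v = 0"
      obtain e where e: "e > 0" "ball x0 e \<inter> affine hull S \<subseteq> S"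
        using x0 by (auto simp: rel_interior_ball)
      \<comment> \<open>The summand 1 keeps the denominator positive for \<open>v = 0\<close>; the
        factor 2 turns the non-strict estimate below into membership in the open ball.\<close>
      define t where "t = e / (2 * (norm v + 1))"
      have t: "t > 0" using e by (simp add: t_def add_nonneg_pos)
      have "norm (t *\<^sub>R v) < e"
      proof -
        have "norm (t *\<^sub>R v) = e/2 * (norm v / (norm v + 1))"
          using e by (simp add: t_def abs_of_pos add_nonneg_pos)
        also have "\<dots> \<le> e/2 * 1"
          using e by (intro mult_left_mono) (auto simp: divide_le_eq_1 add_nonneg_pos)
        finally show ?thesis using e by simp
      qed
      moreover have "x0 + t *\<^sub>R v \<in> affine hull S"
        unfolding hull using v(1) by (auto simp: V_def span_scale)
      ultimately have "x0 + t *\<^sub>R v \<in> S" using e(2) by (auto simp: dist_norm)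
      moreover from this have "f (x0 + t *\<^sub>R v) = f x0"
        using v(2) l x0S by (simp add: linear_add linear_scale)
      ultimately have "x0 + t *\<^sub>R v = x0" using gf x0S by metis
      then show "v = 0" using t by simp
    qed
  qed
  obtain g' where g': "linear g'" "\<And>v. v \<in> V \<Longrightarrow> g' (l v) = v"
    using linear_exists_left_inverse_on [OF l(1), of V] inj by (auto simp: V_def)
  show ?thesis
  proof (rule affine_onI [of g' _ _ "x0 - g' (l x0 + c)"])
    fix y assume "y \<in> f ` S"
    then obtain x where x: "x \<in> S" "y = l x + c" "g y = x" using l(2) gf by auto
    have "x - x0 \<in> V" unfolding V_def using x(1) by (intro span_base) auto
    then have "g' (l x - l x0) = x - x0" using g'(2) l(1) by (metis linear_diff)
    then show "g y = g' y + (x0 - g' (l x0 + c))"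
      using g'(1) x by (simp add: linear_add linear_diff algebra_simps)
  qed (rule g')
qed auto

lemma aff_dim_affine_injective_image:
  assumes "convex S" "affine_on S f" "inj_on f S"
  shows "aff_dim (f ` S) = aff_dim S"
proof (rule antisym)
  have 1: "affine_on (f ` S) (inv_into S f)"
    by (rule affine_on_inverse) (use assms in auto)
  have "inv_into S f ` f ` S = S" using assms(3) by (auto simp: image_image)
  then show "aff_dim S \<le> aff_dim (f ` S)"
    using aff_dim_affine_image_le [OF 1] by simp
qed (use assms aff_dim_affine_image_le in blast)

text \<open>A segment whose endpoints avoid different members of the family meets each member that
  does not contain the line through them in at most one point.\<close>

lemma convex_subset_Union_affine:
  fixes C :: "'a::euclidean_space set"
  assumes "finite \<A>" "convex C" "C \<noteq> {}" "C \<subseteq> \<Union>\<A>" "\<And>A. A \<in> \<A> \<Longrightarrow> affine A"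
  shows "\<exists>A\<in>\<A>. C \<subseteq> A"
  using assms(1,4,5)
proof (induction \<A> rule: finite_induct)
  case empty
  then show ?case using assms by auto
next
  case (insert A \<A>)
  show ?case
  proof (rule ccontr)
    assume neg: "\<not> ?thesis"
    then obtain x where x: "x \<in> C" "x \<notin> A" by blast
    have "\<not> C \<subseteq> \<Union>\<A>" using insert neg by blast
    then obtain y where y: "y \<in> C" "y \<notin> \<Union>\<A>" by blast
    have "y \<in> A" using y insert.prems by blast
    have xy: "x \<noteq> y" using x \<open>y \<in> A\<close> by auto
    have two: "y \<in> B \<and> x \<in> B" if B: "affine B" "u \<in> B" "v \<in> B" "u \<noteq> v" "u \<in> affine hull {x,y}" "v \<in> affine hull {x,y}" for B u v
    proof -
      obtain s t where u: "u = x + s *\<^sub>R (y - x)" and v: "v = x + t *\<^sub>R (y - x)"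
        using B(5,6) by (auto simp: affine_hull_2_alt)
      have st: "s \<noteq> t" using B u v by auto
      have "x + r *\<^sub>R (y - x) = (1 - (r - s)/(t - s)) *\<^sub>R u + ((r - s)/(t - s)) *\<^sub>R v" for r
      proof -
        have "(1 - (r - s)/(t - s)) *\<^sub>R u + ((r - s)/(t - s)) *\<^sub>R v = u + ((r - s)/(t - s)) *\<^sub>R (v - u)"
          by (simp add: algebra_simps)
        also have "v - u = (t - s) *\<^sub>R (y - x)" by (simp add: u v algebra_simps)
        also have "u + ((r - s)/(t - s)) *\<^sub>R (t - s) *\<^sub>R (y - x) = u + (r - s) *\<^sub>R (y - x)"
          using st by simp
        finally show ?thesis by (simp add: u algebra_simps)
      qed
      then have "x + r *\<^sub>R (y - x) \<in> B" for r
        using B(1-3) unfolding affine_alt by (metis add.commute add.left_commute)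
      from this[of 0] this[of 1] show ?thesis by simp
    qed
    have sub: "closed_segment x y \<subseteq> affine hull {x,y}"
      by (simp add: closed_segment_subset_convex_hull convex_hull_subset_affine_hull segment_convex_hull)
    have "closed_segment x y \<subseteq> (\<Union>B\<in>insert A \<A>. B \<inter> closed_segment x y)"
      using insert.prems(1) closed_segment_subset [OF x(1) y(1) assms(2)] by blast
    moreover have "finite (B \<inter> closed_segment x y)" if "B \<in> insert A \<A>" for B
    proof -
      have "\<exists>z. B \<inter> closed_segment x y \<subseteq> {z}"
        using two [of B] insert.prems(2) [OF that] that x y sub by blast
      then show ?thesis using finite_subset by blast
    qed
    ultimately have "finite (closed_segment x y)"
      using insert.hyps(1) by (meson finite_UN_I finite_insert finite_subset)
    then show False using xy by (metis uncountable_closed_segment countable_finite)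
  qed
qed

text \<open>Affine hulls reduce this to \<open>convex_subset_Union_affine\<close>. It takes the
  place of measure or category arguments in the dimension counts.\<close>

lemma aff_dim_convex_subset_Union:
  fixes C :: "'a::euclidean_space set"
  assumes "finite \<F>" "convex C" "C \<noteq> {}" "C \<subseteq> \<Union>\<F>"
  obtains F where "F \<in> \<F>" "aff_dim C \<le> aff_dim F"
proof -
  have "C \<subseteq> \<Union>((hull) affine ` \<F>)"
    using assms(4) hull_subset[of _ affine] by blast
  then have "\<exists>A\<in>(hull) affine ` \<F>. C \<subseteq> A"
    by (intro convex_subset_Union_affine) (use assms in auto)
  then show ?thesis using that by (metis aff_dim_affine_hull aff_dim_subset imageE)
qed

text \<open>Two points are joined by two segments through a common point \<open>z\<close>. The
  affine hull of an \<open>A\<close> and one endpoint still has codimension at least one, so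
  \<open>z\<close> can avoid all these hulls; a segment from the endpoint to \<open>z\<close> that
  met \<open>A\<close> would put \<open>z\<close> into one of them.\<close>

lemma connected_convex_diff_affine:
  fixes C :: "'a::euclidean_space set"
  assumes "finite \<A>" "convex C" 
    and A: "\<And>A. A \<in> \<A> \<Longrightarrow> affine A \<and> aff_dim A + 2 \<le> aff_dim C"
  shows "connected (C - \<Union>\<A>)"
proof (clarsimp simp: connected_iff_connected_component)
  fix x y assume x: "x \<in> C" "\<forall>X\<in>\<A>. x \<notin> X" and y: "y \<in> C" "\<forall>X\<in>\<A>. y \<notin> X"
  let ?H = "(\<lambda>A. affine hull (insert x A)) ` \<A> \<union> (\<lambda>A. affine hull (insert y A)) ` \<A>"
  have "\<not> C \<subseteq> \<Union>?H"
  proof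
    assume "C \<subseteq> \<Union>?H"
    then obtain F where F: "F \<in> ?H" "aff_dim C \<le> aff_dim F"
      using aff_dim_convex_subset_Union [of ?H C] assms x by blast
    moreover have "aff_dim F < aff_dim C"
    proof -
      obtain A z where Az: "A \<in> \<A>" "F = affine hull (insert z A)" using F by blast
      have "aff_dim F \<le> aff_dim A + 1" 
        using Az by (simp add: aff_dim_insert)
      then show ?thesis using A [OF Az(1)] by linarith
    qed
    ultimately show False by auto
  qed
  then obtain z where z: "z \<in> C" "z \<notin> \<Union>?H" by blast
  have seg: "closed_segment u z \<subseteq> C - \<Union>\<A>" if u: "u \<in> C" "u \<notin> \<Union>\<A>" "\<And>A. A \<in> \<A> \<Longrightarrow> z \<notin> affine hull (insert u A)" for u
  proof -
    have False if w: "w \<in> closed_segment u z" and "B \<in> \<A>" "w \<in> B" for w B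
    proof -
      obtain t where t: "w = (1 - t) *\<^sub>R u + t *\<^sub>R z" using w by (auto simp: closed_segment_def)
      have "t \<noteq> 0" using t that u by auto
      \<comment> \<open>As \<open>t \<noteq> 0\<close>, the line through \<open>u\<close> and the
        point \<open>w\<close> of \<open>B\<close> contains \<open>z\<close>.\<close>
      have "z = (1 - 1/t) *\<^sub>R u + (1/t) *\<^sub>R w"
        using \<open>t \<noteq> 0\<close> by (simp add: t algebra_simps)
      moreover have "u \<in> affine hull (insert u B)" "w \<in> affine hull (insert u B)"
        using that by (auto simp: hull_inc)
      ultimately have "z \<in> affine hull (insert u B)"
        by (metis affine_affine_hull affine_alt add.commute diff_add_cancel mem_affine)
      then show False using u(3) that by blast
    qed
    then show ?thesis using closed_segment_subset [OF u(1) z(1) assms(2)] by blast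
  qed
  have "connected_component (C - \<Union>\<A>) x z" "connected_component (C - \<Union>\<A>) y z"
    by (rule connected_componentI [OF connected_segment]; use seg x y z in auto)+
  then show "connected_component (C - \<Union>\<A>) x y"
    using connected_component_sym connected_component_trans by metis
qed

subsection \<open>Piecewise affine maps on polytopes\<close>

lemma polyhedron_halfspace_pairs:
  assumes "polyhedron P"
  obtains I where "finite I" "P = {x. \<forall>(a,b)\<in>I. a \<bullet> x \<le> b}"
proof -
  obtain F where F: "finite F" "P = \<Inter>F" "\<forall>h\<in>F. \<exists>a b. h = {x. a \<bullet> x \<le> b}"
    using assms unfolding polyhedron_def by metis
  from bchoice [OF F(3)] obtain a where "\<forall>h\<in>F. \<exists>b. h = {x. a h \<bullet> x \<le> b}" by blast
  from bchoice [OF this] obtain b where "\<forall>h\<in>F. h = {x. a h \<bullet> x \<le> b h}"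
    by (rule exE)
  then have ab: "x \<in> h \<longleftrightarrow> a h \<bullet> x \<le> b h" if "h \<in> F" for x h
    using that by blast
  show thesis
  proof
    show "finite ((\<lambda>h. (a h, b h)) ` F)" using F by simp
    show "P = {x. \<forall>(a,b)\<in>(\<lambda>h. (a h, b h)) ` F. a \<bullet> x \<le> b}"
      using ab F(2) by auto
  qed
qed

text \<open>The cells of \<open>\<K>\<close> are cut along the bounding hyperplanes of all polytopes
  in \<open>\<P>\<close>, so that each cell lies on one side of each hyperplane; a polytope of
  \<open>\<P>\<close> that contains a relative interior point of a cell then contains the whole
  cell. This yields common subdivisions as well as subdivisions on which a given map is
  affine.\<close>

lemma polytope_refinement:
  fixes \<K> \<P> :: "'a::euclidean_space set set"
  assumes \<K>: "finite \<K>" "\<And>X. X \<in> \<K> \<Longrightarrow> polytope X" "\<And>X Y. X \<in> \<K> \<Longrightarrow> Y \<in> \<K> \<Longrightarrow> X \<inter> Y face_of X"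
    and \<P>: "finite \<P>" "\<And>X. X \<in> \<P> \<Longrightarrow> polytope X" and sub: "\<Union>\<K> \<subseteq> \<Union>\<P>"
  obtains \<L> where "simplicial_complex \<L>" "\<Union>\<L> = \<Union>\<K>" "\<And>\<sigma>. \<sigma> \<in> \<L> \<Longrightarrow> \<exists>\<tau>\<in>\<K>. \<sigma> \<subseteq> \<tau>"
    "\<And>\<sigma>. \<sigma> \<in> \<L> \<Longrightarrow> \<sigma> \<noteq> {} \<Longrightarrow> \<exists>P\<in>\<P>. \<sigma> \<subseteq> P"
proof -
  have "\<forall>P\<in>\<P>. \<exists>I. finite I \<and> P = {x. \<forall>(a,b)\<in>I. a \<bullet> x \<le> b}"
  proof
    fix P assume "P \<in> \<P>"
    then have "polyhedron P" by (intro polytope_imp_polyhedron \<P>(2))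
    then obtain I where "finite I" "P = {x. \<forall>(a,b)\<in>I. a \<bullet> x \<le> b}"
      by (rule polyhedron_halfspace_pairs)
    then show "\<exists>I. finite I \<and> P = {x. \<forall>(a,b)\<in>I. a \<bullet> x \<le> b}"
      by (intro exI conjI)
  qed
  from bchoice [OF this]
  obtain I where I0: "\<forall>P\<in>\<P>. finite (I P) \<and> P = {x. \<forall>(a,b)\<in>I P. a \<bullet> x \<le> b}"
    by (rule exE)
  have I1: "finite (I P)" if "P \<in> \<P>" for P
    using bspec [OF I0 that] by (rule conjunct1)
  have I2: "x \<in> P \<longleftrightarrow> (\<forall>(a,b)\<in>I P. a \<bullet> x \<le> b)" if "P \<in> \<P>" for P x
  proof -
    have "x \<in> P \<longleftrightarrow> x \<in> {x. \<forall>(a,b)\<in>I P. a \<bullet> x \<le> b}"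
      using bspec [OF I0 that, THEN conjunct2] by (rule arg_cong)
    then show ?thesis by (simp only: mem_Collect_eq)
  qed
  have "finite (\<Union>(I ` \<P>))" using I1 \<P>(1) by blast
  then have "\<exists>\<G>. \<Union>\<G> = \<Union>\<K> \<and> finite \<G> \<and> (\<forall>C\<in>\<G>. \<exists>D. D \<in> \<K> \<and> C \<subseteq> D) \<and>
      (\<forall>C\<in>\<K>. \<forall>x\<in>C. \<exists>D. D \<in> \<G> \<and> x \<in> D \<and> D \<subseteq> C) \<and>
      (\<forall>X\<in>\<G>. polytope X) \<and> (\<forall>X\<in>\<G>. aff_dim X \<le> int DIM('a)) \<and>
      (\<forall>X\<in>\<G>. \<forall>Y\<in>\<G>. X \<inter> Y face_of X) \<and>
      (\<forall>X\<in>\<G>. \<forall>x\<in>X. \<forall>y\<in>X. \<forall>a b. (a,b) \<in> \<Union>(I ` \<P>) \<longrightarrow>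
        a \<bullet> x \<le> b \<and> a \<bullet> y \<le> b \<or> a \<bullet> x \<ge> b \<and> a \<bullet> y \<ge> b)"
    by (intro cell_subdivision_lemma \<K> aff_dim_le_DIM)
  then
  obtain \<G> where \<G>0: "\<Union>\<G> = \<Union>\<K>" "finite \<G>" "\<forall>C\<in>\<G>. \<exists>D. D \<in> \<K> \<and> C \<subseteq> D"
    "\<forall>X\<in>\<G>. polytope X" "\<forall>X\<in>\<G>. \<forall>Y\<in>\<G>. X \<inter> Y face_of X"
    and sgn0: "\<forall>X\<in>\<G>. \<forall>x\<in>X. \<forall>y\<in>X. \<forall>a b. (a,b) \<in> \<Union>(I ` \<P>) \<longrightarrow>
        a \<bullet> x \<le> b \<and> a \<bullet> y \<le> b \<or> a \<bullet> x \<ge> b \<and> a \<bullet> y \<ge> b"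
    by (elim exE conjE) (rule that; assumption)
  note \<G> = \<G>0(1,2) \<G>0(3-5)[rule_format] and sgn = sgn0[rule_format]
  have inP: "\<exists>P\<in>\<P>. X \<subseteq> P" if X: "X \<in> \<G>" "X \<noteq> {}" for X
  proof -
    have "convex X" using \<G>(4) X(1) polytope_imp_convex by blast
    obtain x where x: "x \<in> rel_interior X"
      using \<open>convex X\<close> X(2) rel_interior_eq_empty by blast
    have xX: "x \<in> X" using x rel_interior_subset by blast
    then obtain P where P: "P \<in> \<P>" "x \<in> P" using \<G>(1) X sub by blast
    have "a \<bullet> y \<le> b" if y: "y \<in> X" and ab: "(a,b) \<in> I P" for y a b
    proof (rule ccontr)
      assume neg: "\<not> a \<bullet> y \<le> b"
      have ab': "(a,b) \<in> \<Union>(I ` \<P>)" using ab P by blast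
      have ge: "a \<bullet> z \<ge> b" if "z \<in> X" for z
        using sgn [OF X(1) y that ab'] neg by linarith
      have "a \<bullet> x \<le> b" using I2 [OF P(1)] P(2) ab by blast
      then have xb: "a \<bullet> x = b" using ge [OF xX] by simp
      obtain e where e: "e > 1" "(1 - e) *\<^sub>R y + e *\<^sub>R x \<in> X"
        using x y convex_rel_interior_iff [OF \<open>convex X\<close>] X(2) by blast
      have "b \<le> (1 - e) * (a \<bullet> y) + e * b" using ge [OF e(2)] by (simp add: inner_add_right xb)
      moreover have "(e - 1) * (a \<bullet> y) > (e - 1) * b" using e(1) neg by (intro mult_strict_left_mono) auto
      ultimately show False by (simp add: algebra_simps)
    qed
    then have "X \<subseteq> P" using I2 [OF P(1)] by blast
    then show ?thesis using P by blast
  qed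
  obtain \<L> where \<L>: "simplicial_complex \<L>" "\<Union>\<L> = \<Union>\<G>" "\<And>K. K \<in> \<L> \<Longrightarrow> \<exists>C. C \<in> \<G> \<and> K \<subseteq> C"
    using simplicial_subdivision_of_cell_complex [OF \<G>(2,4,5)] by metis
  show thesis
  proof
    show "\<exists>P\<in>\<P>. \<sigma> \<subseteq> P" if \<sigma>: "\<sigma> \<in> \<L>" "\<sigma> \<noteq> {}" for \<sigma>
    proof -
      obtain C where "C \<in> \<G>" "\<sigma> \<subseteq> C" using \<L>(3) \<sigma>(1) by blast
      then show ?thesis using inP [of C] \<sigma>(2) by (metis order_trans subset_empty)
    qed
    show "\<exists>\<tau>\<in>\<K>. \<sigma> \<subseteq> \<tau>" if "\<sigma> \<in> \<L>" for \<sigma>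
      using \<L>(3) [OF that] \<G>(3) by (meson order_trans)
  qed (use \<L> \<G> in auto)
qed

text \<open>The polytopes need not meet in faces, so unions, compositions and inverses require no
  subdivision; \<open>pw_affine_imp_pl_map\<close> and \<open>pl_map_imp_pw_affine\<close> translate
  to and from \<open>pl_map\<close>. The domain is automatically compact, so the notion suits closed
  boxes and \<open>M\<close> itself rather than open chart domains.\<close>

definition pw_affine :: "'a::euclidean_space set \<Rightarrow> ('a \<Rightarrow> 'b::euclidean_space) \<Rightarrow> bool" where
  "pw_affine S f \<longleftrightarrow> (\<exists>\<P>. finite \<P> \<and> S = \<Union>\<P> \<and> (\<forall>P\<in>\<P>. polytope P \<and> affine_on P f))"

lemma pw_affineI:
  "finite \<P> \<Longrightarrow> S = \<Union>\<P> \<Longrightarrow> (\<And>P. P \<in> \<P> \<Longrightarrow> polytope P) \<Longrightarrow> (\<And>P. P \<in> \<P> \<Longrightarrow> affine_on P f) \<Longrightarrow> pw_affine S f"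
  unfolding pw_affine_def by blast

lemma pw_affineE:
  assumes "pw_affine S f"
  obtains \<P> where "finite \<P>" "S = \<Union>\<P>" "\<And>P. P \<in> \<P> \<Longrightarrow> polytope P" "\<And>P. P \<in> \<P> \<Longrightarrow> affine_on P f"
  using assms unfolding pw_affine_def by blast

lemma pw_affine_polytope: "polytope S \<Longrightarrow> affine_on S f \<Longrightarrow> pw_affine S f"
  by (rule pw_affineI [of "{S}"]) auto

lemma pw_affine_Un: "pw_affine S f \<Longrightarrow> pw_affine T f \<Longrightarrow> pw_affine (S \<union> T) f"
  unfolding pw_affine_def by (metis Union_Un_distrib Un_iff finite_UnI)

lemma pw_affine_UN:
  assumes "finite I" "\<And>i. i \<in> I \<Longrightarrow> pw_affine (S i) f"
  shows "pw_affine (\<Union>i\<in>I. S i) f"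
  using assms
proof (induction I rule: finite_induct)
  case empty
  show ?case by (rule pw_affineI [of "{}"]) auto
qed (auto intro: pw_affine_Un)

lemma pw_affine_cong: "(\<And>x. x \<in> S \<Longrightarrow> f x = g x) \<Longrightarrow> pw_affine S f \<Longrightarrow> pw_affine S g"
  unfolding pw_affine_def by (metis UnionI affine_on_cong)

lemma pw_affine_compose:
  assumes "pw_affine S f" "pw_affine T g" "f ` S \<subseteq> T"
  shows "pw_affine S (\<lambda>x. g (f x))"
proof -
  obtain \<P> where \<P>: "finite \<P>" "S = \<Union>\<P>" "\<And>P. P \<in> \<P> \<Longrightarrow> polytope P" "\<And>P. P \<in> \<P> \<Longrightarrow> affine_on P f"
    using assms(1) unfolding pw_affine_def by blast
  obtain \<Q> where \<Q>: "finite \<Q>" "T = \<Union>\<Q>" "\<And>P. P \<in> \<Q> \<Longrightarrow> polytope P" "\<And>P. P \<in> \<Q> \<Longrightarrow> affine_on P g"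
    using assms(2) unfolding pw_affine_def by blast
  let ?R = "\<lambda>(P,Q). {x \<in> P. f x \<in> Q}"
  show ?thesis
  proof (rule pw_affineI [of "?R ` (\<P> \<times> \<Q>)"])
    show "S = \<Union> (?R ` (\<P> \<times> \<Q>))" using \<P>(2) \<Q>(2) assms(3) by fastforce
    show "polytope X" if "X \<in> ?R ` (\<P> \<times> \<Q>)" for X
      using that \<P>(3,4) \<Q>(3) by (auto intro!: polytope_affine_preimage)
    show "affine_on X (\<lambda>x. g (f x))" if X: "X \<in> ?R ` (\<P> \<times> \<Q>)" for X
    proof -
      obtain P Q where "P \<in> \<P>" "Q \<in> \<Q>" "X = {x \<in> P. f x \<in> Q}" using X by auto
      then show ?thesis
        using \<P>(4) \<Q>(4) by (intro affine_on_compose [of X f Q g]) (auto intro: affine_on_subset)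
    qed
  qed (use \<P> \<Q> in auto)
qed

lemma pw_affine_inverse:
  assumes "pw_affine S f" "\<And>x. x \<in> S \<Longrightarrow> g (f x) = x"
  shows "pw_affine (f ` S) g"
proof -
  obtain \<P> where \<P>: "finite \<P>" "S = \<Union>\<P>" "\<And>P. P \<in> \<P> \<Longrightarrow> polytope P" "\<And>P. P \<in> \<P> \<Longrightarrow> affine_on P f"
    using assms(1) unfolding pw_affine_def by blast
  show ?thesis
    by (rule pw_affineI [of "(`) f ` \<P>"])
       (use \<P> assms(2) in \<open>auto intro!: polytope_affine_image affine_on_inverse polytope_imp_convex\<close>)
qed

lemma pw_affine_compact: "pw_affine S f \<Longrightarrow> compact S"
  unfolding pw_affine_def using compact_Union polytope_imp_compact by blast

lemma pw_affine_continuous: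
  assumes "pw_affine S f"
  shows "continuous_on S f"
proof -
  obtain \<P> where \<P>: "finite \<P>" "S = \<Union>\<P>" "\<And>P. P \<in> \<P> \<Longrightarrow> polytope P" "\<And>P. P \<in> \<P> \<Longrightarrow> affine_on P f"
    using assms unfolding pw_affine_def by blast
  have "continuous_on (\<Union>P\<in>\<P>. P) f"
    by (rule continuous_on_closed_Union) (use \<P> in \<open>auto intro: polytope_imp_closed affine_on_continuous\<close>)
  then show ?thesis using \<P>(2) by simp
qed

text \<open>\<open>pl_map\<close> asks for a subdivision of an arbitrary complex \<open>K\<close>
  inside \<open>S\<close>; \<open>polytope_refinement\<close> subdivides \<open>K\<close> along the
  polytopes on which \<open>f\<close> is affine.\<close>

lemma pw_affine_imp_pl_map:
  assumes "pw_affine S f"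
  shows "pl_map S f"
  unfolding pl_map_def
proof (intro allI impI, elim conjE)
  fix K :: "'a set set" assume K: "simplicial_complex K" "\<Union>K \<subseteq> S"
  obtain \<P> where \<P>: "finite \<P>" "S = \<Union>\<P>" "\<And>P. P \<in> \<P> \<Longrightarrow> polytope P" "\<And>P. P \<in> \<P> \<Longrightarrow> affine_on P f"
    using assms unfolding pw_affine_def by blast
  obtain L where L: "simplicial_complex L" "\<Union>L = \<Union>K" "\<And>\<sigma>. \<sigma> \<in> L \<Longrightarrow> \<exists>\<tau>\<in>K. \<sigma> \<subseteq> \<tau>"
    "\<And>\<sigma>. \<sigma> \<in> L \<Longrightarrow> \<sigma> \<noteq> {} \<Longrightarrow> \<exists>P\<in>\<P>. \<sigma> \<subseteq> P"
    by (rule polytope_refinement [of K \<P>])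
       (use K \<P> in \<open>auto simp: simplicial_complex_def intro: simplex_imp_polytope\<close>)
  have "affine_on \<sigma> f" if "\<sigma> \<in> L" for \<sigma>
    using L(4) [OF that] \<P>(4) affine_on_subset by (cases "\<sigma> = {}") auto
  then show "\<exists>L. simplicial_complex L \<and> \<Union>L = \<Union>K \<and> (\<forall>\<sigma>\<in>L. \<exists>\<tau>\<in>K. \<sigma> \<subseteq> \<tau>) \<and> (\<forall>\<sigma>\<in>L. affine_on \<sigma> f)"
    using L by blast
qed

lemma pl_map_subset: "pl_map S f \<Longrightarrow> T \<subseteq> S \<Longrightarrow> pl_map T f"
  unfolding pl_map_def by (meson order_trans)

lemma pl_map_imp_pw_affine:
  assumes "pl_map S f" "polytope T" "T \<subseteq> S"
  shows "pw_affine T f"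
proof -
  obtain K where K: "simplicial_complex K" "\<Union>K = \<Union>{T}"
    using simplicial_subdivision_of_cell_complex [of "{T}"] assms(2)
    by (metis Int_absorb face_of_refl finite.emptyI finite.insertI polytope_imp_convex singletonD)
  then obtain L where L: "simplicial_complex L" "\<Union>L = T" "\<And>\<sigma>. \<sigma> \<in> L \<Longrightarrow> affine_on \<sigma> f"
    using assms(1,3) unfolding pl_map_def by (metis cSup_singleton)
  then show ?thesis
    by (intro pw_affineI [of L]) (auto simp: simplicial_complex_def intro: simplex_imp_polytope)
qed

lemma pl_homeomorphismI:
  assumes "pw_affine S f" "pw_affine T g" "f ` S \<subseteq> T" "g ` T \<subseteq> S"
    "\<And>x. x \<in> S \<Longrightarrow> g (f x) = x" "\<And>y. y \<in> T \<Longrightarrow> f (g y) = y"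
  shows "pl_homeomorphism S T f g"
proof -
  have "f ` S = T" "g ` T = S" using assms(3-6) by (force simp: image_iff)+
  then show ?thesis
    unfolding pl_homeomorphism_def homeomorphism_def
    using assms by (auto intro: pw_affine_imp_pl_map pw_affine_continuous)
qed

text \<open>One of the finitely many affine pieces of \<open>f\<close> must meet \<open>C\<close> in
  full dimension. This carries dimensions through piecewise affine charts.\<close>

lemma pw_affine_convex_piece:
  assumes "pw_affine S f" "convex C" "C \<noteq> {}" "C \<subseteq> S"
  obtains D where "convex D" "D \<subseteq> C" "aff_dim D = aff_dim C" "affine_on D f"
proof -
  obtain \<P> where \<P>: "finite \<P>" "S = \<Union>\<P>" "\<And>P. P \<in> \<P> \<Longrightarrow> polytope P" "\<And>P. P \<in> \<P> \<Longrightarrow> affine_on P f"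
    using assms(1) unfolding pw_affine_def by blast
  have "C \<subseteq> \<Union>((\<lambda>P. P \<inter> C) ` \<P>)" using assms(4) \<P>(2) by blast
  then obtain F where "F \<in> (\<lambda>P. P \<inter> C) ` \<P>" "aff_dim C \<le> aff_dim F"
    by (rule aff_dim_convex_subset_Union [rotated 3]) (use assms \<P>(1) in auto)
  then obtain P where P: "P \<in> \<P>" "aff_dim C \<le> aff_dim (P \<inter> C)" by auto
  show thesis
  proof
    show "convex (P \<inter> C)" using \<P>(3) [OF P(1)] assms(2) by (simp add: convex_Int polytope_imp_convex)
    show "aff_dim (P \<inter> C) = aff_dim C" using P(2) aff_dim_subset [of "P \<inter> C" C] by simp
    show "affine_on (P \<inter> C) f" using \<P>(4) [OF P(1)] affine_on_subset by blast
  qed simp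
qed

subsection \<open>Charts of a compact PL manifold\<close>

text \<open>A chart domain is only relatively open, while \<open>pw_affine\<close> needs polytopes;
  shrinking the chart to a closed box gives both directions this form. Interior and boundary charts
  become alike, because a box meets the orthant in a box. The set \<open>W\<close> records that the
  box still covers a neighbourhood of \<open>x\<close> in \<open>M\<close>.\<close>

lemma manifold_box_chart:
  fixes M :: "'a::euclidean_space set"
  assumes M: "compact_pl_manifold TYPE('b::euclidean_space) M" and "x \<in> M"
  obtains a b :: "'b::euclidean_space" and k f W where "box a b \<noteq> {}" "pw_affine (cbox a b) k"
    "pw_affine (k ` cbox a b) f" "\<And>v. v \<in> cbox a b \<Longrightarrow> f (k v) = v" "k ` cbox a b \<subseteq> M"
    "open W" "x \<in> W" "M \<inter> W \<subseteq> k ` cbox a b"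
proof -
  obtain U and V :: "'b set" and f k where U: "openin (top_of_set M) U" "x \<in> U"
    and V: "open V \<or> openin (top_of_set orthant) V" and fk: "pl_homeomorphism U V f k"
    using assms unfolding compact_pl_manifold_def by blast
  have hom: "homeomorphism U V f k" and "pl_map V k" using fk unfolding pl_homeomorphism_def by auto
  have fx: "f x \<in> V" using hom U(2) by (auto simp: homeomorphism_def)
  obtain a b W where ab: "cbox a b \<subseteq> V" "box a b \<noteq> {}" and W: "open W" "f x \<in> W" "W \<inter> V \<subseteq> cbox a b"
    using V
  proof
    assume "open V"
    then obtain a b where "cbox a b \<subseteq> V" "f x \<in> box a b"
      by (rule open_contains_cbox [OF _ fx])
    then show thesis using box_subset_cbox [of a b] by (intro that [of a b "box a b"]) auto
  next
    assume "openin (top_of_set orthant) V"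
    then obtain T where T: "open T" "V = orthant \<inter> T" by (auto simp: openin_open)
    have fxT: "f x \<in> T" "f x \<in> orthant" using fx T by auto
    obtain a b where ab: "cbox a b \<subseteq> T" "f x \<in> box a b"
      by (rule open_contains_cbox [OF T(1) fxT(1)])
    \<comment> \<open>Clipping the lower corner at 0 intersects the box with the orthant. The result
      is nondegenerate, since each coordinate of \<open>f x\<close> is at least 0 and less than that
      of \<open>b\<close>.\<close>
    define a' where "a' = (\<Sum>i\<in>Basis. max 0 (a \<bullet> i) *\<^sub>R i)"
    have a': "a' \<bullet> i = max 0 (a \<bullet> i)" if "i \<in> Basis" for i
      using that by (simp add: a'_def)
    have eq: "cbox a' b = orthant \<inter> cbox a b"
      by (auto simp: orthant_def mem_box a')
    have ne: "a' \<bullet> i < b \<bullet> i" if i: "i \<in> Basis" for i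
    proof -
      have "a \<bullet> i < f x \<bullet> i" "f x \<bullet> i < b \<bullet> i" "0 \<le> f x \<bullet> i"
        using ab(2) fxT(2) i by (simp_all add: mem_box orthant_def)
      then show ?thesis by (simp add: a' i)
    qed
    show thesis
    proof (rule that [of a' b "box a b"])
      show "cbox a' b \<subseteq> V" unfolding eq T(2) using ab(1) by blast
      show "box a b \<inter> V \<subseteq> cbox a' b" unfolding eq T(2) using box_subset_cbox [of a b] by blast
      show "box a' b \<noteq> {}" using ne by (simp add: box_ne_empty)
    qed (use ab in auto)
  qed
  have sub: "k ` cbox a b \<subseteq> U" using ab hom by (auto simp: homeomorphism_def)
  have pk: "pw_affine (cbox a b) k"
    using \<open>pl_map V k\<close> ab(1) by (intro pl_map_imp_pw_affine) (auto simp: polytope_interval)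
  have fk': "f (k v) = v" if "v \<in> cbox a b" for v
    using that ab hom by (auto simp: homeomorphism_def)
  have "openin (top_of_set U) (U \<inter> f -` W)"
    using hom W(1) by (intro continuous_openin_preimage_gen) (auto simp: homeomorphism_def)
  then have "openin (top_of_set M) (U \<inter> f -` W)" using U(1) openin_trans by blast
  then obtain W' where W': "open W'" "U \<inter> f -` W = M \<inter> W'" by (auto simp: openin_open)
  show thesis
  proof
    show "M \<inter> W' \<subseteq> k ` cbox a b"
    proof
      fix y assume "y \<in> M \<inter> W'"
      then have y: "y \<in> U" "f y \<in> W" using W' by auto
      then have "f y \<in> V" "k (f y) = y" using hom by (auto simp: homeomorphism_def)
      then show "y \<in> k ` cbox a b" using y W(3) by (metis IntI image_eqI subsetD)
    qed
    show "pw_affine (k ` cbox a b) f" using pk fk' by (rule pw_affine_inverse)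
    show "x \<in> W'" using U W W' by blast
    show "k ` cbox a b \<subseteq> M" using sub U(1) openin_imp_subset by blast
  qed (use ab pk fk' W' in auto)
qed

lemma convex_Int_ball_nbhd:
  fixes C :: "'a::euclidean_space set"
  assumes "convex C" "x \<in> C" "open W" "x \<in> W"
  obtains D where "convex D" "x \<in> D" "D \<subseteq> C \<inter> W" "aff_dim D = aff_dim C"
proof -
  obtain e where e: "e > 0" "ball x e \<subseteq> W" using assms(3,4) open_contains_ball by blast
  show thesis
  proof
    show "aff_dim (C \<inter> ball x e) = aff_dim C"
      using assms e by (intro aff_dim_convex_Int_open) auto
  qed (use assms e in \<open>auto intro: convex_Int\<close>)
qed

text \<open>Restricting \<open>C\<close> to a small ball about \<open>x\<close> keeps its dimension,
  and \<open>pw_affine_convex_piece\<close> then selects a part on which \<open>f\<close> is affine.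
  Only the dimension is controlled; \<open>D\<close> may miss \<open>x\<close>.\<close>

lemma manifold_convex_chart:
  fixes M :: "'a::euclidean_space set" and f :: "'a \<Rightarrow> 'b::euclidean_space"
  assumes "pw_affine S f" "inj_on f S" "open W" "M \<inter> W \<subseteq> S" "convex C" "x \<in> C" "C \<subseteq> M" "x \<in> W"
  obtains D where "D \<subseteq> C \<inter> W" "convex (f ` D)" "D \<noteq> {}" "aff_dim (f ` D) = aff_dim C"
proof -
  obtain E where E: "convex E" "x \<in> E" "E \<subseteq> C \<inter> W" "aff_dim E = aff_dim C"
    using convex_Int_ball_nbhd assms by blast
  then have "E \<subseteq> S" using assms by blast
  then obtain D where D: "convex D" "D \<subseteq> E" "aff_dim D = aff_dim E" "affine_on D f"
    using pw_affine_convex_piece [OF assms(1) E(1)] E(2) by blast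
  show thesis
  proof
    show "aff_dim (f ` D) = aff_dim C"
      using D E(4) assms(2) \<open>E \<subseteq> S\<close> by (subst aff_dim_affine_injective_image) (auto intro: inj_on_subset)
    show "D \<noteq> {}"
    proof
      assume "D = {}"
      then have "E = {}" using D(3) by (simp add: aff_dim_empty)
      then show False using E(2) by simp
    qed
  qed (use D E in \<open>auto intro: convex_affine_image\<close>)
qed

lemma manifold_aff_dim_le:
  fixes M :: "'a::euclidean_space set"
  assumes M: "compact_pl_manifold TYPE('b::euclidean_space) M" and "convex C" "C \<subseteq> M"
  shows "aff_dim C \<le> int DIM('b)"
proof (cases "C = {}")
  case False
  then obtain x where x: "x \<in> C" by blast
  then have xM: "x \<in> M" using assms(3) by blast
  obtain a b :: 'b and k f W where ab: "box a b \<noteq> {}" and k: "pw_affine (cbox a b) k"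
    and kf: "pw_affine (k ` cbox a b) f" "\<And>v. v \<in> cbox a b \<Longrightarrow> f (k v) = v" "k ` cbox a b \<subseteq> M"
    "open W" "x \<in> W" "M \<inter> W \<subseteq> k ` cbox a b"
    by (rule manifold_box_chart [OF M xM]) (rule that; assumption)
  have "inj_on f (k ` cbox a b)" by (rule inj_on_inverseI [of _ k]) (use kf(2) in auto)
  then obtain D where "aff_dim (f ` D) = aff_dim C"
    using manifold_convex_chart [OF kf(1) _ kf(4,6) assms(2) x assms(3) kf(5)] by blast
  then show ?thesis by (metis aff_dim_le_DIM)
qed simp

text \<open>A point outside the closed union of the top-dimensional members has a chart
  neighbourhood covered by the remaining ones. The inverse chart \<open>k\<close> is affine and
  injective on a convex piece of full dimension there, so one of these members would have dimension
  at least \<open>DIM('b)\<close>.\<close>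

lemma manifold_pure:
  fixes M :: "'a::euclidean_space set"
  assumes M: "compact_pl_manifold TYPE('b::euclidean_space) M"
    and \<T>: "finite \<T>" "\<And>T. T \<in> \<T> \<Longrightarrow> polytope T" "\<Union>\<T> = M"
  shows "\<Union>{T\<in>\<T>. aff_dim T = int DIM('b)} = M"
proof (rule ccontr)
  let ?N = "\<Union>{T\<in>\<T>. aff_dim T = int DIM('b)}"
  assume "?N \<noteq> M"
  then obtain x where x: "x \<in> M" "x \<notin> ?N" using \<T>(3) by blast
  have "closed ?N" using \<T>(1,2) by (intro closed_Union) (auto intro: polytope_imp_closed)
  obtain a b :: 'b and k f W where ab: "box a b \<noteq> {}" and k: "pw_affine (cbox a b) k"
    and kf: "pw_affine (k ` cbox a b) f" "\<And>v. v \<in> cbox a b \<Longrightarrow> f (k v) = v" "k ` cbox a b \<subseteq> M"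
    "open W" "x \<in> W" "M \<inter> W \<subseteq> k ` cbox a b"
    by (rule manifold_box_chart [OF M x(1)]) (rule that; assumption)
  obtain v where v: "v \<in> cbox a b" "k v = x" using kf x by blast
  have "openin (top_of_set (cbox a b)) (cbox a b \<inter> k -` (- ?N))"
    using \<open>closed ?N\<close> by (intro continuous_openin_preimage_gen pw_affine_continuous [OF k]) auto
  then obtain W2 where W2: "open W2" "cbox a b \<inter> k -` (- ?N) = cbox a b \<inter> W2" by (auto simp: openin_open)
  have vW2: "v \<in> W2" using W2 v x by blast
  have dim: "aff_dim (cbox a b) = int DIM('b)"
    using aff_dim_subset [OF box_subset_cbox, of a b] aff_dim_open [OF open_box ab] aff_dim_le_DIM [of "cbox a b"] by simp
  have inj: "inj_on k (cbox a b)" by (rule inj_on_inverseI [of _ f]) (use kf(2) in auto)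
  obtain D where D: "D \<subseteq> cbox a b \<inter> W2" "convex (k ` D)" "D \<noteq> {}" "aff_dim (k ` D) = int DIM('b)"
    using manifold_convex_chart [OF k inj W2(1) _ convex_box(1) v(1) order_refl vW2] dim by auto
  have "k ` D \<subseteq> \<Union>{T\<in>\<T>. aff_dim T \<noteq> int DIM('b)}"
  proof
    fix y assume y: "y \<in> k ` D"
    then have "y \<notin> ?N" using D(1) W2(2) by blast
    moreover have "y \<in> M" using y D(1) kf(3) by blast
    ultimately show "y \<in> \<Union>{T\<in>\<T>. aff_dim T \<noteq> int DIM('b)}" using \<T>(3) by blast
  qed
  then obtain T where T: "T \<in> {T\<in>\<T>. aff_dim T \<noteq> int DIM('b)}" "aff_dim (k ` D) \<le> aff_dim T"
    by (rule aff_dim_convex_subset_Union [rotated 3]) (use \<T> D in auto)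
  moreover have "aff_dim T \<le> int DIM('b)"
    using T \<T> by (intro manifold_aff_dim_le [OF M]) (auto intro: polytope_imp_convex)
  ultimately show False using D(4) by auto
qed

text \<open>Split \<open>\<T>\<close> into the polytopes reachable from \<open>X\<close> and the
  others. By connectedness the two unions meet at some \<open>x\<close>, but only in sets of
  codimension two. Removing these does not disconnect a chart box at \<open>x\<close>, so one of the
  classes would occupy only such sets within the box, which its dimension forbids.\<close>

lemma manifold_strongly_connected:
  fixes M :: "'a::euclidean_space set"
  assumes M: "compact_pl_manifold TYPE('b::euclidean_space) M" and con: "connected M"
    and \<T>: "finite \<T>" "\<And>T. T \<in> \<T> \<Longrightarrow> polytope T" "\<Union>\<T> = M" "\<And>T. T \<in> \<T> \<Longrightarrow> aff_dim T = int DIM('b)"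
    and face: "\<And>X Y. X \<in> \<T> \<Longrightarrow> Y \<in> \<T> \<Longrightarrow> X \<inter> Y face_of X"
    and X: "X \<in> \<T>" and Y: "Y \<in> \<T>"
  shows "(X,Y) \<in> {(X,Y). X \<in> \<T> \<and> Y \<in> \<T> \<and> aff_dim (X \<inter> Y) = int DIM('b) - 1}\<^sup>*"
    (is "_ \<in> ?R\<^sup>*")
proof (rule ccontr)
  assume XY: "(X,Y) \<notin> ?R\<^sup>*"
  define \<C> where "\<C> = {Z\<in>\<T>. (X,Z) \<in> ?R\<^sup>*}"
  define \<D> where "\<D> = \<T> - \<C>"
  have CD: "\<T> = \<C> \<union> \<D>" "X \<in> \<C>" "Y \<in> \<D>" using X Y XY by (auto simp: \<C>_def \<D>_def)
  have fin: "finite \<C>" "finite \<D>" using \<T>(1) CD(1) by auto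
  have ne: "T \<noteq> {}" if "T \<in> \<T>" for T using \<T>(4) [OF that] by auto
  have cl: "closed (\<Union>\<C>)" "closed (\<Union>\<D>)"
    using fin CD(1) \<T>(2) polytope_imp_closed by (auto intro!: closed_Union)
  \<comment> \<open>The intersection is a proper face of one of the two, hence of dimension below
    \<open>DIM('b)\<close>; dimension \<open>DIM('b) - 1\<close> would make \<open>Z'\<close>
    reachable.\<close>
  have low: "aff_dim (Z \<inter> Z') \<le> int DIM('b) - 2" if Z: "Z \<in> \<C>" "Z' \<in> \<D>" for Z Z'
  proof -
    have ZZ: "Z \<in> \<T>" "Z' \<in> \<T>" using Z CD by auto
    have "Z \<noteq> Z'" using Z by (auto simp: \<D>_def)
    have "(Z,Z') \<notin> ?R"
    proof
      assume "(Z,Z') \<in> ?R"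
      then have "(X,Z') \<in> ?R\<^sup>*" using Z(1) by (auto simp: \<C>_def intro: rtrancl.rtrancl_into_rtrancl)
      then show False using Z(2) ZZ by (auto simp: \<D>_def \<C>_def)
    qed
    then have "aff_dim (Z \<inter> Z') \<noteq> int DIM('b) - 1" using ZZ by auto
    moreover have "aff_dim (Z \<inter> Z') < int DIM('b)"
    proof -
      have "Z \<inter> Z' \<noteq> Z \<or> Z' \<inter> Z \<noteq> Z'" using \<open>Z \<noteq> Z'\<close> by blast
      then have "aff_dim (Z \<inter> Z') < aff_dim Z \<or> aff_dim (Z' \<inter> Z) < aff_dim Z'"
        using face_of_aff_dim_lt face ZZ \<T>(2) polytope_imp_convex by metis
      then show ?thesis using \<T>(4) ZZ by (simp add: inf_commute)
    qed
    ultimately show ?thesis by linarith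
  qed
  have "\<Union>\<C> \<inter> \<Union>\<D> \<noteq> {}"
  proof
    assume "\<Union>\<C> \<inter> \<Union>\<D> = {}"
    then have "\<Union>\<C> \<inter> M = {} \<or> \<Union>\<D> \<inter> M = {}"
      using cl con \<T>(3) CD(1) by (intro connected_closedD) auto
    moreover have "X \<subseteq> \<Union>\<C> \<inter> M" "Y \<subseteq> \<Union>\<D> \<inter> M" using CD \<T>(3) by auto
    ultimately show False using ne X Y by blast
  qed
  then obtain x P0 Q0 where x: "P0 \<in> \<C>" "x \<in> P0" "Q0 \<in> \<D>" "x \<in> Q0" by blast
  then have "x \<in> M" using CD \<T>(3) by blast
  obtain a b :: 'b and k f W where ab: "box a b \<noteq> {}" and k: "pw_affine (cbox a b) k"
    and kf: "pw_affine (k ` cbox a b) f" "\<And>v. v \<in> cbox a b \<Longrightarrow> f (k v) = v" "k ` cbox a b \<subseteq> M"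
    "open W" "x \<in> W" "M \<inter> W \<subseteq> k ` cbox a b"
    by (rule manifold_box_chart [OF M \<open>x \<in> M\<close>]) (rule that; assumption)
  have inj: "inj_on f (k ` cbox a b)" by (rule inj_on_inverseI [of _ k]) (use kf(2) in auto)
  obtain \<P> where \<P>: "finite \<P>" "k ` cbox a b = \<Union>\<P>" "\<And>P. P \<in> \<P> \<Longrightarrow> polytope P" "\<And>P. P \<in> \<P> \<Longrightarrow> affine_on P f"
    by (rule pw_affineE [OF kf(1)]) (rule that; assumption)
  \<comment> \<open>The chart \<open>f\<close> is affine only on each \<open>P\<close>, so the
    intersections are cut by these pieces before affine hulls are taken in the chart.\<close>
  define \<A> where "\<A> = (\<lambda>(P,Z,Z'). affine hull (f ` (P \<inter> (Z \<inter> Z')))) ` (\<P> \<times> \<C> \<times> \<D>)"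
  have finA: "finite \<A>" unfolding \<A>_def using fin \<P>(1) by simp
  have dimA: "affine A \<and> aff_dim A \<le> int DIM('b) - 2" if A: "A \<in> \<A>" for A
  proof -
    obtain P Z Z' where A: "P \<in> \<P>" "Z \<in> \<C>" "Z' \<in> \<D>" "A = affine hull (f ` (P \<inter> (Z \<inter> Z')))"
      using A by (auto simp: \<A>_def)
    have "aff_dim (f ` (P \<inter> (Z \<inter> Z'))) \<le> aff_dim (P \<inter> (Z \<inter> Z'))"
      using A \<P>(4) by (intro aff_dim_affine_image_le) (auto intro: affine_on_subset)
    also have "\<dots> \<le> aff_dim (Z \<inter> Z')" by (rule aff_dim_subset) auto
    finally show ?thesis using low A by (auto intro: order_trans)
  qed
  have dim: "aff_dim (cbox a b) = int DIM('b)"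
    using aff_dim_subset [OF box_subset_cbox, of a b] aff_dim_open [OF open_box ab] aff_dim_le_DIM [of "cbox a b"] by simp
  have con': "connected (cbox a b - \<Union>\<A>)"
    by (rule connected_convex_diff_affine) (use finA dimA dim in force)+
  define S1 S2 where "S1 = cbox a b \<inter> k -` \<Union>\<C>" and "S2 = cbox a b \<inter> k -` \<Union>\<D>"
  have "closed S1" "closed S2"
    unfolding S1_def S2_def using cl pw_affine_continuous [OF k] by (auto intro!: continuous_closed_preimage)
  moreover have "cbox a b \<subseteq> S1 \<union> S2" 
  proof
    fix v assume v: "v \<in> cbox a b"
    then have "k v \<in> \<Union>\<C> \<union> \<Union>\<D>" using kf(3) \<T>(3) CD(1) by blast
    then show "v \<in> S1 \<union> S2" using v by (auto simp: S1_def S2_def)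
  qed
  moreover have "S1 \<inter> S2 \<subseteq> \<Union>\<A>"
  proof
    fix v assume v: "v \<in> S1 \<inter> S2"
    then have "k v \<in> \<Union>\<P>" using \<P>(2) by (auto simp: S1_def)
    then obtain P Z Z' where "P \<in> \<P>" "k v \<in> P" "Z \<in> \<C>" "k v \<in> Z" "Z' \<in> \<D>" "k v \<in> Z'"
      using v by (auto simp: S1_def S2_def)
    moreover have "v = f (k v)" using v kf(2) by (auto simp: S1_def)
    ultimately have "v \<in> affine hull (f ` (P \<inter> (Z \<inter> Z')))" "(P,Z,Z') \<in> \<P> \<times> \<C> \<times> \<D>"
      by (auto intro!: hull_inc)
    then show "v \<in> \<Union>\<A>"
      unfolding \<A>_def UN_iff by (intro bexI [of _ "(P,Z,Z')"]) simp_all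
  qed
  ultimately have "S1 \<inter> (cbox a b - \<Union>\<A>) = {} \<or> S2 \<inter> (cbox a b - \<Union>\<A>) = {}"
    using con' by (intro connected_closedD) auto
  moreover have "S1 \<subseteq> cbox a b" "S2 \<subseteq> cbox a b" by (simp_all add: S1_def S2_def)
  ultimately have cases: "S1 \<subseteq> \<Union>\<A> \<or> S2 \<subseteq> \<Union>\<A>" by blast
  \<comment> \<open>A polytope containing \<open>x\<close> has, near \<open>x\<close>, a part whose
    image in the chart is convex of full dimension, too large for finitely many members of
    \<open>\<A>\<close>.\<close>
  have big: "\<not> cbox a b \<inter> k -` Z \<subseteq> \<Union>\<A>" if Z: "Z \<in> \<T>" "x \<in> Z" for Z
  proof
    assume sub: "cbox a b \<inter> k -` Z \<subseteq> \<Union>\<A>"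
    obtain D where D: "D \<subseteq> Z \<inter> W" "convex (f ` D)" "D \<noteq> {}" "aff_dim (f ` D) = aff_dim Z"
    proof (rule manifold_convex_chart [OF kf(1) inj kf(4,6) _ Z(2) _ kf(5)])
      show "convex Z" using \<T>(2) Z(1) polytope_imp_convex by blast
      show "Z \<subseteq> M" using \<T>(3) Z(1) by blast
    qed (rule that; assumption)
    have "D \<subseteq> k ` cbox a b" using D(1) kf(6) Z(1) \<T>(3) by blast
    then have "f ` D \<subseteq> cbox a b \<inter> k -` Z" using kf(2) D(1) by fastforce
    then have "f ` D \<subseteq> \<Union>\<A>" using sub by blast
    then obtain A where "A \<in> \<A>" "aff_dim (f ` D) \<le> aff_dim A"
      by (rule aff_dim_convex_subset_Union [rotated 3]) (use finA D in auto)
    then show False using dimA D(4) \<T>(4) [OF Z(1)] by fastforce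
  qed
  have "cbox a b \<inter> k -` P0 \<subseteq> S1" "cbox a b \<inter> k -` Q0 \<subseteq> S2" using x by (auto simp: S1_def S2_def)
  then show False using cases big [of P0] big [of Q0] x CD(1) by blast
qed

subsection \<open>Linear images of Lebesgue measure\<close>

lemma lborel_translation:
  fixes a :: "'a::euclidean_space"
  shows "distr lborel borel ((+) a) = (lborel :: 'a measure)"
  using lborel_affine [of 1 a] by (simp add: density_1 o_def)

lemma emeasure_lborel_translation_image:
  fixes a :: "'a::euclidean_space"
  assumes "A \<in> sets borel"
  shows "emeasure lborel ((+) a ` A) = emeasure lborel A"
proof -
  have "emeasure lborel A = emeasure (distr lborel borel ((+) (-a))) A" by (simp add: lborel_translation)
  also have "\<dots> = emeasure lborel ((+) (-a) -` A)" using assms by (simp add: emeasure_distr)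
  also have "(+) (-a) -` A = (+) a ` A" by (force simp: image_iff)
  finally show ?thesis ..
qed

text \<open>Uniqueness of translation invariant measure: with \<open>C\<close> the unit ball, the
  double integral of \<open>indicator A x * indicator C (-x + y)\<close> is evaluated in both
  orders, and invariance of the inner measure decouples the two factors each time.\<close>

lemma translation_invariant_borel_measure:
  fixes M :: "'a::euclidean_space measure"
  assumes sets_M [measurable_cong]: "sets M = sets borel" and sf: "sigma_finite_measure M"
    and inv: "\<And>a. distr M borel ((+) a) = M"
    and A [measurable]: "A \<in> sets borel"
  shows "emeasure M A * emeasure lborel (ball (0::'a) 1) = emeasure M (ball 0 1) * emeasure lborel A"
proof -
  interpret sigma_finite_measure M by (rule sf)
  interpret pair_sigma_finite M lborel ..
  define C where "C = ball (0::'a) 1"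
  have [measurable]: "C \<in> sets borel" by (simp add: C_def)
  have trM: "(\<integral>\<^sup>+x. f (a + x) \<partial>M) = (\<integral>\<^sup>+x. f x \<partial>M)" if [measurable]: "f \<in> borel_measurable borel" for f :: "'a \<Rightarrow> ennreal" and a
    by (subst inv [of a, symmetric], subst nn_integral_distr) auto
  have trL: "(\<integral>\<^sup>+x. f (a + x) \<partial>lborel) = (\<integral>\<^sup>+x. f x \<partial>lborel)" if [measurable]: "f \<in> borel_measurable borel" for f :: "'a \<Rightarrow> ennreal" and a
    by (subst lborel_translation [of a, symmetric], subst nn_integral_distr) auto
  have "emeasure M A * emeasure lborel C = (\<integral>\<^sup>+x. indicator A x * emeasure lborel C \<partial>M)"
    by (subst nn_integral_multc) auto
  also have "\<dots> = (\<integral>\<^sup>+x. (\<integral>\<^sup>+y. indicator A x * indicator C (-x + y) \<partial>lborel) \<partial>M)"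
  proof (rule nn_integral_cong)
    fix x
    have "(\<integral>\<^sup>+y. indicator A x * indicator C (-x + y) \<partial>lborel) = (\<integral>\<^sup>+y. indicator A x * indicator C y \<partial>lborel)"
      by (rule trL) measurable
    also have "\<dots> = indicator A x * emeasure lborel C"
      by (subst nn_integral_cmult) auto
    finally show "indicator A x * emeasure lborel C = (\<integral>\<^sup>+y. indicator A x * indicator C (-x + y) \<partial>lborel)" ..
  qed
  also have "\<dots> = (\<integral>\<^sup>+y. (\<integral>\<^sup>+x. indicator A x * indicator C (-x + y) \<partial>M) \<partial>lborel)"
    by (rule Fubini' [symmetric]) measurable
  also have "\<dots> = (\<integral>\<^sup>+y. (\<integral>\<^sup>+x. indicator A (y + x) * indicator C x \<partial>M) \<partial>lborel)"
  proof (rule nn_integral_cong)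
    fix y
    have "(\<integral>\<^sup>+x. indicator A x * indicator C (-x + y) \<partial>M) = (\<integral>\<^sup>+x. indicator A (y + x) * indicator C (-(y + x) + y) \<partial>M)"
      by (rule trM [symmetric]) measurable
    \<comment> \<open>The shift turns \<open>indicator C (-x + y)\<close> into
      \<open>indicator C (-x)\<close>, and the ball is symmetric.\<close>
    then show "(\<integral>\<^sup>+x. indicator A x * indicator C (-x + y) \<partial>M) = (\<integral>\<^sup>+x. indicator A (y + x) * indicator C x \<partial>M)"
      by (simp add: indicator_def C_def)
  qed
  also have "\<dots> = (\<integral>\<^sup>+x. (\<integral>\<^sup>+y. indicator A (y + x) * indicator C x \<partial>lborel) \<partial>M)"
    by (rule Fubini') measurable
  also have "\<dots> = (\<integral>\<^sup>+x. emeasure lborel A * indicator C x \<partial>M)"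
  proof (rule nn_integral_cong)
    fix x
    have "(\<integral>\<^sup>+y. indicator A (x + y) * indicator C x \<partial>lborel) = (\<integral>\<^sup>+y. indicator A y * indicator C x \<partial>lborel)"
      by (rule trL) measurable
    also have "\<dots> = emeasure lborel A * indicator C x"
      by (subst nn_integral_multc) auto
    finally show "(\<integral>\<^sup>+y. indicator A (y + x) * indicator C x \<partial>lborel) = emeasure lborel A * indicator C x"
      by (simp add: add.commute)
  qed
  also have "\<dots> = emeasure lborel A * emeasure M C"
    by (subst nn_integral_cmult) auto
  finally show ?thesis by (simp add: mult.commute C_def)
qed

lemma emeasure_lborel_open_pos:
  fixes S :: "'a::euclidean_space set"
  assumes "open S" "S \<noteq> {}"
  shows "emeasure lborel S > 0"
proof (rule ccontr)
  assume "\<not> ?thesis"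
  then have "S \<in> null_sets lborel" using assms(1) by auto
  then have "negligible S"
    using null_sets_completionI by (auto simp: negligible_iff_null_sets)
  then show False using open_not_negligible assms by blast
qed

lemma ennreal_positive_finiteE:
  assumes "0 < x" "x < (\<infinity>::ennreal)"
  obtains u where "x = ennreal u" "u > 0"
  using assms by (cases x) (auto simp: less_le)

lemma linear_bij_inverse:
  fixes T :: "'a::euclidean_space \<Rightarrow> 'a"
  assumes "linear T" "inj T"
  obtains T' where "linear T'" "\<And>x. T' (T x) = x" "\<And>x. T (T' x) = x"
proof -
  obtain T' where "linear T'" "\<forall>x. T' (T x) = x" "\<forall>x. T (T' x) = x"
    using linear_injective_isomorphism [OF assms] by blast
  then show ?thesis using that by blast
qed

lemma linear_measurable:
  fixes T :: "'a::euclidean_space \<Rightarrow> 'b::euclidean_space"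
  assumes "linear T" shows "T \<in> borel_measurable borel"
  using assms by (intro borel_measurable_continuous_onI linear_continuous_on)
     (simp add: linear_conv_bounded_linear)

lemma linear_image_borel:
  fixes T :: "'a::euclidean_space \<Rightarrow> 'a"
  assumes "linear T" "inj T" "A \<in> sets borel"
  shows "T ` A \<in> sets borel"
proof -
  obtain T' where T': "linear T'" "\<And>x. T' (T x) = x" "\<And>x. T (T' x) = x"
    using linear_bij_inverse assms by blast
  have "T ` A = T' -` A \<inter> space borel" using T' by (auto simp: image_iff) metis
  then show ?thesis using linear_measurable [OF T'(1)] assms(3) by (metis measurable_sets)
qed

text \<open>Pushing Lebesgue measure forward along the inverse of \<open>T\<close> gives a
  translation invariant measure, which is therefore proportional to Lebesgue measure; the factor is
  the ratio at the unit ball.\<close>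

lemma emeasure_linear_image:
  fixes T :: "'a::euclidean_space \<Rightarrow> 'a"
  assumes T: "linear T" "inj T"
  obtains k where "k > 0" "\<And>A. A \<in> sets borel \<Longrightarrow> emeasure lborel (T ` A) = ennreal k * emeasure lborel A"
proof -
  obtain T' where T': "linear T'" "\<And>x. T' (T x) = x" "\<And>x. T (T' x) = x"
    using linear_bij_inverse T by blast
  have [measurable]: "T' \<in> borel_measurable borel" "T \<in> borel_measurable borel"
    using T T' linear_measurable by auto
  define M where "M = distr lborel borel T'"
  have sets_M: "sets M = sets borel" by (simp add: M_def)
  have M: "emeasure M A = emeasure lborel (T ` A)" if A: "A \<in> sets borel" for A
  proof -
    have "T' -` A = T ` A" using T' by (auto simp: image_iff) metis
    then show ?thesis using A by (simp add: M_def emeasure_distr)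
  qed
  have fin: "emeasure M (cball 0 r) < \<infinity>" for r
    unfolding M [OF borel_closed [OF closed_cball]]
    using T(1) by (intro emeasure_bounded_finite bounded_linear_image) (auto simp: linear_conv_bounded_linear)
  have sf: "sigma_finite_measure M"
  proof
    show "\<exists>A. countable A \<and> A \<subseteq> sets M \<and> \<Union>A = space M \<and> (\<forall>a\<in>A. emeasure M a \<noteq> \<infinity>)"
    proof (intro exI [of _ "range (\<lambda>n. cball 0 (real n))"] conjI ballI)
      show "\<Union> (range (\<lambda>n. cball (0::'a) (real n))) = space M"
        using real_arch_simple by (auto simp: M_def)
    qed (use fin in \<open>auto simp: M_def less_top\<close>)
  qed
  have inv: "distr M borel ((+) a) = M" for a
  proof -
    have "distr M borel ((+) a) = distr lborel borel ((+) a \<circ> T')"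
      unfolding M_def by (rule distr_distr) auto
    also have "(+) a \<circ> T' = T' \<circ> (+) (T a)"
      using T' by (auto simp: linear_add)
    also have "distr lborel borel (T' \<circ> (+) (T a)) = distr (distr lborel borel ((+) (T a))) borel T'"
      by (rule distr_distr [symmetric]) auto
    finally show ?thesis by (simp add: lborel_translation M_def)
  qed
  let ?C = "ball (0::'a) 1"
  have "open (T ` ?C)"
    using T by (intro open_surjective_linear_image) (auto simp: linear_injective_imp_surjective)
  then have pos: "emeasure lborel (T ` ?C) > 0" by (intro emeasure_lborel_open_pos) auto
  have fC: "emeasure lborel (T ` ?C) < \<infinity>"
    using T(1) by (intro emeasure_bounded_finite bounded_linear_image) (auto simp: linear_conv_bounded_linear)
  have pC: "emeasure lborel ?C > 0" by (intro emeasure_lborel_open_pos) auto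
  have fC': "emeasure lborel ?C < \<infinity>" by (intro emeasure_bounded_finite) auto
  obtain u where u: "emeasure lborel (T ` ?C) = ennreal u" "u > 0"
    by (rule ennreal_positive_finiteE [OF pos fC])
  obtain v where v: "emeasure lborel ?C = ennreal v" "v > 0"
    by (rule ennreal_positive_finiteE [OF pC fC'])
  show thesis
  proof
    show "u / v > 0" using u v by simp
    show "emeasure lborel (T ` A) = ennreal (u / v) * emeasure lborel A" if A: "A \<in> sets borel" for A
    proof -
      have "emeasure lborel (T ` A) * ennreal v = ennreal u * emeasure lborel A"
        using translation_invariant_borel_measure [OF sets_M sf inv A] M A u v by simp
      then have "emeasure lborel (T ` A) * ennreal v * ennreal (1/v) = ennreal u * emeasure lborel A * ennreal (1/v)"
        by simp
      moreover have "ennreal v * ennreal (1/v) = 1" using v by (simp flip: ennreal_mult)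
      moreover have "ennreal u * ennreal (1/v) = ennreal (u/v)" using u v by (simp flip: ennreal_mult)
      ultimately show ?thesis by (metis mult.assoc mult.commute mult.right_neutral)
    qed
  qed
qed

text \<open>Let \<open>D\<close> double the component along \<open>e\<close>. Since
  \<open>l e = 0\<close>, the linear shear satisfies \<open>D (T x) = T (T (D x))\<close>, so the
  volume factors \<open>k\<close> of \<open>T\<close> and \<open>d\<close> of \<open>D\<close>
  satisfy \<open>d * k = k * k * d\<close>, whence \<open>k = 1\<close>.\<close>

lemma emeasure_shear_image:
  fixes e :: "'a::euclidean_space" and l :: "'a \<Rightarrow> real"
  assumes l: "linear l" "l e = 0" and A: "A \<in> sets borel"
  shows "emeasure lborel ((\<lambda>x. x + (l x + c) *\<^sub>R e) ` A) = emeasure lborel A"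
proof (cases "e = 0")
  case False
  define T where "T = (\<lambda>x. x + l x *\<^sub>R e)"
  define D where "D = (\<lambda>x. x + ((x \<bullet> e) / (e \<bullet> e)) *\<^sub>R e)"
  have linT: "linear T" and linD: "linear D"
    unfolding T_def D_def using l(1)
    by (intro linearI; simp add: linear_add linear_scale inner_add_left algebra_simps add_divide_distrib)+
  have injT: "inj T"
  proof (rule inj_on_inverseI)
    show "T x - l (T x) *\<^sub>R e = x" for x
      using l by (simp add: T_def linear_add linear_scale)
  qed
  have injD: "inj D"
  proof (rule inj_on_inverseI)
    show "D x - ((D x \<bullet> e) / (2 * (e \<bullet> e))) *\<^sub>R e = x" for x
      using False by (simp add: D_def inner_add_left field_simps)
  qed
  have DT: "D (T x) = T (T (D x))" for x
    using False l by (simp add: D_def T_def linear_add linear_scale inner_add_left algebra_simps add_divide_distrib)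
  obtain k where k: "k > 0" "\<And>A. A \<in> sets borel \<Longrightarrow> emeasure lborel (T ` A) = ennreal k * emeasure lborel A"
    by (rule emeasure_linear_image [OF linT injT]) (rule that; assumption)
  obtain d where d: "d > 0" "\<And>A. A \<in> sets borel \<Longrightarrow> emeasure lborel (D ` A) = ennreal d * emeasure lborel A"
    by (rule emeasure_linear_image [OF linD injD]) (rule that; assumption)
  let ?C = "ball (0::'a) 1"
  have pC: "emeasure lborel ?C > 0" by (intro emeasure_lborel_open_pos) auto
  have fC': "emeasure lborel ?C < \<infinity>" by (intro emeasure_bounded_finite) auto
  obtain v where v: "emeasure lborel ?C = ennreal v" "v > 0"
    by (rule ennreal_positive_finiteE [OF pC fC'])
  have "emeasure lborel (D ` T ` ?C) = emeasure lborel (T ` T ` D ` ?C)"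
    by (simp add: image_image DT)
  moreover have "emeasure lborel (D ` T ` ?C) = ennreal (d * k * v)"
    using k(1) d(1) v by (simp add: d(2) k(2) linear_image_borel [OF linT injT] ennreal_mult mult.assoc)
  moreover have "emeasure lborel (T ` T ` D ` ?C) = ennreal (k * k * d * v)"
    using k(1) d(1) v by (simp add: d(2) k(2) linear_image_borel [OF linT injT] linear_image_borel [OF linD injD] ennreal_mult mult.assoc)
  ultimately have "d * k * v = k * k * d * v"
    using k(1) d(1) v(2) by (simp add: ennreal_inj)
  then have "k = 1" using k(1) d(1) v(2) by simp
  have "(\<lambda>x. x + (l x + c) *\<^sub>R e) ` A = (+) (c *\<^sub>R e) ` T ` A"
    by (auto simp: T_def image_image algebra_simps)
  then have "emeasure lborel ((\<lambda>x. x + (l x + c) *\<^sub>R e) ` A) = emeasure lborel ((+) (c *\<^sub>R e) ` T ` A)" by simp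
  also have "\<dots> = emeasure lborel (T ` A)"
    by (rule emeasure_lborel_translation_image) (rule linear_image_borel [OF linT injT A])
  also have "\<dots> = emeasure lborel A" using k(2) A \<open>k = 1\<close> by simp
  finally show ?thesis .
qed simp

lemma emeasure_diagonal_image:
  fixes c :: "'a::euclidean_space \<Rightarrow> real"
  assumes c: "\<And>j. j \<in> Basis \<Longrightarrow> c j \<noteq> 0" and A: "A \<in> sets borel"
  shows "emeasure lborel ((\<lambda>x. t + (\<Sum>j\<in>Basis. (c j * (x \<bullet> j)) *\<^sub>R j)) ` A) = ennreal (\<Prod>j\<in>Basis. \<bar>c j\<bar>) * emeasure lborel A"
proof -
  define T where "T = (\<lambda>x. t + (\<Sum>j\<in>Basis. (c j * (x \<bullet> j)) *\<^sub>R j))"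
  define T' where "T' = (\<lambda>x. \<Sum>j\<in>Basis. (((x - t) \<bullet> j) / c j) *\<^sub>R j)"
  have T'T: "T' (T x) = x" for x
    by (rule euclidean_eqI) (use c in \<open>simp add: T_def T'_def\<close>)
  have TT': "T (T' x) = x" for x
    by (rule euclidean_eqI) (use c in \<open>simp add: T_def T'_def inner_add_left inner_diff_left\<close>)
  have [measurable]: "T \<in> borel_measurable borel" "T' \<in> borel_measurable borel"
    unfolding T_def T'_def by measurable
  have im: "T ` B = T' -` B" for B using T'T TT' by (auto simp: image_iff) metis
  have B: "T ` A \<in> sets borel" unfolding im using A measurable_sets [of T' borel borel A] by simp
  have "lborel = density (distr lborel borel T) (\<lambda>_. (\<Prod>j\<in>Basis. \<bar>c j\<bar>))"
    unfolding T_def using c by (rule lborel_affine_euclidean)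
  then have "emeasure lborel (T ` A) = emeasure (density (distr lborel borel T) (\<lambda>_. (\<Prod>j\<in>Basis. \<bar>c j\<bar>))) (T ` A)"
    by simp
  also have "\<dots> = ennreal (\<Prod>j\<in>Basis. \<bar>c j\<bar>) * emeasure lborel (T -` T ` A)"
    using B by (simp add: emeasure_density nn_integral_cmult emeasure_distr)
  also have "T -` T ` A = A" using T'T by (metis inj_on_def inj_vimage_image_eq)
  finally show ?thesis by (simp add: T_def)
qed

text \<open>Compactness makes the inverse continuous, so the image of \<open>A\<close> is the
  preimage of \<open>A\<close> under a continuous map on a compact set.\<close>

lemma compact_injective_image_borel:
  fixes f :: "'a::euclidean_space \<Rightarrow> 'b::euclidean_space"
  assumes S: "compact S" "continuous_on S f" "inj_on f S" and A: "A \<in> sets borel" "A \<subseteq> S"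
  shows "f ` A \<in> sets borel"
proof -
  have inv: "continuous_on (f ` S) (inv_into S f)"
    using S by (intro continuous_on_inv) auto
  have fS: "f ` S \<in> sets borel"
    using S by (intro borel_closed compact_imp_closed compact_continuous_image)
  have "f ` A = inv_into S f -` A \<inter> f ` S"
    using A(2) S(3) by (auto simp: inv_into_f_f)
  moreover have "inv_into S f -` A \<inter> f ` S \<in> sets borel"
    using borel_measurable_continuous_on_restrict [OF inv] A(1) fS
    by (auto simp: measurable_def sets_restrict_space_iff space_restrict_space)
  ultimately show ?thesis by simp
qed

lemma convex_full_dim_interior:
  fixes S :: "'a::euclidean_space set"
  assumes "convex S" "aff_dim S = int DIM('a)"
  shows "interior S \<noteq> {}"
proof -
  have "affine hull S = UNIV" using assms(2) by (simp flip: aff_dim_eq_full)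
  then have "rel_interior S = interior S" by (rule rel_interior_interior)
  moreover have "S \<noteq> {}" using assms(2) by auto
  ultimately show ?thesis using rel_interior_eq_empty [OF assms(1)] by simp
qed

text \<open>Two affine embeddings of \<open>S\<close> differ by an affine map, whose linear part is
  injective because the image of \<open>S\<close> under \<open>f\<close> has interior points. The
  Lebesgue measures pulled back along them are thus proportional, so a simplicial measure is
  determined on a top-dimensional simplex by one number.\<close>

lemma emeasure_affine_change:
  fixes f g :: "'a::euclidean_space \<Rightarrow> 'b::euclidean_space"
  assumes S: "polytope S" "aff_dim S = int DIM('b)"
    and f: "affine_on S f" "inj_on f S" and g: "affine_on S g" "inj_on g S"
  obtains k where "k > 0"
    "\<And>A. A \<in> sets borel \<Longrightarrow> A \<subseteq> S \<Longrightarrow> emeasure lebesgue (g ` A) = ennreal k * emeasure lebesgue (f ` A)"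
proof -
  have conv: "convex S" using S polytope_imp_convex by blast
  define h where "h = inv_into S f"
  have hf: "h (f x) = x" if "x \<in> S" for x using that f(2) by (simp add: h_def)
  have fh: "f (h y) = y" and hS: "h y \<in> S" if "y \<in> f ` S" for y
    using that hf by auto
  have "affine_on (f ` S) h" by (rule affine_on_inverse) (use conv f hf in auto)
  then have "affine_on (f ` S) (\<lambda>x. g (h x))"
    by (rule affine_on_compose [OF _ g(1)]) (auto simp: hf)
  then obtain l c where l: "linear l" "\<And>y. y \<in> f ` S \<Longrightarrow> g (h y) = l y + c"
    unfolding affine_on_def by blast
  have "aff_dim (f ` S) = int DIM('b)" using S conv f aff_dim_affine_injective_image by metis
  then have "interior (f ` S) \<noteq> {}"
    using convex_full_dim_interior convex_affine_image conv f by blast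
  then obtain x e where e: "e > 0" "cball x e \<subseteq> f ` S"
    by (meson mem_interior_cball ex_in_conv)
  have inj: "inj l"
  proof (subst linear_injective_0 [OF l(1)], intro allI impI)
    fix v assume v: "l v = 0"
    define t where "t = e / (norm v + 1)"
    have t: "t > 0" using e by (simp add: t_def add_nonneg_pos)
    have "norm (t *\<^sub>R v) = e * (norm v / (norm v + 1))"
      using e by (simp add: t_def abs_of_pos add_nonneg_pos)
    also have "\<dots> \<le> e * 1"
      using e by (intro mult_left_mono) (auto simp: divide_le_eq_1 add_nonneg_pos)
    finally have "x + t *\<^sub>R v \<in> f ` S" using e(2) by (auto simp: dist_norm)
    moreover have "x \<in> f ` S" using e by auto
    moreover have "l (x + t *\<^sub>R v) = l x" using v l(1) by (simp add: linear_add linear_scale)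
    ultimately have "g (h (x + t *\<^sub>R v)) = g (h x)" using l(2) by simp
    then have "h (x + t *\<^sub>R v) = h x"
      using hS \<open>x + t *\<^sub>R v \<in> f ` S\<close> \<open>x \<in> f ` S\<close> by (intro inj_onD [OF g(2)])
    then have "x + t *\<^sub>R v = x"
      using \<open>x + t *\<^sub>R v \<in> f ` S\<close> \<open>x \<in> f ` S\<close> fh by metis
    then show "v = 0" using t by simp
  qed
  obtain k where k: "k > 0" "\<And>A. A \<in> sets borel \<Longrightarrow> emeasure lborel (l ` A) = ennreal k * emeasure lborel A"
    by (rule emeasure_linear_image [OF l(1) inj]) (rule that; assumption)
  show thesis
  proof
    show "k > 0" by (rule k)
    fix A assume A: "A \<in> sets borel" "A \<subseteq> S"
    have b: "f ` A \<in> sets borel" "g ` A \<in> sets borel"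
      using A S f g by (auto intro!: compact_injective_image_borel [of S] polytope_imp_compact affine_on_continuous)
    have "g ` A = (\<lambda>y. c + l y) ` f ` A"
      unfolding image_image
    proof (rule image_cong)
      fix x assume "x \<in> A"
      then have "x \<in> S" using A by blast
      then show "g x = c + l (f x)" using l(2) [of "f x"] hf by simp
    qed simp
    then have eq: "g ` A = (+) c ` l ` f ` A" by (simp add: image_image)
    have "emeasure lborel (g ` A) = emeasure lborel (l ` f ` A)"
      unfolding eq by (rule emeasure_lborel_translation_image) (rule linear_image_borel [OF l(1) inj b(1)])
    then show "emeasure lebesgue (g ` A) = ennreal k * emeasure lebesgue (f ` A)"
      using b k(2) by simp
  qed
qed

subsection \<open>Coordinates on a simplex with a distinguished facet\<close>

locale facet_chart =
  fixes e :: "'b::euclidean_space" and f :: "'b \<Rightarrow> 'a::euclidean_space"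
  assumes e: "e \<in> Basis" and inj_f: "inj_on f Basis"
begin

text \<open>The facet has the vertices \<open>f i\<close>.  In the model, its vertices are \<open>0\<close> (for \<open>i = e\<close>) and the other
  basis vectors, so that \<open>bary z\<close> are the barycentric coordinates of the projection of \<open>z\<close> along
  \<open>e\<close>; the apex \<open>p\<close> lies over the barycentre of the facet at height \<open>a\<close>, which is negative for the lower
  half of a bipyramid.\<close>

definition bvec :: "'b \<Rightarrow> 'b" where
  "bvec i = (if i = e then - (\<Sum>j\<in>Basis-{e}. j) else i)"

definition bary :: "'b \<Rightarrow> 'b \<Rightarrow> real" where
  "bary z i = bvec i \<bullet> z + (if i = e then 1 else 0)"

text \<open>The factor \<open>DIM('b)\<close> normalises \<open>lam\<close> to 1 at the barycentre
  of the facet, where every coordinate is \<open>1 / DIM('b)\<close>; the apex at height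
  \<open>a\<close> then lies on the graph of \<open>a * lam\<close>.\<close>

definition lam :: "'b \<Rightarrow> real" where
  "lam z = DIM('b) * Min (bary z ` Basis)"

definition cen :: 'a where
  "cen = (1 / DIM('b)) *\<^sub>R (\<Sum>i\<in>Basis. f i)"

text \<open>The affine map that takes the model facet to the facet, vertex to vertex, and the point
  at height \<open>a\<close> over its barycentre to \<open>p\<close>.\<close>

definition half :: "real \<Rightarrow> 'a \<Rightarrow> 'b \<Rightarrow> 'a" where
  "half a p z = (\<Sum>i\<in>Basis. bary z i *\<^sub>R f i) + (z \<bullet> e / a) *\<^sub>R (p - cen)"

text \<open>By \<open>half_eq\<close> the coefficient of \<open>f i\<close> is
  \<open>bary z i - (z \<bullet> e / a) / DIM('b)\<close>, so the two inequalities say that the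
  coefficients of all vertices are nonnegative. Dividing by \<open>a\<close> lets one definition
  serve the upper and the lower half.\<close>

definition hdom :: "real \<Rightarrow> 'b set" where
  "hdom a = {z. 0 \<le> z \<bullet> e / a \<and> z \<bullet> e / a \<le> lam z}"

lemma bvec_e: "i \<in> Basis \<Longrightarrow> bvec i \<bullet> e = 0"
  using e by (auto simp: bvec_def inner_sum_left inner_Basis intro!: sum.neutral)

lemma bary_other: "i \<noteq> e \<Longrightarrow> bary z i = z \<bullet> i"
  by (simp add: bary_def bvec_def inner_commute)

lemma bary_e: "bary z e = 1 - (\<Sum>j\<in>Basis-{e}. z \<bullet> j)"
  by (simp add: bary_def bvec_def inner_sum_left) (simp add: inner_commute)

lemma bary_sum: "(\<Sum>i\<in>Basis. bary z i) = 1"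
proof -
  have "(\<Sum>i\<in>Basis. bary z i) = bary z e + (\<Sum>i\<in>Basis-{e}. bary z i)"
    using e by (simp add: sum.remove)
  also have "(\<Sum>i\<in>Basis-{e}. bary z i) = (\<Sum>i\<in>Basis-{e}. z \<bullet> i)"
    by (rule sum.cong) (auto simp: bary_other)
  finally show ?thesis by (simp add: bary_e)
qed

lemma bary_add_e: "i \<in> Basis \<Longrightarrow> bary (z + r *\<^sub>R e) i = bary z i"
  by (simp add: bary_def inner_add_right bvec_e)

lemma lam_add_e: "lam (z + r *\<^sub>R e) = lam z"
proof -
  have "bary (z + r *\<^sub>R e) ` Basis = bary z ` Basis" by (rule image_cong) (auto simp: bary_add_e)
  then show ?thesis by (simp add: lam_def)
qed

lemma lam_ge_iff: "t \<le> lam z \<longleftrightarrow> (\<forall>i\<in>Basis. t / DIM('b) \<le> bary z i)"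
proof -
  have "t \<le> lam z \<longleftrightarrow> t / DIM('b) \<le> Min (bary z ` Basis)"
    by (simp add: lam_def divide_le_eq mult.commute)
  also have "\<dots> \<longleftrightarrow> (\<forall>i\<in>Basis. t / DIM('b) \<le> bary z i)"
    by (subst Min_ge_iff) auto
  finally show ?thesis .
qed

lemma lam_le: "i \<in> Basis \<Longrightarrow> lam z \<le> DIM('b) * bary z i"
  by (simp add: lam_def)

lemma bary_coords_eq:
  assumes "\<And>i. i \<in> Basis \<Longrightarrow> i \<noteq> e \<Longrightarrow> bary z i = bary z' i" "z \<bullet> e = z' \<bullet> e"
  shows "z = z'"
proof (rule euclidean_eqI)
  fix i :: 'b assume "i \<in> Basis"
  then show "z \<bullet> i = z' \<bullet> i"
    using assms(1) [of i] assms(2) by (cases "i = e") (auto simp: bary_other)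
qed

lemma half_eq:
  assumes "p \<notin> f ` Basis"
  shows "half a p z = (\<Sum>i\<in>Basis. (bary z i - (z \<bullet> e / a) / DIM('b)) *\<^sub>R f i) + (z \<bullet> e / a) *\<^sub>R p"
  by (simp add: half_def cen_def scaleR_diff_left scaleR_diff_right sum_subtractf scaleR_sum_right)

lemma affine_on_half: "affine_on S (half a p)"
proof (rule affine_onI [where c = "half a p 0"])
  let ?l = "\<lambda>z. (\<Sum>i\<in>Basis. (bvec i \<bullet> z) *\<^sub>R f i) + (z \<bullet> e / a) *\<^sub>R (p - cen)"
  show "linear ?l"
    by (rule linearI) (simp_all add: inner_add_right inner_add_left algebra_simps sum.distrib add_divide_distrib scaleR_sum_right)
  show "half a p x = ?l x + half a p 0" for x
    by (simp add: half_def bary_def scaleR_add_left sum.distrib)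
qed

lemma half_surj:
  assumes p: "p \<notin> f ` Basis" and a: "a \<noteq> 0"
    and u: "\<And>v. v \<in> insert p (f ` Basis) \<Longrightarrow> 0 \<le> u v" "sum u (insert p (f ` Basis)) = 1"
  obtains z where "z \<in> hdom a" "half a p z = (\<Sum>v\<in>insert p (f ` Basis). u v *\<^sub>R v)"
    "z \<bullet> e / a = u p" "\<And>i. i \<in> Basis \<Longrightarrow> bary z i = u (f i) + u p / DIM('b)"
proof -
  \<comment> \<open>Solves \<open>half_eq\<close> for the given coefficients: the height yields
    \<open>u p\<close>, and each coordinate adds back the part \<open>u p / DIM('b)\<close> that the
    barycentre takes away. The coordinate \<open>bary z e\<close> is not set; it follows from the
    sum being 1.\<close>
  define z where "z = (\<Sum>i\<in>Basis. (if i = e then a * u p else u (f i) + u p / DIM('b)) *\<^sub>R i)"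
  have ze: "z \<bullet> e / a = u p" using e a by (simp add: z_def)
  have sum1: "(\<Sum>i\<in>Basis. u (f i)) + u p = 1"
    using u(2) p inj_f by (simp add: sum.reindex)
  have other: "bary z i = u (f i) + u p / DIM('b)" if "i \<in> Basis" "i \<noteq> e" for i
    using that by (simp add: bary_other z_def)
  have b: "bary z i = u (f i) + u p / DIM('b)" if "i \<in> Basis" for i
  proof (cases "i = e")
    case True
    have "bary z e + (\<Sum>i\<in>Basis-{e}. bary z i) = 1"
      using bary_sum [of z] e by (simp add: sum.remove)
    moreover have "(\<Sum>i\<in>Basis-{e}. bary z i) = (\<Sum>i\<in>Basis-{e}. u (f i) + u p / DIM('b))"
      by (rule sum.cong) (auto simp: other)
    moreover have "(u (f e) + u p / DIM('b)) + (\<Sum>i\<in>Basis-{e}. u (f i) + u p / DIM('b)) = (\<Sum>i\<in>Basis. u (f i) + u p / DIM('b))"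
      using e by (simp add: sum.remove)
    moreover have "\<dots> = 1" using sum1 by (simp add: sum.distrib)
    ultimately have "bary z e = u (f e) + u p / DIM('b)" by linarith
    then show ?thesis using True by simp
  qed (use that other in auto)
  show thesis
  proof
    show "z \<in> hdom a"
      using u(1) by (auto simp: hdom_def ze lam_ge_iff b simp del: divide_divide_eq_left)
    show "half a p z = (\<Sum>v\<in>insert p (f ` Basis). u v *\<^sub>R v)"
      using p inj_f by (simp add: half_eq ze b sum.reindex)
  qed (use ze b in auto)
qed

lemma half_in_hull:
  assumes p: "p \<notin> f ` Basis" and z: "z \<in> hdom a"
  shows "half a p z \<in> convex hull (insert p (f ` Basis))"
proof -
  define u where "u v = (if v = p then z \<bullet> e / a else bary z (inv_into Basis f v) - (z \<bullet> e / a) / DIM('b))" for v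
  have uf: "u (f i) = bary z i - (z \<bullet> e / a) / DIM('b)" if "i \<in> Basis" for i
    using that p inj_f by (auto simp: u_def)
  have up: "u p = z \<bullet> e / a" by (simp add: u_def)
  have "sum u (insert p (f ` Basis)) = 1"
    using p inj_f by (simp add: sum.reindex uf up sum_subtractf bary_sum)
  moreover have "0 \<le> u v" if "v \<in> insert p (f ` Basis)" for v
    using that z by (auto simp: hdom_def lam_ge_iff uf up)
  moreover have "half a p z = (\<Sum>v\<in>insert p (f ` Basis). u v *\<^sub>R v)"
    using p inj_f by (simp add: half_eq [OF p] uf up sum.reindex)
  ultimately show ?thesis
    by (subst convex_hull_finite) (auto intro!: exI [of _ u])
qed

text \<open>The differences of the coefficients of two points with the same image would form an
  affine dependence of the vertices.\<close>

lemma inj_half: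
  assumes p: "p \<notin> f ` Basis" and a: "a \<noteq> 0" and ind: "\<not> affine_dependent (insert p (f ` Basis))"
  shows "inj (half a p)"
proof (rule injI)
  fix z z' assume eq: "half a p z = half a p z'"
  define co where "co z i = bary z i - (z \<bullet> e / a) / DIM('b)" for z i
  define u where "u v = (if v = p then z \<bullet> e / a - z' \<bullet> e / a
     else co z (inv_into Basis f v) - co z' (inv_into Basis f v))" for v
  have uf: "u (f i) = co z i - co z' i" if "i \<in> Basis" for i
    using that p inj_f by (auto simp: u_def)
  have up: "u p = z \<bullet> e / a - z' \<bullet> e / a" by (simp add: u_def)
  have "sum u (insert p (f ` Basis)) = 0"
    using p inj_f by (simp add: sum.reindex uf up co_def sum_subtractf bary_sum)
  moreover have "(\<Sum>v\<in>insert p (f ` Basis). u v *\<^sub>R v) = 0"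
  proof -
    have "half a p z = (\<Sum>i\<in>Basis. co z i *\<^sub>R f i) + (z \<bullet> e / a) *\<^sub>R p" for z
      unfolding co_def by (rule half_eq [OF p])
    then have "(\<Sum>i\<in>Basis. co z i *\<^sub>R f i) + (z \<bullet> e / a) *\<^sub>R p = (\<Sum>i\<in>Basis. co z' i *\<^sub>R f i) + (z' \<bullet> e / a) *\<^sub>R p"
      using eq by simp
    then show ?thesis
      using p inj_f by (simp add: uf up sum.reindex scaleR_diff_left sum_subtractf algebra_simps)
  qed
  ultimately have zero: "u v = 0" if "v \<in> insert p (f ` Basis)" for v
    using ind that by (subst (asm) affine_dependent_explicit_finite) auto
  have "z \<bullet> e / a = z' \<bullet> e / a" using zero [of p] up by simp
  moreover from this have ze: "z \<bullet> e = z' \<bullet> e" using a by simp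
  have "bary z i = bary z' i" if "i \<in> Basis" for i
    using zero [of "f i"] uf [OF that] that ze by (simp add: co_def)
  ultimately show "z = z'" using a by (intro bary_coords_eq) auto
qed

lemma half_image:
  assumes p: "p \<notin> f ` Basis" and a: "a \<noteq> 0"
  shows "half a p ` hdom a = convex hull (insert p (f ` Basis))"
proof
  show "half a p ` hdom a \<subseteq> convex hull (insert p (f ` Basis))"
    using half_in_hull [OF p] by blast
  show "convex hull (insert p (f ` Basis)) \<subseteq> half a p ` hdom a"
  proof
    fix x assume "x \<in> convex hull (insert p (f ` Basis))"
    then obtain u where u: "\<forall>v\<in>insert p (f ` Basis). 0 \<le> u v" "sum u (insert p (f ` Basis)) = 1"
      "(\<Sum>v\<in>insert p (f ` Basis). u v *\<^sub>R v) = x"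
      by (subst (asm) convex_hull_finite) auto
    obtain z' where "z' \<in> hdom a" "half a p z' = x"
      by (rule half_surj [OF p a, of u]) (use u in auto)
    then show "x \<in> half a p ` hdom a" by blast
  qed
qed

text \<open>At height 0 neither the parameter nor the apex enters, so one \<open>z\<close> serves
  all of them. This makes the two halves of a bipyramid agree along the facet.\<close>

lemma facet_point:
  assumes "x \<in> convex hull (f ` Basis)"
  obtains z where "z \<bullet> e = 0" "\<And>a. z \<in> hdom a" "\<And>a p. half a p z = x"
proof -
  obtain u where u: "\<forall>v\<in>f ` Basis. 0 \<le> u v" "sum u (f ` Basis) = 1"
    "(\<Sum>v\<in>f ` Basis. u v *\<^sub>R v) = x"
    using assms by (subst (asm) convex_hull_finite) auto
  have "f ` Basis \<noteq> UNIV"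
    using finite_imp_bounded [of "f ` Basis"] not_bounded_UNIV by auto
  \<comment> \<open>An auxiliary apex with weight 0 makes \<open>half_surj\<close>
    applicable.\<close>
  then obtain p where p: "p \<notin> f ` Basis" by blast
  have [simp]: "i \<in> Basis \<Longrightarrow> f i \<noteq> p" for i using p by auto
  define u' where "u' v = (if v = p then 0 else u v)" for v
  obtain z where z: "z \<in> hdom 1" "z \<bullet> e / 1 = u' p" "\<And>i. i \<in> Basis \<Longrightarrow> bary z i = u' (f i) + u' p / DIM('b)"
  proof (rule half_surj [OF p, of 1 u'])
    show "sum u' (insert p (f ` Basis)) = 1"
      using p u(2) inj_f by (simp add: u'_def sum.reindex)
    show "0 \<le> u' v" if "v \<in> insert p (f ` Basis)" for v
      using that u(1) by (auto simp: u'_def)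
  qed (auto intro: that)
  have b: "bary z i = u (f i)" if "i \<in> Basis" for i using z(3) [OF that] that by (simp add: u'_def)
  have ze: "z \<bullet> e = 0" using z(2) by (simp add: u'_def)
  show thesis
  proof
    show "z \<in> hdom a" for a using u(1) by (auto simp: hdom_def ze lam_ge_iff b)
    show "half a p z = x" for a p using u(3) inj_f by (simp add: half_def ze b sum.reindex)
  qed (rule ze)
qed

text \<open>Leaving out the vertex \<open>f i\<close> makes its coordinate \<open>bary z i - z \<bullet> e / a / DIM('b)\<close> vanish, which
  puts \<open>z\<close> on the graph of \<open>lam\<close>.\<close>

lemma outer_face_point:
  assumes p: "p \<notin> f ` Basis" and a: "a \<noteq> 0" and i: "i \<in> Basis"
    and x: "x \<in> convex hull (insert p (f ` Basis) - {f i})"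
  obtains z where "z \<in> hdom a" "half a p z = x" "z \<bullet> e / a = lam z"
proof -
  let ?V = "insert p (f ` Basis)"
  obtain u where u: "\<forall>v\<in>?V - {f i}. 0 \<le> u v" "sum u (?V - {f i}) = 1"
    "(\<Sum>v\<in>?V - {f i}. u v *\<^sub>R v) = x"
    using x by (subst (asm) convex_hull_finite) auto
  define u' where "u' v = (if v = f i then 0 else u v)" for v
  have fi: "f i \<in> ?V" using i by simp
  have s1: "sum u' ?V = 1"
    using u(2) by (subst sum.remove [OF _ fi]) (auto simp: u'_def)
  have s2: "(\<Sum>v\<in>?V. u' v *\<^sub>R v) = x"
    using u(3) by (subst sum.remove [OF _ fi]) (auto simp: u'_def)
  obtain z where z: "z \<in> hdom a" "half a p z = (\<Sum>v\<in>?V. u' v *\<^sub>R v)" "z \<bullet> e / a = u' p"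
    "\<And>i. i \<in> Basis \<Longrightarrow> bary z i = u' (f i) + u' p / DIM('b)"
  proof (rule half_surj [OF p a _ s1])
    show "0 \<le> u' v" if "v \<in> ?V" for v using that u(1) by (auto simp: u'_def)
  qed (auto intro: that)
  have "lam z \<le> z \<bullet> e / a"
    using lam_le [OF i, of z] z(4) [OF i] z(3) by (simp add: u'_def)
  moreover have "z \<bullet> e / a \<le> lam z" using z(1) by (simp add: hdom_def)
  ultimately show thesis using that z s2 by simp
qed

definition unhalf :: "real \<Rightarrow> 'a \<Rightarrow> 'a \<Rightarrow> 'b" where
  "unhalf a p = inv (half a p)"

context
  fixes p and a :: real
  assumes p: "p \<notin> f ` Basis" and a: "a \<noteq> 0" and ind: "\<not> affine_dependent (insert p (f ` Basis))"
begin

lemma unhalf_half: "unhalf a p (half a p z) = z"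
  using inj_half [OF p a ind] by (simp add: unhalf_def)

lemma half_unhalf: "x \<in> convex hull (insert p (f ` Basis)) \<Longrightarrow> half a p (unhalf a p x) = x"
  unfolding half_image [OF p a, symmetric] using unhalf_half by auto

lemma unhalf_image: "unhalf a p ` (convex hull (insert p (f ` Basis))) = hdom a"
  unfolding half_image [OF p a, symmetric] image_image by (simp add: unhalf_half)

lemma affine_on_unhalf: "affine_on (convex hull (insert p (f ` Basis))) (unhalf a p)"
proof -
  have "affine_on (range (half a p)) (unhalf a p)"
    by (rule affine_on_inverse) (auto simp: affine_on_half unhalf_half)
  then show ?thesis
    unfolding half_image [OF p a, symmetric] by (rule affine_on_subset) auto
qed

lemma inj_on_unhalf: "inj_on (unhalf a p) (convex hull (insert p (f ` Basis)))"
  by (rule inj_on_inverseI [of _ "half a p"]) (rule half_unhalf)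

lemma polytope_hdom: "polytope (hdom a)"
  unfolding unhalf_image [symmetric]
  by (intro polytope_affine_image affine_on_unhalf polytope_convex_hull) simp

end

text \<open>Stretching along \<open>e\<close> leaves the barycentric coordinates alone. The volumes
  of the halves are therefore \<open>\<bar>a\<bar>\<close> times a common constant: the parameters
  of a bipyramid are volumes up to scale.\<close>

lemma hdom_scale:
  assumes "a \<noteq> 0"
  shows "hdom a = (\<lambda>z. 0 + (\<Sum>j\<in>Basis. ((if j = e then a else 1) * (z \<bullet> j)) *\<^sub>R j)) ` hdom 1"
    (is "_ = ?D a ` _")
proof -
  have ie: "?D a z \<bullet> i = (if i = e then a else 1) * (z \<bullet> i)" if "i \<in> Basis" for a z i
    using that by simp
  have b: "bary (?D a z) i = bary z i" if "i \<in> Basis" for a z i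
  proof (cases "i = e")
    case True
    have "(\<Sum>j\<in>Basis-{e}. ?D a z \<bullet> j) = (\<Sum>j\<in>Basis-{e}. z \<bullet> j)"
      by (rule sum.cong) (auto simp: ie)
    then show ?thesis using True by (simp add: bary_e)
  qed (use that in \<open>simp add: bary_other\<close>)
  have l: "lam (?D a z) = lam z" for a z
  proof -
    have "bary (?D a z) ` Basis = bary z ` Basis" by (rule image_cong [OF refl b])
    then show ?thesis by (simp add: lam_def)
  qed
  have DD: "?D a (?D (1/a) z) = z" for z
    by (rule euclidean_eqI) (use assms in auto)
  show ?thesis
  proof (rule set_eqI)
    fix z
    show "z \<in> hdom a \<longleftrightarrow> z \<in> ?D a ` hdom 1"
    proof
      assume "z \<in> hdom a"
      then have "?D (1/a) z \<in> hdom 1"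
        using e by (simp only: hdom_def mem_Collect_eq l ie) simp
      then show "z \<in> ?D a ` hdom 1" by (rule rev_image_eqI) (rule DD [symmetric])
    next
      assume "z \<in> ?D a ` hdom 1"
      then obtain y where y: "z = ?D a y" "y \<in> hdom 1" by blast
      then show "z \<in> hdom a"
        using e assms by (simp only: hdom_def mem_Collect_eq l ie) simp
    qed
  qed
qed

section \<open>The volume-preserving piecewise affine shear of the model\<close>

definition slide :: "real \<Rightarrow> 'b \<Rightarrow> 'b" where
  "slide d z = z + (d * lam z) *\<^sub>R e"

lemma lam_slide [simp]: "lam (slide d z) = lam z"
  by (simp add: slide_def lam_add_e)

lemma slide_e: "slide d z \<bullet> e = z \<bullet> e + d * lam z"
  using e by (simp add: slide_def inner_add_left)

lemma slide_slide [simp]: "slide (-d) (slide d z) = z" "slide d (slide (-d) z) = z"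
  using lam_slide [of d z] lam_slide [of "-d" z] by (simp_all add: slide_def)

text \<open>A region of linearity of \<open>lam\<close>, where the minimum is attained at
  \<open>i\<close>. The regions are polyhedra that may overlap.\<close>

definition piece :: "'b \<Rightarrow> 'b set" where
  "piece i = {z. \<forall>j\<in>Basis. bary z i \<le> bary z j}"

lemma piece_cover: "(\<Union>i\<in>Basis. piece i) = UNIV"
proof -
  have "\<exists>i\<in>Basis. z \<in> piece i" for z
  proof -
    have "Min (bary z ` Basis) \<in> bary z ` Basis" by (rule Min_in) auto
    then obtain i where i: "i \<in> Basis" "Min (bary z ` Basis) = bary z i" by blast
    have "Min (bary z ` Basis) \<le> bary z j" if "j \<in> Basis" for j
      using that by (intro Min_le) auto
    then show ?thesis using i by (auto simp: piece_def)
  qed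
  then show ?thesis by blast
qed

lemma polyhedron_piece: "polyhedron (piece i)"
proof -
  have "piece i = \<Inter>((\<lambda>j. {z. (bvec i - bvec j) \<bullet> z \<le> (if j = e then 1 else 0) - (if i = e then 1 else 0)}) ` Basis)"
  proof -
    have "bary z i \<le> bary z j \<longleftrightarrow> (bvec i - bvec j) \<bullet> z \<le> (if j = e then 1 else 0) - (if i = e then 1 else 0)" for z j
      unfolding bary_def inner_diff_left by linarith
    then show ?thesis unfolding piece_def by blast
  qed
  also have "polyhedron \<dots>"
    by (rule polyhedron_Inter) (auto intro: polyhedron_halfspace_le)
  finally show ?thesis .
qed

lemma lam_piece: "i \<in> Basis \<Longrightarrow> z \<in> piece i \<Longrightarrow> lam z = DIM('b) * bary z i"
  unfolding lam_def piece_def by (intro arg_cong2 [of _ _ _ _ "(*)"] refl Min_eqI) auto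

lemma slide_piece:
  assumes "i \<in> Basis" "z \<in> piece i"
  shows "slide d z = z + ((d * DIM('b)) * (bvec i \<bullet> z) + (d * DIM('b)) * (if i = e then 1 else 0)) *\<^sub>R e"
  using lam_piece [OF assms] by (simp add: slide_def bary_def algebra_simps)

lemma pw_affine_slide:
  assumes "polytope S"
  shows "pw_affine S (slide d)"
proof (rule pw_affineI [of "(\<lambda>i. S \<inter> piece i) ` Basis"])
  show "S = \<Union> ((\<lambda>i. S \<inter> piece i) ` Basis)" using piece_cover by blast
  show "polytope P" if "P \<in> (\<lambda>i. S \<inter> piece i) ` Basis" for P
    using that assms polyhedron_piece by (auto intro: polytope_Int_polyhedron)
  show "affine_on P (slide d)" if P: "P \<in> (\<lambda>i. S \<inter> piece i) ` Basis" for P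
  proof -
    obtain i where i: "i \<in> Basis" "P \<subseteq> piece i" using P by blast
    show ?thesis
    proof (rule affine_onI)
      show "linear (\<lambda>z. z + ((d * DIM('b)) * (bvec i \<bullet> z)) *\<^sub>R e)"
        by (rule linearI) (simp_all add: inner_add_right algebra_simps)
      show "slide d z = z + ((d * DIM('b)) * (bvec i \<bullet> z)) *\<^sub>R e + ((d * DIM('b)) * (if i = e then 1 else 0)) *\<^sub>R e"
        if "z \<in> P" for z
        using slide_piece [OF i(1), of z d] i(2) that by (auto simp: algebra_simps)
    qed
  qed
qed simp

lemma slide_measurable: "slide d \<in> borel_measurable borel"
proof -
  have "(\<lambda>z. Min (bary z ` Basis)) \<in> borel_measurable borel"
    by (rule borel_measurable_Min) (auto simp: bary_def)
  then show ?thesis unfolding slide_def lam_def by measurable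
qed

lemma slide_image_borel: "A \<in> sets borel \<Longrightarrow> slide d ` A \<in> sets borel"
proof -
  assume A: "A \<in> sets borel"
  have "slide d ` A = slide (-d) -` A \<inter> space borel"
  proof (intro set_eqI iffI)
    fix x assume "x \<in> slide (-d) -` A \<inter> space borel"
    then show "x \<in> slide d ` A" using slide_slide(2) [of d x] by (metis IntD1 image_eqI vimageE)
  qed auto
  then show ?thesis using slide_measurable A by (metis measurable_sets)
qed

text \<open>On each piece \<open>slide d\<close> is a shear along \<open>e\<close> whose linear form
  vanishes at \<open>e\<close> by \<open>bvec_e\<close>. Since the pieces overlap, they are peeled
  off from \<open>B\<close> one at a time.\<close>

lemma emeasure_slide:
  assumes A: "A \<in> sets borel"
  shows "emeasure lborel (slide d ` A) = emeasure lborel A"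
proof -
  have inj: "inj (slide d)" by (rule inj_on_inverseI [of _ "slide (-d)"]) simp
  have "emeasure lborel (slide d ` B) = emeasure lborel B"
    if "finite I" "I \<subseteq> Basis" "B \<in> sets borel" "B \<subseteq> (\<Union>i\<in>I. piece i)" for I B
    using that
  proof (induction I arbitrary: B rule: finite_induct)
    case (insert i I)
    have pb: "piece i \<in> sets borel"
      using polyhedron_imp_closed [OF polyhedron_piece] by (rule borel_closed)
    let ?B1 = "B \<inter> piece i" and ?B2 = "B - piece i"
    have B: "?B1 \<in> sets borel" "?B2 \<in> sets borel" using insert.prems pb by auto
    have 1: "emeasure lborel (slide d ` ?B1) = emeasure lborel ?B1"
    proof -
      have "slide d ` ?B1 = (\<lambda>z. z + ((d * DIM('b)) * (bvec i \<bullet> z) + (d * DIM('b)) * (if i = e then 1 else 0)) *\<^sub>R e) ` ?B1"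
        by (rule image_cong [OF refl]) (use insert.prems slide_piece in auto)
      then show ?thesis
      proof (simp only:, intro emeasure_shear_image)
        show "linear (\<lambda>z. (d * DIM('b)) * (bvec i \<bullet> z))"
          by (rule linearI) (simp_all add: inner_add_right algebra_simps)
        show "(d * DIM('b)) * (bvec i \<bullet> e) = 0" using insert.prems by (simp add: bvec_e)
      qed (rule B)
    qed
    have 2: "emeasure lborel (slide d ` ?B2) = emeasure lborel ?B2"
      using insert.prems B by (intro insert.IH) auto
    have "slide d ` B = slide d ` ?B1 \<union> slide d ` ?B2" by blast
    also have "emeasure lborel \<dots> = emeasure lborel (slide d ` ?B1) + emeasure lborel (slide d ` ?B2)"
      using inj B slide_image_borel by (intro plus_emeasure [symmetric]) (auto dest: injD)
    also have "\<dots> = emeasure lborel (?B1 \<union> ?B2)"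
      unfolding 1 2 using B by (intro plus_emeasure) auto
    also have "?B1 \<union> ?B2 = B" by blast
    finally show ?case .
  qed simp
  from this [of Basis A] show ?thesis using A piece_cover by simp
qed

end

subsection \<open>Moving volume across a facet\<close>

lemma emeasure_affine_image_positive_finite:
  fixes g :: "'a::euclidean_space \<Rightarrow> 'b::euclidean_space"
  assumes S: "polytope S" "aff_dim S = int DIM('b)" and g: "affine_on S g" "inj_on g S"
  shows "0 < emeasure lebesgue (g ` S)" "emeasure lebesgue (g ` S) < \<infinity>"
proof -
  have P: "polytope (g ` S)" using S g by (intro polytope_affine_image)
  then have gS: "g ` S \<in> sets borel" by (intro borel_closed polytope_imp_closed)
  have "aff_dim (g ` S) = int DIM('b)"
    using S g by (subst aff_dim_affine_injective_image) (auto intro: polytope_imp_convex)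
  then have "interior (g ` S) \<noteq> {}" using P by (intro convex_full_dim_interior polytope_imp_convex)
  then have "0 < emeasure lborel (interior (g ` S))" by (intro emeasure_lborel_open_pos) auto
  also have "\<dots> \<le> emeasure lborel (g ` S)" using gS by (intro emeasure_mono interior_subset) auto
  finally show "0 < emeasure lebesgue (g ` S)" using gS by simp
  show "emeasure lebesgue (g ` S) < \<infinity>"
    using gS emeasure_bounded_finite [OF polytope_imp_bounded [OF P]] by simp
qed

text \<open>The fraction of the volume of \<open>S\<close> that lies in \<open>A\<close>. The choice
  of \<open>g\<close> is immaterial by \<open>simplex_share_eq\<close>, because embeddings change
  volumes by a constant factor. It separates what depends on the simplex alone from the volume that
  a measure assigns to it.\<close>

definition simplex_share :: "'b::euclidean_space itself \<Rightarrow> 'a::euclidean_space set \<Rightarrow> 'a set \<Rightarrow> ennreal" where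
  "simplex_share _ S A =
     (let g = (SOME g::'a \<Rightarrow> 'b. affine_on S g \<and> inj_on g S) in emeasure lebesgue (g ` A) / emeasure lebesgue (g ` S))"

lemma simplex_share_eq:
  fixes g :: "'a::euclidean_space \<Rightarrow> 'b::euclidean_space"
  assumes S: "polytope S" "aff_dim S = int DIM('b)" and g: "affine_on S g" "inj_on g S"
    and A: "A \<in> sets borel" "A \<subseteq> S"
  shows "simplex_share TYPE('b) S A = emeasure lebesgue (g ` A) / emeasure lebesgue (g ` S)"
proof -
  define g' where "g' = (SOME g::'a \<Rightarrow> 'b. affine_on S g \<and> inj_on g S)"
  have g': "affine_on S g'" "inj_on g' S"
    using someI [of "\<lambda>g::'a \<Rightarrow> 'b. affine_on S g \<and> inj_on g S" g] g by (auto simp: g'_def)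
  obtain k where k: "k > 0"
    "\<And>A. A \<in> sets borel \<Longrightarrow> A \<subseteq> S \<Longrightarrow> emeasure lebesgue (g' ` A) = ennreal k * emeasure lebesgue (g ` A)"
    by (rule emeasure_affine_change [OF S g g']) (rule that; assumption)
  have Sb: "S \<in> sets borel" using S(1) by (intro borel_closed polytope_imp_closed)
  obtain v where v: "emeasure lebesgue (g ` S) = ennreal v" "v > 0"
    by (rule ennreal_positive_finiteE [OF emeasure_affine_image_positive_finite [OF S g]])
  have "simplex_share TYPE('b) S A = emeasure lebesgue (g' ` A) / emeasure lebesgue (g' ` S)"
    by (simp add: simplex_share_def Let_def g'_def)
  also have "\<dots> = (ennreal k * emeasure lebesgue (g ` A)) / (ennreal k * ennreal v)"
    using k(2) [OF A] k(2) [OF Sb] v by simp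
  also have "\<dots> = emeasure lebesgue (g ` A) / ennreal v"
    using k(1) v(2) by (cases "emeasure lebesgue (g ` A)") (auto simp: ennreal_mult [symmetric] divide_ennreal ennreal_top_divide ennreal_mult_top)
  finally show ?thesis by (simp add: v)
qed

section \<open>Two simplices with a common facet as a folded bipyramid\<close>

locale bipyramid = facet_chart e f
  for e :: "'b::euclidean_space" and f :: "'b \<Rightarrow> 'a::euclidean_space" +
  fixes p q :: 'a
  assumes p: "p \<notin> f ` Basis" and q: "q \<notin> f ` Basis"
    and ind_p: "\<not> affine_dependent (insert p (f ` Basis))"
    and ind_q: "\<not> affine_dependent (insert q (f ` Basis))"
    and meet: "convex hull (insert p (f ` Basis)) \<inter> convex hull (insert q (f ` Basis)) \<subseteq> convex hull (f ` Basis)"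
begin

abbreviation "D1 \<equiv> convex hull (insert p (f ` Basis))"
abbreviation "D2 \<equiv> convex hull (insert q (f ` Basis))"

definition "bdom a b = hdom a \<union> hdom (-b)"

text \<open>The two simplices need not lie in one flat of dimension \<open>DIM('b)\<close>, so the
  model is bent along the facet, with one affine map for each sign of the height. Both maps agree at
  height 0.\<close>

definition "bfold a b z = (if 0 \<le> z \<bullet> e then half a p z else half (-b) q z)"

definition "bunfold a b x = (if x \<in> D1 then unhalf a p x else unhalf (-b) q x)"

lemma polytope_D: "polytope D1" "polytope D2"
  by (simp_all add: polytope_convex_hull)

lemma aff_dim_D: "aff_dim D1 = int DIM('b)" "aff_dim D2 = int DIM('b)"
proof -
  have "card (insert p (f ` Basis)) = DIM('b) + 1" "card (insert q (f ` Basis)) = DIM('b) + 1"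
    using p q inj_f by (simp_all add: card_image)
  then show "aff_dim D1 = int DIM('b)" "aff_dim D2 = int DIM('b)"
    unfolding aff_dim_convex_hull
    using aff_dim_affine_independent [OF ind_p] aff_dim_affine_independent [OF ind_q] by linarith+
qed

context
  fixes a b :: real
  assumes a: "a > 0" and b: "b > 0"
begin

lemma hdom_pos: "z \<in> hdom a \<longleftrightarrow> 0 \<le> z \<bullet> e \<and> z \<bullet> e \<le> a * lam z"
  using a by (auto simp: hdom_def field_simps)

lemma hdom_neg: "z \<in> hdom (-b) \<longleftrightarrow> z \<bullet> e \<le> 0 \<and> - (b * lam z) \<le> z \<bullet> e"
  using b by (auto simp: hdom_def field_simps)

lemma bdom_iff: "z \<in> bdom a b \<longleftrightarrow> - (b * lam z) \<le> z \<bullet> e \<and> z \<bullet> e \<le> a * lam z"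
proof
  assume "z \<in> bdom a b"
  then consider "z \<in> hdom a" | "z \<in> hdom (-b)" by (auto simp: bdom_def)
  then show "- (b * lam z) \<le> z \<bullet> e \<and> z \<bullet> e \<le> a * lam z"
  proof cases
    case 1
    then have "0 \<le> a * lam z" by (simp add: hdom_pos)
    then have "0 \<le> lam z" using a by (simp add: zero_le_mult_iff)
    then have "0 \<le> b * lam z" using b by simp
    then show ?thesis using 1 by (simp add: hdom_pos)
  next
    case 2
    then have "0 \<le> b * lam z" by (simp add: hdom_neg)
    then have "0 \<le> lam z" using b by (simp add: zero_le_mult_iff)
    then have "0 \<le> a * lam z" using a by simp
    then show ?thesis using 2 by (simp add: hdom_neg)
  qed
qed (auto simp: bdom_def hdom_pos hdom_neg)

lemma bfold_hdom_pos: "z \<in> hdom a \<Longrightarrow> bfold a b z = half a p z"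
  by (simp add: bfold_def hdom_pos)

lemma bfold_hdom_neg: "z \<in> hdom (-b) \<Longrightarrow> bfold a b z = half (-b) q z"
  by (auto simp: bfold_def hdom_neg half_def dest: order.antisym)

text \<open>The test in \<open>bunfold\<close> prefers \<open>D1\<close>. On the overlap, which
  \<open>meet\<close> places in the facet, both inverses give the same point of the model by
  \<open>facet_point\<close>.\<close>

lemma bunfold_D2:
  assumes "x \<in> D2"
  shows "bunfold a b x = unhalf (-b) q x"
proof (cases "x \<in> D1")
  case True
  then have "x \<in> convex hull (f ` Basis)" using assms meet by blast
  then obtain z where z: "\<And>a p. half a p z = x"
    by (rule facet_point) (rule that; assumption)
  have "unhalf a p x = z" using unhalf_half [OF p _ ind_p, of a z] a z by simp
  moreover have "unhalf (-b) q x = z" using unhalf_half [OF q _ ind_q, of "-b" z] b z by simp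
  ultimately show ?thesis by (simp add: bunfold_def)
qed (simp add: bunfold_def)

lemma bfold_in: "z \<in> bdom a b \<Longrightarrow> bfold a b z \<in> D1 \<union> D2"
  using half_in_hull [OF p, of z a] half_in_hull [OF q, of z "-b"] bfold_hdom_pos bfold_hdom_neg
  by (auto simp: bdom_def)

lemma bunfold_bfold: 
  assumes "z \<in> bdom a b"
  shows "bunfold a b (bfold a b z) = z"
proof -
  consider "z \<in> hdom a" | "z \<in> hdom (-b)" using assms by (auto simp: bdom_def)
  then show ?thesis
  proof cases
    case 1
    then have "bfold a b z = half a p z" "half a p z \<in> D1"
      using half_in_hull [OF p] by (auto simp: bfold_hdom_pos)
    then show ?thesis using unhalf_half [OF p _ ind_p] a by (simp add: bunfold_def)
  next
    case 2
    then have "bfold a b z = half (-b) q z" "half (-b) q z \<in> D2"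
      using half_in_hull [OF q] by (auto simp: bfold_hdom_neg)
    then show ?thesis using unhalf_half [OF q _ ind_q] b by (simp add: bunfold_D2)
  qed
qed

lemma bunfold_in:
  assumes "x \<in> D1 \<union> D2"
  shows "bunfold a b x \<in> bdom a b" "bfold a b (bunfold a b x) = x"
proof -
  have "\<exists>z \<in> bdom a b. bfold a b z = x"
    using assms
  proof
    assume "x \<in> D1"
    then have "x \<in> half a p ` hdom a" using half_image [OF p, of a] a by simp
    then obtain z where "z \<in> hdom a" "half a p z = x" by blast
    then show ?thesis by (intro bexI [of _ z]) (auto simp: bdom_def bfold_hdom_pos)
  next
    assume "x \<in> D2"
    then have "x \<in> half (-b) q ` hdom (-b)" using half_image [OF q, of "-b"] b by simp
    then obtain z where "z \<in> hdom (-b)" "half (-b) q z = x" by blast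
    then show ?thesis by (intro bexI [of _ z]) (auto simp: bdom_def bfold_hdom_neg)
  qed
  then obtain z where z: "z \<in> bdom a b" "x = bfold a b z" by blast
  show "bunfold a b x \<in> bdom a b" "bfold a b (bunfold a b x) = x"
    using z by (simp_all add: bunfold_bfold)
qed

lemma polytope_hdom_ab: "polytope (hdom a)" "polytope (hdom (-b))"
  using polytope_hdom [OF p _ ind_p] polytope_hdom [OF q _ ind_q] a b by simp_all

lemma pw_affine_bfold: "pw_affine (bdom a b) (bfold a b)"
  unfolding bdom_def
proof (rule pw_affine_Un)
  show "pw_affine (hdom a) (bfold a b)"
    by (rule pw_affine_polytope [OF polytope_hdom_ab(1)])
       (subst affine_on_cong [OF bfold_hdom_pos], auto simp: affine_on_half)
  show "pw_affine (hdom (-b)) (bfold a b)"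
    by (rule pw_affine_polytope [OF polytope_hdom_ab(2)])
       (subst affine_on_cong [OF bfold_hdom_neg], auto simp: affine_on_half)
qed

lemma pw_affine_bunfold: "pw_affine (D1 \<union> D2) (bunfold a b)"
proof (rule pw_affine_Un)
  show "pw_affine D1 (bunfold a b)"
    by (rule pw_affine_polytope [OF polytope_D(1)],
        subst affine_on_cong [of _ _ "unhalf a p"])
       (use affine_on_unhalf [OF p _ ind_p, of a] a in \<open>auto simp: bunfold_def\<close>)
  show "pw_affine D2 (bunfold a b)"
    by (rule pw_affine_polytope [OF polytope_D(2)],
        subst affine_on_cong [of _ _ "unhalf (-b) q"])
       (use affine_on_unhalf [OF q _ ind_q, of "-b"] b in \<open>auto simp: bunfold_D2\<close>)
qed

lemma pw_affine_slide_bdom: "pw_affine (bdom a b) (slide d)"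
  unfolding bdom_def using polytope_hdom_ab by (intro pw_affine_Un pw_affine_slide)

lemma slide_bdom:
  assumes "a' > 0" "b' > 0" "a' + b' = a + b" "z \<in> bdom a b"
  shows "- (b' * lam z) \<le> slide (a' - a) z \<bullet> e \<and> slide (a' - a) z \<bullet> e \<le> a' * lam z"
proof -
  have b': "b' = a + b - a'" using assms by simp
  show ?thesis using assms(4) unfolding bdom_iff slide_e b' by (simp add: algebra_simps)
qed

end

definition "exchange a b a' b' x = bfold a' b' (slide (a' - a) (bunfold a b x))"

context
  fixes a b a' b' :: real
  assumes ab: "a > 0" "b > 0" "a' > 0" "b' > 0" "a' + b' = a + b"
begin

lemma slide_bdom': "z \<in> bdom a b \<Longrightarrow> slide (a' - a) z \<in> bdom a' b'"
  using slide_bdom [OF ab(1,2) ab(3-5)] ab by (simp add: bdom_iff)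

lemma exchange_in: "x \<in> D1 \<union> D2 \<Longrightarrow> exchange a b a' b' x \<in> D1 \<union> D2"
  unfolding exchange_def using ab by (intro bfold_in slide_bdom' bunfold_in) auto

lemma bunfold_exchange:
  "x \<in> D1 \<union> D2 \<Longrightarrow> bunfold a' b' (exchange a b a' b' x) = slide (a' - a) (bunfold a b x)"
  unfolding exchange_def using ab by (intro bunfold_bfold slide_bdom' bunfold_in) auto

lemma exchange_exchange:
  assumes "x \<in> D1 \<union> D2"
  shows "exchange a' b' a b (exchange a b a' b' x) = x"
proof -
  have "exchange a' b' a b (exchange a b a' b' x) = bfold a b (slide (- (a' - a)) (slide (a' - a) (bunfold a b x)))"
    unfolding exchange_def [of a' b'] bunfold_exchange [OF assms] by simp
  also have "\<dots> = x" using bunfold_in(2) [OF ab(1,2) assms] by (simp only: slide_slide)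
  finally show ?thesis .
qed

lemma pw_affine_exchange: "pw_affine (D1 \<union> D2) (exchange a b a' b')"
proof -
  have "pw_affine (D1 \<union> D2) (\<lambda>x. slide (a' - a) (bunfold a b x))"
    using bunfold_in(1) [OF ab(1,2)]
    by (intro pw_affine_compose [OF pw_affine_bunfold [OF ab(1,2)] pw_affine_slide_bdom [OF ab(1,2)]]) blast
  then have "pw_affine (D1 \<union> D2) (\<lambda>x. bfold a' b' (slide (a' - a) (bunfold a b x)))"
    using bunfold_in(1) [OF ab(1,2)] slide_bdom'
    by (intro pw_affine_compose [OF _ pw_affine_bfold [OF ab(3,4)]]) blast+
  then show ?thesis unfolding exchange_def .
qed

text \<open>Omitting a facet vertex puts the point on an outer face of the bipyramid, the graph of
  \<open>a * lam\<close> or of \<open>- b * lam\<close>. The shear carries these graphs to the ones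
  for \<open>a'\<close> and \<open>- b'\<close>, and \<open>half\<close> depends only on the
  barycentric coordinates and on the ratio of the height to the parameter, which do not
  change.\<close>

lemma exchange_fixed:
  assumes i: "i \<in> Basis"
    and x: "x \<in> convex hull (insert p (f ` Basis) - {f i}) \<union> convex hull (insert q (f ` Basis) - {f i})"
  shows "exchange a b a' b' x = x"
proof -
  have bary_slide: "bary (slide d z) j = bary z j" if "j \<in> Basis" for d z j
    using that by (simp add: slide_def bary_add_e)
  from x show ?thesis
  proof
    assume x1: "x \<in> convex hull (insert p (f ` Basis) - {f i})"
    have "a \<noteq> 0" using ab by simp
    obtain z where z: "z \<in> hdom a" "half a p z = x" "z \<bullet> e / a = lam z"
      by (rule outer_face_point [OF p \<open>a \<noteq> 0\<close> i x1])
    have "bfold a b z = x" using bfold_hdom_pos [OF ab(1,2)] z by simp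
    then have u: "bunfold a b x = z" using bunfold_bfold [OF ab(1,2), of z] z by (auto simp: bdom_def)
    have ze: "z \<bullet> e = a * lam z" using z(3) ab by (simp add: field_simps)
    have le: "slide (a' - a) z \<bullet> e = a' * lam z" by (simp add: slide_e ze algebra_simps)
    have "0 \<le> lam z" using z(1) ze ab by (simp add: hdom_pos [OF ab(1,2)] zero_le_mult_iff)
    then have "exchange a b a' b' x = half a' p (slide (a' - a) z)"
      using ab by (simp add: exchange_def u bfold_def le)
    also have "\<dots> = half a p z"
      using ab by (simp add: half_def le ze bary_slide)
    finally show ?thesis using z by simp
  next
    assume x1: "x \<in> convex hull (insert q (f ` Basis) - {f i})"
    have "-b \<noteq> 0" using ab by simp
    obtain z where z: "z \<in> hdom (-b)" "half (-b) q z = x" "z \<bullet> e / (-b) = lam z"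
      by (rule outer_face_point [OF q \<open>-b \<noteq> 0\<close> i x1])
    have "bfold a b z = x" using bfold_hdom_neg [OF ab(1,2)] z by simp
    then have u: "bunfold a b x = z" using bunfold_bfold [OF ab(1,2), of z] z by (auto simp: bdom_def)
    have ze: "z \<bullet> e = - (b * lam z)" using z(3) ab by (simp add: field_simps)
    have b': "b' = b - (a' - a)" using ab by simp
    have le: "slide (a' - a) z \<bullet> e = - (b' * lam z)" by (simp add: slide_e ze b' algebra_simps)
    have "0 \<le> b * lam z" using z(1) ze by (simp add: hdom_neg [OF ab(1,2)])
    then have "0 \<le> lam z" using ab by (simp add: zero_le_mult_iff)
    have "slide (a' - a) z \<in> hdom (-b')"
      using \<open>0 \<le> lam z\<close> ab by (simp add: hdom_neg [OF ab(3,4)] le)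
    then have "exchange a b a' b' x = half (-b') q (slide (a' - a) z)"
      using bfold_hdom_neg [OF ab(3,4)] by (simp add: exchange_def u)
    also have "\<dots> = half (-b) q z"
      using ab by (simp add: half_def le ze bary_slide)
    finally show ?thesis using z by simp
  qed
qed

end

end

lemma emeasure_lborel_hyperplane:
  fixes e :: "'a::euclidean_space"
  assumes "e \<noteq> 0" shows "emeasure lborel {z. z \<bullet> e = r} = 0"
proof -
  have eq: "{z. z \<bullet> e = r} = {z. e \<bullet> z = r}" by (simp add: inner_commute)
  have "closed {z. e \<bullet> z = r}" by (rule closed_hyperplane)
  then have "{z. e \<bullet> z = r} \<in> sets borel" by (rule borel_closed)
  moreover have "emeasure lebesgue {z. e \<bullet> z = r} = 0"
    using negligible_hyperplane [of e r] assms by (auto simp: negligible_iff_null_sets null_sets_def)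
  ultimately show ?thesis unfolding eq by simp
qed

lemma emeasure_Un_null_Int:
  assumes "A \<in> sets M" "B \<in> sets M" "emeasure M (A \<inter> B) = 0"
  shows "emeasure M (A \<union> B) = emeasure M A + emeasure M B"
proof -
  have "emeasure M (A \<union> B) = emeasure M (A \<union> (B - A \<inter> B))" by (rule arg_cong [of _ _ "emeasure M"]) blast
  also have "\<dots> = emeasure M A + emeasure M (B - A \<inter> B)"
    using assms by (intro plus_emeasure [symmetric]) auto
  also have "emeasure M (B - A \<inter> B) = emeasure M B"
    using assms by (intro emeasure_Diff_null_set) auto
  finally show ?thesis .
qed

section \<open>Invariance of weighted volume, and exclusion of a third simplex at a facet\<close>

context bipyramid
begin

definition "vol0 = emeasure lborel (hdom 1)"

lemma hdom_borel: "a \<noteq> 0 \<Longrightarrow> hdom a \<in> sets borel"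
  using polytope_hdom [OF p _ ind_p] by (intro borel_closed polytope_imp_closed)

lemma vol0: "0 < vol0" "vol0 < \<infinity>"
proof -
  have 1: "unhalf 1 p ` D1 = hdom 1" by (rule unhalf_image [OF p _ ind_p]) simp
  have "affine_on D1 (unhalf 1 p)" "inj_on (unhalf 1 p) D1"
    using affine_on_unhalf [OF p _ ind_p] inj_on_unhalf [OF p _ ind_p] by auto
  then show "0 < vol0" "vol0 < \<infinity>"
    using emeasure_affine_image_positive_finite [OF polytope_D(1) aff_dim_D(1), of "unhalf 1 p"] hdom_borel [of 1]
    unfolding 1 by (simp_all add: vol0_def)
qed

lemma emeasure_hdom:
  assumes "a \<noteq> 0"
  shows "emeasure lborel (hdom a) = ennreal \<bar>a\<bar> * vol0"
proof -
  have "emeasure lborel (hdom a) = ennreal (\<Prod>j\<in>Basis. \<bar>if j = e then a else 1\<bar>) * vol0"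
    unfolding vol0_def by (subst hdom_scale [OF assms], rule emeasure_diagonal_image) (use assms hdom_borel in auto)
  also have "(\<Prod>j\<in>Basis. \<bar>if j = e then a else 1\<bar>) = (\<Prod>j\<in>Basis. if j = e then \<bar>a\<bar> else 1)"
    by (rule prod.cong) auto
  also have "\<dots> = \<bar>a\<bar>" using e by simp
  finally show ?thesis .
qed

text \<open>The model half has volume \<open>\<bar>a\<bar> * vol0\<close>, so the weighted share is
  a volume in units of \<open>vol0\<close>, the same unit for both halves. The apex \<open>r\<close>
  stands for \<open>p\<close> with parameter \<open>a\<close> and for \<open>q\<close> with
  parameter \<open>-b\<close>.\<close>

lemma share_unhalf:
  assumes r: "r \<notin> f ` Basis" "\<not> affine_dependent (insert r (f ` Basis))"
    and a: "a \<noteq> 0" and A: "A \<in> sets borel" "A \<subseteq> convex hull (insert r (f ` Basis))"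
  shows "ennreal \<bar>a\<bar> * simplex_share TYPE('b) (convex hull (insert r (f ` Basis))) A = emeasure lborel (unhalf a r ` A) / vol0"
    "unhalf a r ` A \<in> sets borel"
proof -
  let ?D = "convex hull (insert r (f ` Basis))"
  have D: "polytope ?D" "aff_dim ?D = int DIM('b)"
  proof -
    have "card (insert r (f ` Basis)) = DIM('b) + 1"
      using r inj_f by (simp_all add: card_image)
    then show "aff_dim ?D = int DIM('b)"
      unfolding aff_dim_convex_hull using aff_dim_affine_independent [OF r(2)] by linarith
  qed (simp add: polytope_convex_hull)
  have g: "affine_on ?D (unhalf a r)" "inj_on (unhalf a r) ?D"
    using affine_on_unhalf [OF r(1) a r(2)] inj_on_unhalf [OF r(1) a r(2)] by auto
  show gA: "unhalf a r ` A \<in> sets borel"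
    using D g A by (intro compact_injective_image_borel [of ?D] polytope_imp_compact affine_on_continuous)
  have "unhalf a r ` ?D = hdom a" by (rule unhalf_image [OF r(1) a r(2)])
  then have "simplex_share TYPE('b) ?D A = emeasure lborel (unhalf a r ` A) / (ennreal \<bar>a\<bar> * vol0)"
    using simplex_share_eq [OF D g A] gA hdom_borel [OF a] by (simp add: emeasure_hdom [OF a])
  moreover obtain v where v: "vol0 = ennreal v" "v > 0"
    by (rule ennreal_positive_finiteE [OF vol0])
  ultimately show "ennreal \<bar>a\<bar> * simplex_share TYPE('b) ?D A = emeasure lborel (unhalf a r ` A) / vol0"
    using a by (cases "emeasure lborel (unhalf a r ` A)")
      (auto simp: ennreal_mult [symmetric] divide_ennreal ennreal_top_divide ennreal_mult_top)
qed

text \<open>Both simplices unfold into one model, where the overlap lies in the hyperplane of height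
  0 and has measure 0.\<close>

lemma share_bunfold:
  assumes ab: "a > 0" "b > 0" and A: "A \<in> sets borel" "A \<subseteq> D1 \<union> D2"
  shows "ennreal a * simplex_share TYPE('b) D1 (A \<inter> D1) + ennreal b * simplex_share TYPE('b) D2 (A \<inter> D2)
     = emeasure lborel (bunfold a b ` A) / vol0"
    "bunfold a b ` A \<in> sets borel"
proof -
  have Db: "D1 \<in> sets borel" "D2 \<in> sets borel"
    using polytope_D by (auto intro: borel_closed polytope_imp_closed)
  let ?P = "unhalf a p ` (A \<inter> D1)" and ?Q = "unhalf (-b) q ` (A \<inter> D2)"
  have AD: "A \<inter> D1 \<in> sets borel" "A \<inter> D2 \<in> sets borel" using A Db by auto
  have P: "ennreal a * simplex_share TYPE('b) D1 (A \<inter> D1) = emeasure lborel ?P / vol0" "?P \<in> sets borel"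
    using share_unhalf [OF p ind_p _ AD(1), of a] ab by auto
  have Q: "ennreal b * simplex_share TYPE('b) D2 (A \<inter> D2) = emeasure lborel ?Q / vol0" "?Q \<in> sets borel"
    using share_unhalf [OF q ind_q _ AD(2), of "-b"] ab by auto
  have eq: "bunfold a b ` A = ?P \<union> ?Q"
  proof -
    have "bunfold a b ` A = bunfold a b ` (A \<inter> D1) \<union> bunfold a b ` (A \<inter> D2)"
      using A(2) by blast
    also have "bunfold a b ` (A \<inter> D1) = ?P" by (rule image_cong) (auto simp: bunfold_def)
    also have "bunfold a b ` (A \<inter> D2) = ?Q" by (rule image_cong) (auto simp: bunfold_D2 [OF ab])
    finally show ?thesis .
  qed
  have "?P \<subseteq> hdom a" "?Q \<subseteq> hdom (-b)"
    using unhalf_image [OF p _ ind_p, of a] unhalf_image [OF q _ ind_q, of "-b"] ab by auto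
  then have "?P \<inter> ?Q \<subseteq> {z. z \<bullet> e = 0}"
    by (fastforce simp: hdom_pos [OF ab] hdom_neg [OF ab] subset_iff)
  then have "emeasure lborel (?P \<inter> ?Q) \<le> emeasure lborel {z. z \<bullet> e = 0}"
    by (intro emeasure_mono) auto
  also have "\<dots> = 0" using e by (intro emeasure_lborel_hyperplane) auto
  finally have "emeasure lborel (bunfold a b ` A) = emeasure lborel ?P + emeasure lborel ?Q"
    unfolding eq using P Q by (intro emeasure_Un_null_Int) auto
  then show "ennreal a * simplex_share TYPE('b) D1 (A \<inter> D1) + ennreal b * simplex_share TYPE('b) D2 (A \<inter> D2)
     = emeasure lborel (bunfold a b ` A) / vol0"
    by (simp add: P Q add_divide_distrib_ennreal)
  show "bunfold a b ` A \<in> sets borel" unfolding eq using P Q by auto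
qed

text \<open>In the model the exchange is the shear \<open>slide (a' - a)\<close>, which preserves
  volume; both sides are this volume divided by \<open>vol0\<close>.\<close>

lemma share_exchange:
  assumes ab: "a > 0" "b > 0" "a' > 0" "b' > 0" "a' + b' = a + b" and A: "A \<in> sets borel" "A \<subseteq> D1 \<union> D2"
  shows "ennreal a * simplex_share TYPE('b) D1 (A \<inter> D1) + ennreal b * simplex_share TYPE('b) D2 (A \<inter> D2)
     = ennreal a' * simplex_share TYPE('b) D1 (exchange a b a' b' ` A \<inter> D1)
       + ennreal b' * simplex_share TYPE('b) D2 (exchange a b a' b' ` A \<inter> D2)"
proof -
  let ?h = "exchange a b a' b'"
  have "compact (D1 \<union> D2)" using polytope_D by (intro compact_Un polytope_imp_compact)
  moreover have "inj_on ?h (D1 \<union> D2)"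
    by (rule inj_on_inverseI [of _ "exchange a' b' a b"]) (rule exchange_exchange [OF ab])
  ultimately have hA: "?h ` A \<in> sets borel"
    using pw_affine_continuous [OF pw_affine_exchange [OF ab]] A by (intro compact_injective_image_borel [of "D1 \<union> D2"])
  have sub: "?h ` A \<subseteq> D1 \<union> D2" using A(2) exchange_in [OF ab] by blast
  have "bunfold a' b' ` ?h ` A = slide (a' - a) ` bunfold a b ` A"
    unfolding image_image by (rule image_cong) (use A(2) bunfold_exchange [OF ab] in auto)
  then have "emeasure lborel (bunfold a' b' ` ?h ` A) = emeasure lborel (bunfold a b ` A)"
    using emeasure_slide share_bunfold(2) [OF ab(1,2) A] by simp
  then show ?thesis
    using share_bunfold(1) [OF ab(1,2) A] share_bunfold(1) [OF ab(3,4) hA sub] by simp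
qed

text \<open>The barycentre of the facet comes from an interior point of the model bipyramid. Folding
  followed by a chart is continuous and injective near that point, so by invariance of domain
  \<open>D1 \<union> D2\<close> contains a neighbourhood of the barycentre in \<open>M\<close>.
  There \<open>Z\<close> would be covered by its intersections with \<open>D1\<close> and
  \<open>D2\<close>, both of smaller dimension.\<close>

lemma no_third_simplex:
  fixes M :: "'a set"
  assumes M: "compact_pl_manifold TYPE('b) M" and D: "D1 \<subseteq> M" "D2 \<subseteq> M"
    and Z: "convex Z" "Z \<subseteq> M" "convex hull (f ` Basis) \<subseteq> Z"
    and small: "aff_dim (Z \<inter> D1) < aff_dim Z" "aff_dim (Z \<inter> D2) < aff_dim Z"
  shows False
proof -
  \<comment> \<open>The barycentre of the model facet, whose vertices are 0 and the basis vectors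
    other than \<open>e\<close>.\<close>
  define z0 where "z0 = (\<Sum>i\<in>Basis. (if i = e then 0 else 1 / DIM('b)) *\<^sub>R i)"
  have z0e: "z0 \<bullet> e = 0" using e by (simp add: z0_def)
  have b0: "bary z0 i = 1 / DIM('b)" if i: "i \<in> Basis" for i
  proof (cases "i = e")
    case True
    have "(\<Sum>j\<in>Basis-{e}. z0 \<bullet> j) = (\<Sum>j\<in>Basis-{e}. 1 / DIM('b))"
      by (rule sum.cong) (auto simp: z0_def)
    also have "\<dots> = (real DIM('b) - 1) / DIM('b)"
      using e by (simp add: card_Diff_singleton of_nat_diff DIM_positive Suc_leI)
    finally show ?thesis using True by (simp add: bary_e diff_divide_distrib)
  qed (use i in \<open>simp add: bary_other z0_def\<close>)
  \<comment> \<open>The strict form of \<open>\<bar>z \<bullet> e\<bar> \<le> lam z\<close>, which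
    describes \<open>bdom 1 1\<close>; strictness makes \<open>N\<close> open.\<close>
  define N where "N = (\<Inter>i\<in>Basis. {z. (z \<bullet> e) / DIM('b) < bary z i} \<inter> {z. (- (z \<bullet> e)) / DIM('b) < bary z i})"
  have "open N" unfolding N_def bary_def
    by (intro open_INT ballI open_Int open_Collect_less continuous_intros) auto
  have z0N: "z0 \<in> N" by (simp add: N_def z0e b0)
  have Nsub: "N \<subseteq> bdom 1 1"
  proof
    fix z assume "z \<in> N"
    then have "z \<bullet> e \<le> lam z" "- (z \<bullet> e) \<le> lam z"
      unfolding lam_ge_iff by (auto simp: N_def less_imp_le)
    then show "z \<in> bdom 1 1" by (simp add: bdom_iff)
  qed
  let ?F = "bfold 1 1"
  define x where "x = ?F z0"
  have xD: "x = (\<Sum>i\<in>Basis. (1 / DIM('b)) *\<^sub>R f i)"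
    by (simp add: x_def bfold_def z0e half_def b0)
  have "x \<in> convex hull (f ` Basis)"
  proof -
    have "(\<Sum>i\<in>Basis. (1 / DIM('b)) *\<^sub>R f i) \<in> convex hull (f ` Basis)"
      by (rule convex_sum) (auto intro: hull_inc)
    then show ?thesis by (simp add: xD)
  qed
  then have xZ: "x \<in> Z" and xM: "x \<in> M" using Z by auto
  obtain a b :: 'b and k g W where k: "pw_affine (cbox a b) k"
    and kg: "pw_affine (k ` cbox a b) g" "\<And>v. v \<in> cbox a b \<Longrightarrow> g (k v) = v" "k ` cbox a b \<subseteq> M"
    "open W" "x \<in> W" "M \<inter> W \<subseteq> k ` cbox a b"
    by (rule manifold_box_chart [OF M xM]) (rule that; assumption)
  have contF: "continuous_on N ?F"
    using pw_affine_continuous [OF pw_affine_bfold] Nsub continuous_on_subset by (metis zero_less_one)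
  define N' where "N' = N \<inter> ?F -` W"
  have "open N'" unfolding N'_def using contF \<open>open N\<close> kg(4) by (intro continuous_open_preimage)
  have FM: "?F z \<in> M \<inter> W" if "z \<in> N'" for z
    using that Nsub bfold_in [of 1 1 z] D by (auto simp: N'_def)
  have ginj: "inj_on g (k ` cbox a b)" by (rule inj_on_inverseI [of _ k]) (use kg(2) in auto)
  have Finj: "inj_on ?F N'"
    by (rule inj_on_inverseI [of _ "bunfold 1 1"]) (use Nsub in \<open>auto simp: N'_def bunfold_bfold\<close>)
  have FN: "?F ` N' \<subseteq> k ` cbox a b" using FM kg(6) by blast
  have "continuous_on N' (g \<circ> ?F)"
  proof (rule continuous_on_compose)
    show "continuous_on N' ?F" using contF by (rule continuous_on_subset) (auto simp: N'_def)
    show "continuous_on (?F ` N') g"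
      using pw_affine_continuous [OF kg(1)] FN by (rule continuous_on_subset)
  qed
  moreover have "inj_on (g \<circ> ?F) N'"
    using Finj ginj FN by (intro comp_inj_on) (auto intro: inj_on_subset)
  \<comment> \<open>Domain and target both lie in \<open>'b\<close>, so invariance of domain makes
    the image open in \<open>'b\<close> itself and not only in the closed box of the chart.\<close>
  ultimately have "open ((g \<circ> ?F) ` N')" using \<open>open N'\<close> by (intro invariance_of_domain)
  then have "openin (top_of_set (k ` cbox a b)) (k ` cbox a b \<inter> g -` ((g \<circ> ?F) ` N'))"
    using pw_affine_continuous [OF kg(1)] by (intro continuous_openin_preimage_gen)
  then obtain W2 where W2: "open W2" "k ` cbox a b \<inter> g -` ((g \<circ> ?F) ` N') = k ` cbox a b \<inter> W2"
    by (auto simp: openin_open)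
  have "z0 \<in> N'" using z0N kg(5) by (simp add: N'_def x_def)
  then have "x \<in> W2" using W2(2) FN by (force simp: x_def)
  have nbhd: "M \<inter> (W \<inter> W2) \<subseteq> D1 \<union> D2"
  proof
    fix y assume y: "y \<in> M \<inter> (W \<inter> W2)"
    then have yk: "y \<in> k ` cbox a b" using kg(6) by blast
    then have "g y \<in> (g \<circ> ?F) ` N'" using W2(2) y by blast
    then obtain z where z: "z \<in> N'" "g y = g (?F z)" by auto
    then have "y = ?F z" using inj_onD [OF ginj] yk FN by blast
    then show "y \<in> D1 \<union> D2" using z(1) Nsub bfold_in [of 1 1 z] by (auto simp: N'_def)
  qed
  have "open (W \<inter> W2)" "x \<in> W \<inter> W2" using W2(1) kg(4,5) \<open>x \<in> W2\<close> by auto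
  then obtain E where E: "convex E" "x \<in> E" "E \<subseteq> Z \<inter> (W \<inter> W2)" "aff_dim E = aff_dim Z"
    by (rule convex_Int_ball_nbhd [OF Z(1) xZ])
  have "E \<subseteq> Z" "E \<subseteq> D1 \<union> D2" using E(3) nbhd Z(2) by (meson Int_lower1 le_inf_iff order_trans)+
  then have "E \<subseteq> (Z \<inter> D1) \<union> (Z \<inter> D2)" by (simp add: le_inf_iff flip: Int_Un_distrib)
  then have "E \<subseteq> \<Union>{Z \<inter> D1, Z \<inter> D2}" by simp
  then obtain G where "G \<in> {Z \<inter> D1, Z \<inter> D2}" "aff_dim E \<le> aff_dim G"
    by (rule aff_dim_convex_subset_Union [rotated 3]) (use E in auto)
  then show False using small E(4) by auto
qed

end

subsection \<open>Volumes of the simplices of a triangulated manifold\<close>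

text \<open>The common face is spanned by some vertices of either simplex, and its extreme points
  show that these are the same set \<open>c\<close>. By dimension \<open>c\<close> has
  \<open>DIM('b)\<close> elements, one fewer than either vertex set, so it can be indexed by
  \<open>Basis\<close>.\<close>

lemma facet_bipyramid:
  fixes X Y :: "'a::euclidean_space set"
  assumes X: "int DIM('b::euclidean_space) simplex X" and Y: "int DIM('b::euclidean_space) simplex Y"
    and face: "X \<inter> Y face_of X" "X \<inter> Y face_of Y" and dim: "aff_dim (X \<inter> Y) = int DIM('b::euclidean_space) - 1"
  obtains e :: "'b::euclidean_space" and f p q where "bipyramid e f p q"
    "X = convex hull (insert p (f ` Basis))" "Y = convex hull (insert q (f ` Basis))"
proof -
  obtain C where C: "\<not> affine_dependent C" "card C = DIM('b) + 1" "X = convex hull C"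
    using X by (auto simp: simplex_def)
  obtain C' where C': "\<not> affine_dependent C'" "card C' = DIM('b) + 1" "Y = convex hull C'"
    using Y by (auto simp: simplex_def)
  obtain c where c: "c \<subseteq> C" "X \<inter> Y = convex hull c"
    using face(1) face_of_convex_hull_affine_independent [OF C(1)] C(3) by auto
  obtain c' where c': "c' \<subseteq> C'" "X \<inter> Y = convex hull c'"
    using face(2) face_of_convex_hull_affine_independent [OF C'(1)] C'(3) by auto
  have ind: "\<not> affine_dependent c" "\<not> affine_dependent c'"
    using c c' C C' affine_independent_subset by blast+
  have "x \<in> c \<longleftrightarrow> x \<in> c'" for x
    using extreme_point_of_convex_hull_affine_independent [OF ind(1), of x]
      extreme_point_of_convex_hull_affine_independent [OF ind(2), of x] c c' by simp
  then have cc: "c' = c" by blast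
  have "aff_dim c = int DIM('b) - 1" using dim c by (simp add: aff_dim_convex_hull)
  then have card: "card c = DIM('b)" using aff_dim_affine_independent [OF ind(1)] by simp
  have fin: "finite C" "finite C'" "finite c"
    using aff_independent_finite C C' ind by blast+
  have "card (C - c) = 1" "card (C' - c) = 1"
    using c c' cc fin card C C' by (simp_all add: card_Diff_subset)
  then obtain p q where "C - c = {p}" "C' - c = {q}" by (meson card_1_singletonE)
  then have p: "C = insert p c" "p \<notin> c" and q: "C' = insert q c" "q \<notin> c"
    using c c' cc by auto
  obtain f :: "'b \<Rightarrow> 'a" where f: "bij_betw f Basis c"
    using finite_same_card_bij [of "Basis :: 'b set" c] fin card by auto
  then have fB: "f ` Basis = c" "inj_on f Basis" by (auto simp: bij_betw_def)
  \<comment> \<open>The height direction of the model is arbitrary.\<close>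
  obtain e :: 'b where e: "e \<in> Basis" using nonempty_Basis by blast
  show thesis
  proof (rule that)
    show "bipyramid e f p q"
    proof
      show "convex hull (insert p (f ` Basis)) \<inter> convex hull (insert q (f ` Basis)) \<subseteq> convex hull (f ` Basis)"
        using c C C' p q fB by simp
    qed (use p q C C' fB e in auto)
  qed (use p q C C' fB in auto)
qed

text \<open>\<open>\<T>\<close> holds the top-dimensional simplices of a triangulation without their
  faces; \<open>manifold_pure\<close> is what supplies \<open>cover\<close>.\<close>

locale pl_manifold_simplices =
  fixes n :: "'b::euclidean_space itself" and M :: "'a::euclidean_space set" and \<T>
  assumes manifold: "compact_pl_manifold n M" and con: "connected M"
    and fin: "finite \<T>" and simplex: "\<And>X. X \<in> \<T> \<Longrightarrow> int DIM('b) simplex X"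
    and face: "\<And>X Y. X \<in> \<T> \<Longrightarrow> Y \<in> \<T> \<Longrightarrow> X \<inter> Y face_of X" and cover: "\<Union>\<T> = M"
begin

lemma manifold': "compact_pl_manifold TYPE('b) M"
  using manifold by (simp add: compact_pl_manifold_def)

lemma poly: "X \<in> \<T> \<Longrightarrow> polytope X"
  using simplex simplex_imp_polytope by blast

lemma dim: "X \<in> \<T> \<Longrightarrow> aff_dim X = int DIM('b)"
  using simplex aff_dim_simplex by blast

lemma compact_M: "compact M"
  using manifold by (simp add: compact_pl_manifold_def)

text \<open>The value at \<open>A\<close> of the simplicial measure that gives each \<open>X\<close>
  the volume \<open>v X\<close>. Points in several simplices are counted repeatedly, but common
  proper faces have share 0.\<close>

definition mass :: "('a set \<Rightarrow> real) \<Rightarrow> 'a set \<Rightarrow> ennreal" where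
  "mass v A = (\<Sum>X\<in>\<T>. ennreal (v X) * simplex_share TYPE('b) X (A \<inter> X))"

definition reach :: "('a set \<Rightarrow> real) \<Rightarrow> ('a set \<Rightarrow> real) \<Rightarrow> bool" where
  "reach v w \<longleftrightarrow> (\<exists>h h'. pw_affine M h \<and> pw_affine M h' \<and> h ` M \<subseteq> M \<and> h' ` M \<subseteq> M \<and>
     (\<forall>x\<in>M. h' (h x) = x \<and> h (h' x) = x) \<and>
     (\<forall>A\<in>sets borel. A \<subseteq> M \<longrightarrow> mass v A = mass w (h ` A)))"

lemma mass_cong: "(\<And>X. X \<in> \<T> \<Longrightarrow> v X = w X) \<Longrightarrow> mass v A = mass w A"
  unfolding mass_def by (rule sum.cong) auto

lemma pw_affine_id: "pw_affine M (\<lambda>x. x)"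
  by (rule pw_affineI [OF fin cover [symmetric]]) (auto simp: poly affine_on_ident)

lemma reach_refl: 
  assumes "\<And>X. X \<in> \<T> \<Longrightarrow> v X = w X"
  shows "reach v w"
  unfolding reach_def
  by (rule exI [of _ "\<lambda>x. x"], rule exI [of _ "\<lambda>x. x"]) (auto simp: pw_affine_id mass_cong [OF assms])

lemma reach_trans:
  assumes "reach u v" "reach v w"
  shows "reach u w"
proof -
  obtain h h' where h: "pw_affine M h" "pw_affine M h'" "h ` M \<subseteq> M" "h' ` M \<subseteq> M"
     "\<forall>x\<in>M. h' (h x) = x \<and> h (h' x) = x" "\<forall>A\<in>sets borel. A \<subseteq> M \<longrightarrow> mass u A = mass v (h ` A)"
    using assms(1) unfolding reach_def by (elim exE conjE) (rule that; assumption)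
  obtain k k' where k: "pw_affine M k" "pw_affine M k'" "k ` M \<subseteq> M" "k' ` M \<subseteq> M"
     "\<forall>x\<in>M. k' (k x) = x \<and> k (k' x) = x" "\<forall>A\<in>sets borel. A \<subseteq> M \<longrightarrow> mass v A = mass w (k ` A)"
    using assms(2) unfolding reach_def by (elim exE conjE) (rule that; assumption)
  have mem: "h x \<in> M" "h' x \<in> M" "k x \<in> M" "k' x \<in> M" if "x \<in> M" for x
    using that h k by auto
  show ?thesis
    unfolding reach_def
  proof (rule exI [of _ "\<lambda>x. k (h x)"], rule exI [of _ "\<lambda>x. h' (k' x)"], intro conjI ballI impI)
    show "pw_affine M (\<lambda>x. k (h x))" "pw_affine M (\<lambda>x. h' (k' x))"
      using h k by (auto intro: pw_affine_compose)
    fix A assume A: "A \<in> sets borel" "A \<subseteq> M"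
    have "inj_on h M" by (rule inj_on_inverseI [of _ h']) (use h in auto)
    then have "h ` A \<in> sets borel"
      using compact_M h(1) A by (intro compact_injective_image_borel [of M] pw_affine_continuous)
    moreover have "h ` A \<subseteq> M" using A h(3) by blast
    ultimately have "mass v (h ` A) = mass w (k ` h ` A)" using k(6) by blast
    moreover have "mass u A = mass v (h ` A)" using h(6) A by blast
    ultimately show "mass u A = mass w ((\<lambda>x. k (h x)) ` A)" by (simp add: image_image)
  qed (use mem h k in auto)
qed

text \<open>The exchange is extended by the identity to the other simplices. This is consistent
  because a further simplex does not contain the common facet: it meets \<open>X\<close> and
  \<open>Y\<close> in faces that omit a vertex of the facet, and the exchange fixes these.\<close>

lemma facet_exchange_reach:
  assumes XY: "X \<in> \<T>" "Y \<in> \<T>" "aff_dim (X \<inter> Y) = int DIM('b) - 1"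
    and pos: "v X > 0" "v Y > 0" "x' > 0" "y' > 0" "x' + y' = v X + v Y"
  shows "reach v (v(X := x', Y := y'))"
proof -
  have neq: "X \<noteq> Y" using dim [OF XY(1)] XY(3) by auto
  have "Y \<inter> X face_of Y" using face XY by blast
  then have fYX: "X \<inter> Y face_of Y" by (simp add: inf_commute)
  obtain e :: 'b and f p q where B: "bipyramid e f p q"
    and X: "X = convex hull (insert p (f ` Basis))" and Y: "Y = convex hull (insert q (f ` Basis))"
    by (rule facet_bipyramid [OF simplex [OF XY(1)] simplex [OF XY(2)] face [OF XY(1,2)] fYX XY(3)])
  interpret bipyramid e f p q by (rule B)
  define h0 where "h0 = exchange (v X) (v Y) x' y'"
  define k0 where "k0 = exchange x' y' (v X) (v Y)"
  note pos' = pos(3,4,1,2) pos(5) [symmetric]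
  have fixed: "h0 x = x" "k0 x = x" if Z: "Z \<in> \<T>" "Z \<noteq> X" "Z \<noteq> Y" and x: "x \<in> Z" "x \<in> X \<union> Y" for Z x
  proof -
    have sub: "X \<subseteq> M" "Y \<subseteq> M" "Z \<subseteq> M" using XY Z cover by auto
    have cZ: "convex Z" using poly Z polytope_imp_convex by blast
    \<comment> \<open>If \<open>Z\<close> were contained in \<open>X'\<close>, it would be a proper
      face of \<open>X'\<close> of the same dimension.\<close>
    have small: "aff_dim (Z \<inter> X) < aff_dim Z" "aff_dim (Z \<inter> Y) < aff_dim Z"
    proof -
      have *: "aff_dim (Z \<inter> X') < aff_dim Z" if X': "X' \<in> \<T>" "Z \<noteq> X'" for X'
      proof (rule face_of_aff_dim_lt [OF cZ face [OF Z(1) X'(1)]])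
        show "Z \<inter> X' \<noteq> Z"
        proof
          assume ZX: "Z \<inter> X' = Z"
          have "X' \<inter> Z \<noteq> X'" using ZX X' by blast
          then have "aff_dim (X' \<inter> Z) < aff_dim X'"
            using face [OF X'(1) Z(1)] poly [OF X'(1)] by (intro face_of_aff_dim_lt polytope_imp_convex)
          then show False using ZX dim Z X' by (simp add: inf_commute)
        qed
      qed
      show "aff_dim (Z \<inter> X) < aff_dim Z" "aff_dim (Z \<inter> Y) < aff_dim Z" using * XY Z by auto
    qed
    have notF: "\<not> convex hull (f ` Basis) \<subseteq> Z"
      using no_third_simplex [OF manifold' _ _ cZ sub(3) _ small [unfolded X Y]] sub X Y by blast
    \<comment> \<open>The intersection with \<open>Z\<close> is the hull of a set \<open>c\<close>
      of vertices; if \<open>c\<close> contained all facet vertices, the facet would lie in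
      \<open>Z\<close>.\<close>
    have omit: "\<exists>i\<in>Basis. x \<in> convex hull (insert r (f ` Basis) - {f i})"
      if r: "x \<in> X'" "X' \<in> \<T>" "X' = convex hull (insert r (f ` Basis))" "\<not> affine_dependent (insert r (f ` Basis))" for r X'
    proof -
      have "X' \<inter> Z face_of X'" using face r Z by blast
      then obtain c where c: "c \<subseteq> insert r (f ` Basis)" "X' \<inter> Z = convex hull c"
        using face_of_convex_hull_affine_independent [OF r(4)] r(3) by auto
      have "\<not> f ` Basis \<subseteq> c"
      proof
        assume "f ` Basis \<subseteq> c"
        then have "convex hull (f ` Basis) \<subseteq> convex hull c" by (rule hull_mono)
        then show False using notF c(2) by blast
      qed
      then obtain i where i: "i \<in> Basis" "f i \<notin> c" by blast
      have "x \<in> convex hull c" using r(1) x(1) c(2) by blast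
      moreover have "convex hull c \<subseteq> convex hull (insert r (f ` Basis) - {f i})"
        using c(1) i(2) by (intro hull_mono) blast
      ultimately show ?thesis using i(1) by blast
    qed
    have "\<exists>i\<in>Basis. x \<in> convex hull (insert p (f ` Basis) - {f i}) \<union> convex hull (insert q (f ` Basis) - {f i})"
      using x(2) omit [of X p] omit [of Y q] XY X Y ind_p ind_q by blast
    then obtain i where i: "i \<in> Basis" "x \<in> convex hull (insert p (f ` Basis) - {f i}) \<union> convex hull (insert q (f ` Basis) - {f i})"
      by blast
    show "h0 x = x" "k0 x = x"
      unfolding h0_def k0_def by (rule exchange_fixed [OF pos i] exchange_fixed [OF pos' i])+
  qed
  define h where "h x = (if x \<in> X \<union> Y then h0 x else x)" for x
  define k where "k x = (if x \<in> X \<union> Y then k0 x else x)" for x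
  have hk_other: "h x = x" "k x = x" if "Z \<in> \<T> - {X,Y}" "x \<in> Z" for Z x
    using that fixed [of Z x] by (auto simp: h_def k_def)
  have M_eq: "M = (X \<union> Y) \<union> (\<Union>Z\<in>\<T>-{X,Y}. Z)" using cover XY by auto
  have h0in: "h0 x \<in> X \<union> Y" and k0in: "k0 x \<in> X \<union> Y" if "x \<in> X \<union> Y" for x
    using exchange_in [OF pos] exchange_in [OF pos'] that unfolding X Y h0_def k0_def by auto
  have k0h0: "k0 (h0 x) = x" and h0k0: "h0 (k0 x) = x" if "x \<in> X \<union> Y" for x
    using exchange_exchange [OF pos] exchange_exchange [OF pos'] that unfolding X Y h0_def k0_def by auto
  have hin: "h x \<in> M" "k x \<in> M" if "x \<in> M" for x
    using that h0in [of x] k0in [of x] M_eq by (auto simp: h_def k_def)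
  have pw_h: "pw_affine M h" and pw_k: "pw_affine M k"
  proof -
    have 1: "pw_affine (X \<union> Y) h" "pw_affine (X \<union> Y) k"
      by (rule pw_affine_cong [of _ h0] pw_affine_cong [of _ k0],
          simp add: h_def k_def, use pw_affine_exchange [OF pos] pw_affine_exchange [OF pos'] in \<open>simp add: X Y h0_def k0_def\<close>)+
    have 2: "pw_affine Z h" "pw_affine Z k" if Z: "Z \<in> \<T> - {X,Y}" for Z
    proof -
      have "pw_affine Z (\<lambda>x. x)" using poly Z by (intro pw_affine_polytope affine_on_ident) auto
      then show "pw_affine Z h" "pw_affine Z k"
        using hk_other [OF Z] by (auto intro: pw_affine_cong [rotated])
    qed
    show "pw_affine M h" "pw_affine M k"
      unfolding M_eq by (intro pw_affine_Un pw_affine_UN 1 2 finite_Diff fin; assumption)+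
  qed
  have kh: "k (h x) = x" and hk: "h (k x) = x" for x
    using h0in k0in k0h0 h0k0 by (auto simp: h_def k_def)
  define w where "w = v(X := x', Y := y')"
  have "mass v A = mass w (h ` A)" if A: "A \<in> sets borel" "A \<subseteq> M" for A
  proof -
    let ?s = "\<lambda>X A. simplex_share TYPE('b) X (A \<inter> X)"
    have split: "mass u A = (ennreal (u X) * ?s X A + ennreal (u Y) * ?s Y A) + (\<Sum>Z\<in>\<T>-{X,Y}. ennreal (u Z) * ?s Z A)" for u A
    proof -
      have "mass u A = ennreal (u X) * ?s X A + (\<Sum>Z\<in>\<T>-{X}. ennreal (u Z) * ?s Z A)"
        unfolding mass_def by (rule sum.remove [OF fin XY(1)])
      also have "(\<Sum>Z\<in>\<T>-{X}. ennreal (u Z) * ?s Z A) = ennreal (u Y) * ?s Y A + (\<Sum>Z\<in>\<T>-{X}-{Y}. ennreal (u Z) * ?s Z A)"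
        using fin XY neq by (intro sum.remove) auto
      also have "\<T> - {X} - {Y} = \<T> - {X,Y}" by blast
      finally show ?thesis by (simp add: add.assoc)
    qed
    have rest: "(\<Sum>Z\<in>\<T>-{X,Y}. ennreal (v Z) * ?s Z A) = (\<Sum>Z\<in>\<T>-{X,Y}. ennreal (w Z) * ?s Z (h ` A))"
    proof (rule sum.cong)
      fix Z assume Z: "Z \<in> \<T> - {X,Y}"
      \<comment> \<open>The map \<open>h\<close> is injective and fixes \<open>Z\<close> pointwise,
        so it moves nothing into or out of \<open>Z\<close>.\<close>
      have "h ` A \<inter> Z = A \<inter> Z"
      proof (intro set_eqI iffI)
        fix y assume "y \<in> h ` A \<inter> Z"
        then obtain x where x: "x \<in> A" "y = h x" "y \<in> Z" by blast
        then have "y = x" using hk_other(2) [OF Z x(3)] kh [of x] by simp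
        then show "y \<in> A \<inter> Z" using x by simp
      next
        fix y assume "y \<in> A \<inter> Z"
        then show "y \<in> h ` A \<inter> Z" using hk_other(1) [OF Z, of y] by force
      qed
      then show "ennreal (v Z) * ?s Z A = ennreal (w Z) * ?s Z (h ` A)"
        using Z by (simp add: w_def)
    qed simp
    let ?A = "A \<inter> (X \<union> Y)"
    have "X \<union> Y \<in> sets borel"
      using poly XY by (intro borel_closed closed_Un polytope_imp_closed) auto
    then have A': "?A \<in> sets borel" "?A \<subseteq> X \<union> Y" using A by auto
    have e1: "A \<inter> X = ?A \<inter> X" "A \<inter> Y = ?A \<inter> Y" by auto
    have e2: "h ` A \<inter> X = h0 ` ?A \<inter> X" "h ` A \<inter> Y = h0 ` ?A \<inter> Y"
      by (auto simp: h_def image_iff split: if_splits)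
    have "ennreal (v X) * ?s X A + ennreal (v Y) * ?s Y A = ennreal (w X) * ?s X (h ` A) + ennreal (w Y) * ?s Y (h ` A)"
      using share_exchange [OF pos, of ?A] A' neq unfolding e1 e2 w_def h0_def
      by (simp add: X [symmetric] Y [symmetric])
    then show ?thesis unfolding split [of v A] split [of w "h ` A"] rest by simp
  qed
  then show ?thesis
    unfolding reach_def w_def [symmetric]
    by (intro exI [of _ h] exI [of _ k]) (use pw_h pw_k hin kh hk in auto)
qed

text \<open>Two separate corrections instead of function updates: for \<open>X = Y\<close> they
  cancel and give back \<open>v\<close>, which is the base of the induction in
  \<open>reach_move\<close>.\<close>

definition move :: "('a set \<Rightarrow> real) \<Rightarrow> 'a set \<Rightarrow> 'a set \<Rightarrow> real \<Rightarrow> 'a set \<Rightarrow> real" where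
  "move v X Y t = (\<lambda>Z. v Z - (if Z = X then t else 0) + (if Z = Y then t else 0))"

text \<open>The amount \<open>t\<close> is handed along a chain of adjacent simplices from
  \<open>X\<close> to \<open>Y\<close>: in each step the current end passes on what it holds in
  addition to its final volume.\<close>

lemma reach_move:
  assumes "X \<in> \<T>" "Y \<in> \<T>" and v: "\<And>Z. Z \<in> \<T> \<Longrightarrow> v Z > 0" and t: "0 \<le> t" "t < v X"
  shows "reach v (move v X Y t)"
proof -
  have "(X,Y) \<in> {(X,Y). X \<in> \<T> \<and> Y \<in> \<T> \<and> aff_dim (X \<inter> Y) = int DIM('b) - 1}\<^sup>*"
    by (rule manifold_strongly_connected [OF manifold' con fin poly cover dim face assms(1,2)])
  then show ?thesis
  proof (induction rule: rtrancl_induct)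
    case base
    show ?case by (rule reach_refl) (simp add: move_def)
  next
    case (step Y Z)
    then have YZ: "Y \<in> \<T>" "Z \<in> \<T>" "aff_dim (Y \<inter> Z) = int DIM('b) - 1" by auto
    then have "Y \<noteq> Z" using dim [of Y] by auto
    let ?u = "move v X Y t"
    have "reach ?u (?u(Y := ?u Y - t, Z := ?u Z + t))"
    proof (rule facet_exchange_reach [OF YZ])
      \<comment> \<open>After handing on \<open>t\<close>, an intermediate simplex is back at its
        volume under \<open>v\<close>; only \<open>X\<close> has lost volume, and
        \<open>t < v X\<close>.\<close>
      show "?u Y > 0" "?u Z > 0" "?u Y - t > 0" "?u Z + t > 0"
        using v [OF YZ(1)] v [OF YZ(2)] t by (auto simp: move_def)
    qed simp
    moreover have "?u(Y := ?u Y - t, Z := ?u Z + t) = move v X Z t"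
      using \<open>Y \<noteq> Z\<close> by (auto simp: move_def fun_eq_iff)
    ultimately show ?case using step.IH reach_trans by simp
  qed
qed

text \<open>Equal totals provide a simplex with too much volume and one with too little. Moving the
  smaller of the two discrepancies settles at least one of them and disturbs no other simplex, so
  the number of disagreements drops.\<close>

lemma reach_equal_total:
  assumes "\<And>Z. Z \<in> \<T> \<Longrightarrow> v Z > 0" "\<And>Z. Z \<in> \<T> \<Longrightarrow> w Z > 0" "sum v \<T> = sum w \<T>"
  shows "reach v w"
  using assms(1,3)
proof (induction "card {Z \<in> \<T>. v Z \<noteq> w Z}" arbitrary: v rule: less_induct)
  case less
  show ?case
  proof (cases "\<forall>Z\<in>\<T>. v Z = w Z")
    case True
    then show ?thesis by (intro reach_refl) auto
  next
    case False
    have "\<exists>X\<in>\<T>. v X > w X"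
    proof (rule ccontr)
      assume "\<not> ?thesis"
      then have "sum v \<T> < sum w \<T>"
        using False by (intro sum_strict_mono_ex1 [OF fin]) force+
      then show False using less.prems by simp
    qed
    then obtain X where X: "X \<in> \<T>" "v X > w X" by blast
    have "\<exists>X\<in>\<T>. v X < w X"
    proof (rule ccontr)
      assume "\<not> ?thesis"
      then have "sum w \<T> < sum v \<T>"
        using False by (intro sum_strict_mono_ex1 [OF fin]) force+
      then show False using less.prems by simp
    qed
    then obtain Y where Y: "Y \<in> \<T>" "v Y < w Y" by blast
    define t where "t = min (v X - w X) (w Y - v Y)"
    have t: "0 \<le> t" "t < v X" "t > 0" using X Y assms(2) [of X] by (auto simp: t_def)
    let ?u = "move v X Y t"
    have neq: "X \<noteq> Y" using X Y by auto
    have "reach v ?u" using X Y less.prems t by (intro reach_move) auto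
    moreover have "reach ?u w"
    proof (rule less.hyps)
      show "?u Z > 0" if "Z \<in> \<T>" for Z
        using less.prems(1) [OF that] t by (auto simp: move_def)
      show "sum ?u \<T> = sum w \<T>"
        using fin X Y less.prems(2) by (simp add: move_def sum.distrib sum_subtractf)
      have "?u X = w X \<or> ?u Y = w Y" using neq by (auto simp: move_def t_def min_def)
      then have "\<not> {Z \<in> \<T>. v Z \<noteq> w Z} \<subseteq> {Z \<in> \<T>. ?u Z \<noteq> w Z}"
        using X Y by fastforce
      moreover have "v Z \<noteq> w Z" if "?u Z \<noteq> w Z" for Z
        using that X(2) Y(2) by (cases "Z = X \<or> Z = Y") (auto simp: move_def)
      ultimately have "{Z \<in> \<T>. ?u Z \<noteq> w Z} \<subset> {Z \<in> \<T>. v Z \<noteq> w Z}"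
        by blast
      then show "card {Z \<in> \<T>. ?u Z \<noteq> w Z} < card {Z \<in> \<T>. v Z \<noteq> w Z}"
        using fin by (intro psubset_card_mono) auto
    qed
    ultimately show ?thesis by (rule reach_trans)
  qed
qed

end

subsection \<open>Simplicial measures\<close>

lemma low_dim_null:
  fixes S :: "'a::euclidean_space set"
  assumes "aff_dim S < int DIM('a)" "S \<in> sets borel"
  shows "emeasure lborel S = 0"
proof -
  obtain a b where ab: "a \<noteq> 0" "S \<subseteq> {x. a \<bullet> x = b}"
    using aff_lowdim_subset_hyperplane assms(1) by blast
  then have "S \<subseteq> {x. x \<bullet> a = b}" by (auto simp: inner_commute)
  then have "emeasure lborel S \<le> emeasure lborel {x. x \<bullet> a = b}"
    by (intro emeasure_mono) auto
  then show ?thesis using emeasure_lborel_hyperplane [OF ab(1)] by simp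
qed

lemma simplicial_measure_sets:
  assumes "simplicial_measure_rel n M \<T> \<mu>"
  shows "A \<in> sets \<mu> \<longleftrightarrow> A \<in> sets borel \<and> A \<subseteq> M" "M \<in> sets borel" "space \<mu> = M"
proof -
  have "finite \<T>" "\<Union>\<T> = M" "\<And>X. X \<in> \<T> \<Longrightarrow> polytope X" and s: "sets \<mu> = sets (restrict_space borel M)"
    using assms by (auto simp: simplicial_measure_rel_def triangulation_def intro: simplex_imp_polytope)
  then have "closed M" by (metis closed_Union polytope_imp_closed)
  then show M: "M \<in> sets borel" by (rule borel_closed)
  show "A \<in> sets \<mu> \<longleftrightarrow> A \<in> sets borel \<and> A \<subseteq> M"
    unfolding s using M by (subst sets_restrict_space_iff) auto
  show "space \<mu> = M"
    using sets_eq_imp_space_eq [OF s] by (simp add: space_restrict_space)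
qed

context pl_manifold_simplices
begin

context
  fixes \<mu> and \<S>
  assumes \<mu>: "simplicial_measure_rel TYPE('b) M \<S> \<mu>" and sub: "\<And>X. X \<in> \<T> \<Longrightarrow> \<exists>Y\<in>\<S>. X \<subseteq> Y"
begin

lemma simplex_chart:
  assumes X: "X \<in> \<T>"
  obtains g :: "'a \<Rightarrow> 'b" where "affine_on X g" "inj_on g X"
    "\<And>A. A \<in> sets borel \<Longrightarrow> A \<subseteq> X \<Longrightarrow> emeasure \<mu> A = emeasure lebesgue (g ` A)"
proof -
  obtain Y where Y: "Y \<in> \<S>" "X \<subseteq> Y" using sub X by blast
  have YM: "Y \<subseteq> M" using Y \<mu> by (auto simp: simplicial_measure_rel_def)
  have "convex Y" using Y \<mu> by (auto simp: simplicial_measure_rel_def triangulation_def intro: convex_simplex)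
  then have "aff_dim Y = int DIM('b)"
    using manifold_aff_dim_le [OF manifold' _ YM] aff_dim_subset [OF Y(2)] dim [OF X] by simp
  then obtain g :: "'a \<Rightarrow> 'b" where g: "affine_on Y g" "inj_on g Y"
      "\<forall>A\<in>sets \<mu>. A \<subseteq> Y \<longrightarrow> emeasure \<mu> A = emeasure lebesgue (g ` A)"
    using \<mu> Y(1) unfolding simplicial_measure_rel_def by blast
  show thesis
  proof
    show "emeasure \<mu> A = emeasure lebesgue (g ` A)" if A: "A \<in> sets borel" "A \<subseteq> X" for A
    proof -
      have "A \<subseteq> Y" using A(2) Y(2) by (rule order_trans)
      moreover have "A \<in> sets \<mu>"
        using simplicial_measure_sets(1) [OF \<mu>] A(1) order_trans [OF \<open>A \<subseteq> Y\<close> YM] by simp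
      ultimately show ?thesis using g(3) by simp
    qed
    show "affine_on X g" by (rule affine_on_subset [OF g(1) Y(2)])
    show "inj_on g X" by (rule inj_on_subset [OF g(2) Y(2)])
  qed
qed

lemma simplex_measure: "X \<in> \<T> \<Longrightarrow> emeasure \<mu> X = ennreal (measure \<mu> X) \<and> measure \<mu> X > 0"
proof -
  assume X: "X \<in> \<T>"
  obtain g :: "'a \<Rightarrow> 'b" where g: "affine_on X g" "inj_on g X"
    "\<And>A. A \<in> sets borel \<Longrightarrow> A \<subseteq> X \<Longrightarrow> emeasure \<mu> A = emeasure lebesgue (g ` A)"
    by (rule simplex_chart [OF X]) (rule that; assumption)
  have "X \<in> sets borel" using poly [OF X] by (intro borel_closed polytope_imp_closed)
  then have "emeasure \<mu> X = emeasure lebesgue (g ` X)" using g(3) by blast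
  then obtain v where v: "emeasure \<mu> X = ennreal v" "v > 0"
    using emeasure_affine_image_positive_finite [OF poly [OF X] dim [OF X] g(1,2)] ennreal_positive_finiteE by metis
  then show ?thesis by (simp add: measure_def)
qed

lemma simplex_share_measure:
  assumes X: "X \<in> \<T>" and A: "A \<in> sets borel" "A \<subseteq> X"
  shows "emeasure \<mu> A = ennreal (measure \<mu> X) * simplex_share TYPE('b) X A"
proof -
  obtain g :: "'a \<Rightarrow> 'b" where g: "affine_on X g" "inj_on g X"
    "\<And>A. A \<in> sets borel \<Longrightarrow> A \<subseteq> X \<Longrightarrow> emeasure \<mu> A = emeasure lebesgue (g ` A)"
    by (rule simplex_chart [OF X]) (rule that; assumption)
  have "X \<in> sets borel" using poly [OF X] by (intro borel_closed polytope_imp_closed)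
  then have "emeasure \<mu> X = emeasure lebesgue (g ` X)" using g(3) by blast
  then have "simplex_share TYPE('b) X A = emeasure \<mu> A / ennreal (measure \<mu> X)"
    using simplex_share_eq [OF poly [OF X] dim [OF X] g(1,2) A] g(3) [OF A] simplex_measure [OF X] by simp
  then show ?thesis
    using simplex_measure [OF X]
    by (cases "emeasure \<mu> A") (auto simp: ennreal_mult [symmetric] divide_ennreal ennreal_top_divide ennreal_mult_top)
qed

text \<open>The intersection is a proper face of one of the two simplices, so its image in the chart
  of \<open>X\<close> lies in a hyperplane.\<close>

lemma simplex_overlap_null:
  assumes "X \<in> \<T>" "Y \<in> \<T>" "X \<noteq> Y"
  shows "emeasure \<mu> (X \<inter> Y) = 0"
proof -
  obtain g :: "'a \<Rightarrow> 'b" where g: "affine_on X g" "inj_on g X"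
    "\<And>A. A \<in> sets borel \<Longrightarrow> A \<subseteq> X \<Longrightarrow> emeasure \<mu> A = emeasure lebesgue (g ` A)"
    by (rule simplex_chart [OF assms(1)]) (rule that; assumption)
  have P: "polytope (X \<inter> Y)" using poly assms by (intro polytope_Int) auto
  have gP: "polytope (g ` (X \<inter> Y))" using P g(1) affine_on_subset by (intro polytope_affine_image) blast+
  have "X \<inter> Y \<noteq> X \<or> Y \<inter> X \<noteq> Y" using assms(3) by blast
  then have "aff_dim (X \<inter> Y) < aff_dim X \<or> aff_dim (Y \<inter> X) < aff_dim Y"
    using face_of_aff_dim_lt face assms poly polytope_imp_convex by metis
  then have "aff_dim (X \<inter> Y) < int DIM('b)" using dim assms by (simp add: inf_commute)
  moreover have "aff_dim (g ` (X \<inter> Y)) \<le> aff_dim (X \<inter> Y)"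
    using g(1) affine_on_subset by (intro aff_dim_affine_image_le) blast
  ultimately have "emeasure lborel (g ` (X \<inter> Y)) = 0"
    using gP by (intro low_dim_null borel_closed polytope_imp_closed) auto
  moreover have "emeasure \<mu> (X \<inter> Y) = emeasure lebesgue (g ` (X \<inter> Y))"
    using P by (intro g(3) borel_closed polytope_imp_closed) auto
  ultimately show ?thesis using gP by (simp add: borel_closed polytope_imp_closed)
qed

lemma simplicial_measure_sum:
  assumes A: "A \<in> sets \<mu>"
  shows "emeasure \<mu> A = (\<Sum>X\<in>\<T>. emeasure \<mu> (A \<inter> X))"
proof -
  have Xs: "X \<in> sets \<mu>" if "X \<in> \<T>" for X
    using that poly [OF that] cover simplicial_measure_sets(1) [OF \<mu>] by (auto intro: borel_closed polytope_imp_closed)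
  have "emeasure \<mu> (A \<inter> \<Union>\<G>) = (\<Sum>X\<in>\<G>. emeasure \<mu> (A \<inter> X))" if "finite \<G>" "\<G> \<subseteq> \<T>" for \<G>
    using that
  proof (induction \<G> rule: finite_induct)
    case (insert X \<G>)
    have G: "\<Union>\<G> \<in> sets \<mu>" using insert Xs by (intro sets.finite_Union) auto
    have X: "X \<in> sets \<mu>" using insert Xs by auto
    have "A \<inter> X \<inter> (A \<inter> \<Union>\<G>) \<subseteq> (\<Union>Y\<in>\<G>. X \<inter> Y)" by blast
    moreover have UN: "(\<Union>Y\<in>\<G>. X \<inter> Y) \<in> sets \<mu>" using insert Xs by (intro sets.finite_UN) auto
    ultimately have "emeasure \<mu> (A \<inter> X \<inter> (A \<inter> \<Union>\<G>)) \<le> emeasure \<mu> (\<Union>Y\<in>\<G>. X \<inter> Y)"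
      by (intro emeasure_mono)
    also have "\<dots> \<le> (\<Sum>Y\<in>\<G>. emeasure \<mu> (X \<inter> Y))"
      using insert Xs by (intro emeasure_subadditive_finite) auto
    also have "\<dots> = 0" using insert simplex_overlap_null by (intro sum.neutral) auto
    finally have "emeasure \<mu> ((A \<inter> X) \<union> (A \<inter> \<Union>\<G>)) = emeasure \<mu> (A \<inter> X) + emeasure \<mu> (A \<inter> \<Union>\<G>)"
      using A X G by (intro emeasure_Un_null_Int) auto
    then show ?case using insert by (simp add: Int_Un_distrib)
  qed simp
  from this [OF fin order_refl] show ?thesis
    using A cover simplicial_measure_sets(1) [OF \<mu>] by (simp add: inf_absorb1)
qed

lemma simplicial_measure_mass:
  assumes A: "A \<in> sets \<mu>"
  shows "emeasure \<mu> A = mass (measure \<mu>) A"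
  unfolding simplicial_measure_sum [OF A] mass_def
proof (rule sum.cong)
  fix X assume X: "X \<in> \<T>"
  have "A \<inter> X \<in> sets borel"
    using A simplicial_measure_sets(1) [OF \<mu>] poly [OF X] by (auto intro: borel_closed polytope_imp_closed)
  then show "emeasure \<mu> (A \<inter> X) = ennreal (measure \<mu> X) * simplex_share TYPE('b) X (A \<inter> X)"
    by (intro simplex_share_measure [OF X]) auto
qed simp

lemma simplicial_measure_total: "emeasure \<mu> M = ennreal (sum (measure \<mu>) \<T>)"
proof -
  have "M \<in> sets \<mu>" using simplicial_measure_sets [OF \<mu>] by blast
  then have "emeasure \<mu> M = (\<Sum>X\<in>\<T>. emeasure \<mu> (M \<inter> X))" by (rule simplicial_measure_sum)
  also have "\<dots> = (\<Sum>X\<in>\<T>. ennreal (measure \<mu> X))"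
    using cover simplex_measure by (intro sum.cong refl) (metis Union_upper inf_absorb2)
  finally show ?thesis by simp
qed

end

end

text \<open>A complex refining \<open>\<S>\<close> whose nonempty simplices lie in simplices of
  \<open>\<S>'\<close> serves both triangulations; without its lower-dimensional simplices it still
  covers \<open>M\<close> by \<open>manifold_pure\<close>.\<close>

lemma manifold_triangulation_exists:
  fixes M :: "'a::euclidean_space set"
  assumes M: "compact_pl_manifold TYPE('b::euclidean_space) M" "connected M"
    and \<S>: "triangulation \<S>" "\<Union>\<S> = M" and \<S>': "triangulation \<S>'" "\<Union>\<S>' = M"
  obtains \<T> where "pl_manifold_simplices TYPE('b) M \<T>" 
    "\<And>X. X \<in> \<T> \<Longrightarrow> \<exists>Y\<in>\<S>. X \<subseteq> Y" "\<And>X. X \<in> \<T> \<Longrightarrow> \<exists>Y\<in>\<S>'. X \<subseteq> Y"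
proof -
  have poly: "polytope X" if "X \<in> \<S> \<or> X \<in> \<S>'" for X
    using that \<S> \<S>' by (auto simp: triangulation_def intro: simplex_imp_polytope)
  obtain \<L> where \<L>: "simplicial_complex \<L>" "\<Union>\<L> = \<Union>\<S>" "\<And>\<sigma>. \<sigma> \<in> \<L> \<Longrightarrow> \<exists>\<tau>\<in>\<S>. \<sigma> \<subseteq> \<tau>"
    "\<And>\<sigma>. \<sigma> \<in> \<L> \<Longrightarrow> \<sigma> \<noteq> {} \<Longrightarrow> \<exists>P\<in>\<S>'. \<sigma> \<subseteq> P"
    by (rule polytope_refinement [of \<S> \<S>']) (use \<S> \<S>' poly in \<open>auto simp: triangulation_def\<close>)
  define \<T> where "\<T> = {X \<in> \<L>. aff_dim X = int DIM('b)}"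
  show thesis
  proof
    show "pl_manifold_simplices TYPE('b) M \<T>"
    proof
      show "\<Union>\<T> = M" unfolding \<T>_def
        using \<L>(1,2) \<S>(2) by (intro manifold_pure [OF M(1)]) (auto simp: simplicial_complex_def intro: simplex_imp_polytope)
      show "int DIM('b) simplex X" if "X \<in> \<T>" for X
        using that \<L>(1) aff_dim_simplex by (fastforce simp: \<T>_def simplicial_complex_def)
    qed (use M \<L>(1) in \<open>auto simp: \<T>_def simplicial_complex_def\<close>)
    show "\<exists>Y\<in>\<S>. X \<subseteq> Y" if "X \<in> \<T>" for X using that \<L>(3) by (auto simp: \<T>_def)
    show "\<exists>Y\<in>\<S>'. X \<subseteq> Y" if "X \<in> \<T>" for X 
    proof -
      have "X \<noteq> {}" using that by (auto simp: \<T>_def)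
      then show ?thesis using that \<L>(4) by (auto simp: \<T>_def)
    qed
  qed
qed

lemma simplicial_measure_total_positive_finite:
  fixes M :: "'a::euclidean_space set"
  assumes M: "compact_pl_manifold TYPE('b::euclidean_space) M" "connected M"
    and \<mu>: "simplicial_measure TYPE('b) M \<mu>" and "M \<noteq> {}"
  shows "0 < emeasure \<mu> M" "emeasure \<mu> M < \<infinity>"
proof -
  obtain \<S> where \<S>: "simplicial_measure_rel TYPE('b) M \<S> \<mu>" using \<mu> by (auto simp: simplicial_measure_def)
  then have tr: "triangulation \<S>" "\<Union>\<S> = M" by (auto simp: simplicial_measure_rel_def)
  obtain \<T> where \<T>: "pl_manifold_simplices TYPE('b) M \<T>" "\<And>X. X \<in> \<T> \<Longrightarrow> \<exists>Y\<in>\<S>. X \<subseteq> Y"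
    by (rule manifold_triangulation_exists [OF M tr tr]) (rule that; assumption)
  interpret pl_manifold_simplices "TYPE('b)" M \<T> by (rule \<T>)
  have total: "emeasure \<mu> M = ennreal (sum (measure \<mu>) \<T>)" by (rule simplicial_measure_total [OF \<S> \<T>(2)])
  have "\<T> \<noteq> {}" using cover \<open>M \<noteq> {}\<close> by auto
  then have "sum (measure \<mu>) \<T> > 0" using simplex_measure [OF \<S> \<T>(2)] fin by (intro sum_pos) auto
  then show "0 < emeasure \<mu> M" "emeasure \<mu> M < \<infinity>" by (simp_all add: total)
qed

lemma simplicial_measures_equivalent:
  fixes M :: "'a::euclidean_space set"
  assumes M: "compact_pl_manifold TYPE('b::euclidean_space) M" "connected M"
    and \<mu>1: "simplicial_measure TYPE('b) M \<mu>1" and \<mu>2: "simplicial_measure TYPE('b) M \<mu>2"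
    and eq: "emeasure \<mu>1 M = emeasure \<mu>2 M"
  obtains h h' where "pw_affine M h" "pw_affine M h'" "h ` M \<subseteq> M" "h' ` M \<subseteq> M"
     "\<And>x. x \<in> M \<Longrightarrow> h' (h x) = x" "\<And>x. x \<in> M \<Longrightarrow> h (h' x) = x"
     "\<And>A. A \<in> sets \<mu>2 \<Longrightarrow> emeasure \<mu>1 (h -` A \<inter> M) = emeasure \<mu>2 A"
proof -
  obtain \<S>1 where \<S>1: "simplicial_measure_rel TYPE('b) M \<S>1 \<mu>1" using \<mu>1 by (auto simp: simplicial_measure_def)
  then have tr1: "triangulation \<S>1" "\<Union>\<S>1 = M" by (auto simp: simplicial_measure_rel_def)
  obtain \<S>2 where \<S>2: "simplicial_measure_rel TYPE('b) M \<S>2 \<mu>2" using \<mu>2 by (auto simp: simplicial_measure_def)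
  then have tr2: "triangulation \<S>2" "\<Union>\<S>2 = M" by (auto simp: simplicial_measure_rel_def)
  obtain \<T> where \<T>: "pl_manifold_simplices TYPE('b) M \<T>" 
    "\<And>X. X \<in> \<T> \<Longrightarrow> \<exists>Y\<in>\<S>1. X \<subseteq> Y" "\<And>X. X \<in> \<T> \<Longrightarrow> \<exists>Y\<in>\<S>2. X \<subseteq> Y"
    by (rule manifold_triangulation_exists [OF M tr1 tr2]) (rule that; assumption)
  interpret pl_manifold_simplices "TYPE('b)" M \<T> by (rule \<T>)
  note m1 = simplex_measure [OF \<S>1 \<T>(2)] and m2 = simplex_measure [OF \<S>2 \<T>(3)]
  have "ennreal (sum (measure \<mu>1) \<T>) = ennreal (sum (measure \<mu>2) \<T>)"
    using eq simplicial_measure_total [OF \<S>1 \<T>(2)] simplicial_measure_total [OF \<S>2 \<T>(3)] by simp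
  then have "sum (measure \<mu>1) \<T> = sum (measure \<mu>2) \<T>"
    by (subst (asm) ennreal_inj) (auto intro: sum_nonneg)
  then have "reach (measure \<mu>1) (measure \<mu>2)"
    using m1 m2 by (intro reach_equal_total) auto
  then obtain h h' where h: "pw_affine M h" "pw_affine M h'" "h ` M \<subseteq> M" "h' ` M \<subseteq> M"
     "\<forall>x\<in>M. h' (h x) = x \<and> h (h' x) = x"
     "\<forall>A\<in>sets borel. A \<subseteq> M \<longrightarrow> mass (measure \<mu>1) A = mass (measure \<mu>2) (h ` A)"
    unfolding reach_def by (elim exE conjE) (rule that; assumption)
  show thesis
  proof (rule that [OF h(1-4)])
    fix A assume A: "A \<in> sets \<mu>2"
    then have A': "A \<in> sets borel" "A \<subseteq> M" using simplicial_measure_sets(1) [OF \<S>2] by auto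
    \<comment> \<open>The conclusion speaks of preimages, \<open>reach\<close> of images; the
      inverse translates between them.\<close>
    have B: "h -` A \<inter> M = h' ` A"
    proof (intro set_eqI iffI)
      fix x assume "x \<in> h -` A \<inter> M"
      then show "x \<in> h' ` A" using h(5) by (intro rev_image_eqI [of "h x"]) auto
    next
      fix x assume "x \<in> h' ` A"
      then show "x \<in> h -` A \<inter> M" using h(4,5) A'(2) by auto
    qed
    have "inj_on h' M" by (rule inj_on_inverseI [of _ h]) (use h(5) in auto)
    then have B': "h' ` A \<in> sets borel" "h' ` A \<subseteq> M"
      using compact_M h(2,4) A' by (auto intro!: compact_injective_image_borel [of M] pw_affine_continuous)
    then have "h' ` A \<in> sets \<mu>1" using simplicial_measure_sets(1) [OF \<S>1] by blast
    then have "emeasure \<mu>1 (h' ` A) = mass (measure \<mu>1) (h' ` A)"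
      by (intro simplicial_measure_mass [OF \<S>1] \<T>(2))
    also have "\<dots> = mass (measure \<mu>2) (h ` h' ` A)" using h(6) B' by blast
    also have "h ` h' ` A = A"
    proof -
      have "h ` h' ` A = (\<lambda>x. x) ` A"
        unfolding image_image by (rule image_cong) (use h(5) A'(2) in auto)
      then show ?thesis by simp
    qed
    also have "mass (measure \<mu>2) A = emeasure \<mu>2 A"
      using A by (intro simplicial_measure_mass [OF \<S>2, symmetric] \<T>(3))
    finally show "emeasure \<mu>1 (h -` A \<inter> M) = emeasure \<mu>2 A" using B by simp
  qed (use h(5) in auto)
qed

subsection \<open>Boxes and local charts\<close>

lemma pl_homeomorphism_restrict:
  assumes "pw_affine S f" "pw_affine T g" "U \<subseteq> S" "f ` U = V" "V \<subseteq> T" "\<And>x. x \<in> U \<Longrightarrow> g (f x) = x"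
  shows "pl_homeomorphism U V f g"
proof -
  have "g ` V = U" using assms(4,6) by force
  moreover have "f (g y) = y" if "y \<in> V" for y using that assms(4,6) by auto
  ultimately show ?thesis
    unfolding pl_homeomorphism_def homeomorphism_def
    using assms by (auto intro: pl_map_subset [OF pw_affine_imp_pl_map] continuous_on_subset [OF pw_affine_continuous])
qed

text \<open>For each coordinate the lower face is used if \<open>y\<close> is not on the upper one,
  and the upper face otherwise. Near \<open>y\<close> the opposite faces are not met, so moving the
  corner \<open>c\<close> to the origin and flipping signs turns the box into the orthant, for
  interior and boundary points alike. The dilation by \<open>\<kappa>\<close> adjusts the
  volume.\<close>

lemma box_corner_chart:
  fixes a b y :: "'b::euclidean_space" and \<kappa> :: real
  assumes ab: "box a b \<noteq> {}" and y: "y \<in> cbox a b" and \<kappa>: "\<kappa> > 0"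
  obtains W and r r' :: "'b \<Rightarrow> 'b" where "affine_on UNIV r" "affine_on UNIV r'" "\<And>z. r' (r z) = z" "open W" "y \<in> W"
    "\<And>V. open V \<Longrightarrow> V \<subseteq> W \<Longrightarrow> openin (top_of_set orthant) (r ` (cbox a b \<inter> V))"
    "\<And>A. A \<in> sets borel \<Longrightarrow> emeasure lborel (r ` A) = ennreal (\<kappa> ^ DIM('b)) * emeasure lborel A"
proof -
  define s where "s i = (if y \<bullet> i < b \<bullet> i then 1 else -1 :: real)" for i
  define c where "c i = (if y \<bullet> i < b \<bullet> i then a \<bullet> i else b \<bullet> i)" for i
  define r where "r z = (\<Sum>i\<in>Basis. (\<kappa> * s i * (z \<bullet> i - c i)) *\<^sub>R i)" for z :: 'b
  define r' where "r' u = (\<Sum>i\<in>Basis. (s i * (u \<bullet> i) / \<kappa> + c i) *\<^sub>R i)" for u :: 'b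
  \<comment> \<open>Strictly away from the faces opposite to \<open>c\<close>, so that inside
    \<open>W\<close> the box is cut out by one inequality per coordinate.\<close>
  define W where "W = (\<Inter>i\<in>Basis. if y \<bullet> i < b \<bullet> i then {z. z \<bullet> i < b \<bullet> i} else {z. a \<bullet> i < z \<bullet> i})"
  have ss: "s i * s i = 1" "s i \<noteq> 0" for i by (auto simp: s_def)
  have ab': "a \<bullet> i < b \<bullet> i" if "i \<in> Basis" for i using ab that by (simp add: box_ne_empty)
  have ri: "r z \<bullet> i = \<kappa> * s i * (z \<bullet> i - c i)" if "i \<in> Basis" for z i using that by (simp add: r_def)
  have r'i: "r' u \<bullet> i = s i * (u \<bullet> i) / \<kappa> + c i" if "i \<in> Basis" for u i using that by (simp add: r'_def)
  have r'r: "r' (r z) = z" for z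
    by (rule euclidean_eqI) (use \<kappa> in \<open>auto simp: r'i ri s_def\<close>)
  have rr': "r (r' u) = u" for u
    by (rule euclidean_eqI) (use \<kappa> in \<open>auto simp: r'i ri s_def\<close>)
  show thesis
  proof
    show "affine_on UNIV r"
    proof (rule affine_onI)
      show "linear (\<lambda>z. \<Sum>i\<in>Basis. (\<kappa> * s i * (z \<bullet> i)) *\<^sub>R i)"
        by (rule linearI) (simp_all add: inner_add_left algebra_simps sum.distrib scaleR_sum_right)
      show "r z = (\<Sum>i\<in>Basis. (\<kappa> * s i * (z \<bullet> i)) *\<^sub>R i) + (\<Sum>i\<in>Basis. (- (\<kappa> * s i * c i)) *\<^sub>R i)" for z
        by (simp add: r_def algebra_simps sum.distrib sum_subtractf sum_negf)
    qed
    show "affine_on UNIV r'"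
    proof (rule affine_onI)
      show "linear (\<lambda>u. \<Sum>i\<in>Basis. (s i * (u \<bullet> i) / \<kappa>) *\<^sub>R i)"
        by (rule linearI) (simp_all add: inner_add_left algebra_simps add_divide_distrib sum.distrib scaleR_sum_right)
      show "r' u = (\<Sum>i\<in>Basis. (s i * (u \<bullet> i) / \<kappa>) *\<^sub>R i) + (\<Sum>i\<in>Basis. c i *\<^sub>R i)" for u
        by (simp add: r'_def algebra_simps sum.distrib)
    qed
    show "r' (r z) = z" for z by (rule r'r)
    show "open W" unfolding W_def
      by (intro open_INT ballI) (auto intro!: open_Collect_less continuous_intros)
    show "y \<in> W"
    proof -
      have "a \<bullet> i < y \<bullet> i" if "i \<in> Basis" "\<not> y \<bullet> i < b \<bullet> i" for i
        using ab' [OF that(1)] that(2) by linarith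
      then show ?thesis by (auto simp: W_def)
    qed
    show "openin (top_of_set orthant) (r ` (cbox a b \<inter> V))" if V: "open V" "V \<subseteq> W" for V
    proof -
      have in_box: "z \<in> cbox a b \<longleftrightarrow> r z \<in> orthant" if z: "z \<in> W" for z
      proof -
        have "a \<bullet> i \<le> z \<bullet> i \<and> z \<bullet> i \<le> b \<bullet> i \<longleftrightarrow> 0 \<le> r z \<bullet> i" if i: "i \<in> Basis" for i
        proof (cases "y \<bullet> i < b \<bullet> i")
          case True
          then have "z \<bullet> i < b \<bullet> i" using z i by (auto simp: W_def)
          then show ?thesis using True \<kappa> by (simp add: ri i s_def c_def zero_le_mult_iff)
        next
          case False
          then have "a \<bullet> i < z \<bullet> i" using z i by (auto simp: W_def)
          then show ?thesis using False \<kappa> by (simp add: ri i s_def c_def zero_le_mult_iff mult_le_0_iff)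
        qed
        then show ?thesis by (auto simp: mem_box orthant_def)
      qed
      have "r ` (cbox a b \<inter> V) = orthant \<inter> r' -` V"
      proof (intro set_eqI iffI)
        fix u assume "u \<in> r ` (cbox a b \<inter> V)"
        then obtain z where "z \<in> cbox a b" "z \<in> V" "u = r z" by blast
        then show "u \<in> orthant \<inter> r' -` V" using in_box [of z] V(2) r'r by auto
      next
        fix u assume "u \<in> orthant \<inter> r' -` V"
        then show "u \<in> r ` (cbox a b \<inter> V)"
          using in_box [of "r' u"] V(2) rr' by (intro rev_image_eqI [of "r' u"]) auto
      qed
      moreover have "open (r' -` V)"
        using V(1) unfolding r'_def by (intro open_vimage continuous_intros) (use \<kappa> in auto)
      ultimately show ?thesis by (auto simp: openin_open)
    qed
    show "emeasure lborel (r ` A) = ennreal (\<kappa> ^ DIM('b)) * emeasure lborel A" if A: "A \<in> sets borel" for A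
    proof -
      let ?t = "(\<Sum>i\<in>Basis. (- (\<kappa> * s i * c i)) *\<^sub>R i) :: 'b"
      have "r = (\<lambda>z. ?t + (\<Sum>j\<in>Basis. ((\<kappa> * s j) * (z \<bullet> j)) *\<^sub>R j))"
        by (rule ext) (simp add: r_def algebra_simps sum.distrib sum_subtractf sum_negf)
      then have "emeasure lborel (r ` A) = ennreal (\<Prod>j\<in>(Basis::'b set). \<bar>\<kappa> * s j\<bar>) * emeasure lborel A"
        using emeasure_diagonal_image [OF _ A, of "\<lambda>j. \<kappa> * s j" ?t] \<kappa> ss by simp
      also have "(\<Prod>j\<in>(Basis::'b set). \<bar>\<kappa> * s j\<bar>) = (\<Prod>j\<in>(Basis::'b set). \<kappa>)"
        using \<kappa> by (intro prod.cong) (auto simp: s_def)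
      finally show ?thesis by simp
    qed
  qed
qed

section \<open>Simplicial measures on a polytope in the model space\<close>

lemma polytope_triangulation:
  assumes "polytope P" "finite \<P>" "\<And>Q. Q \<in> \<P> \<Longrightarrow> polytope Q" "P \<subseteq> \<Union>\<P>"
  obtains \<T> where "triangulation \<T>" "\<Union>\<T> = P" "\<And>X. X \<in> \<T> \<Longrightarrow> X \<noteq> {} \<Longrightarrow> \<exists>Q\<in>\<P>. X \<subseteq> Q"
proof -
  obtain \<L> where \<L>: "simplicial_complex \<L>" "\<Union>\<L> = \<Union>{P}" "\<And>\<sigma>. \<sigma> \<in> \<L> \<Longrightarrow> \<sigma> \<noteq> {} \<Longrightarrow> \<exists>Q\<in>\<P>. \<sigma> \<subseteq> Q"
    by (rule polytope_refinement [of "{P}" \<P>]) (use assms in \<open>auto simp: face_of_refl polytope_imp_convex\<close>)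
  show thesis
    by (rule that [of \<L>]) (use \<L> in \<open>auto simp: simplicial_complex_def triangulation_def\<close>)
qed

lemma compact_pl_manifold_box:
  fixes a b :: "'b::euclidean_space"
  assumes ab: "box a b \<noteq> {}"
  shows "compact_pl_manifold TYPE('b) (cbox a b)"
  unfolding compact_pl_manifold_def
proof (intro conjI ballI)
  obtain \<T> where "triangulation \<T>" "\<Union>\<T> = cbox a b"
    by (rule polytope_triangulation [of "cbox a b" "{cbox a b}"]) (auto simp: polytope_interval)
  then show "\<exists>\<T>. triangulation \<T> \<and> \<Union>\<T> = cbox a b" by blast
  fix y assume y: "y \<in> cbox a b"
  obtain W and r r' :: "'b \<Rightarrow> 'b" where r: "affine_on UNIV r" "affine_on UNIV r'" "\<And>z. r' (r z) = z" "open W" "y \<in> W"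
    "\<And>V. open V \<Longrightarrow> V \<subseteq> W \<Longrightarrow> openin (top_of_set orthant) (r ` (cbox a b \<inter> V))"
    by (rule box_corner_chart [OF ab y zero_less_one]) (rule that; assumption)
  have ar: "affine_on S r" "affine_on S r'" for S using r(1,2) affine_on_subset by blast+
  have P: "polytope (r ` cbox a b)" by (intro polytope_affine_image polytope_interval ar)
  show "\<exists>U V h k. openin (top_of_set (cbox a b)) U \<and> y \<in> U \<and>
      (open V \<or> openin (top_of_set (orthant::'b set)) V) \<and> pl_homeomorphism U V h k"
  proof (intro exI conjI)
    show "openin (top_of_set (cbox a b)) (cbox a b \<inter> W)" using r(4) by (simp add: openin_open_Int)
    show "open (r ` (cbox a b \<inter> W)) \<or> openin (top_of_set orthant) (r ` (cbox a b \<inter> W))"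
      using r(4,6) by blast
    show "pl_homeomorphism (cbox a b \<inter> W) (r ` (cbox a b \<inter> W)) r r'"
      by (rule pl_homeomorphism_restrict [of "cbox a b" _ "r ` cbox a b"])
         (use r(3) in \<open>auto intro: pw_affine_polytope polytope_interval P ar\<close>)
  qed (use y r in auto)
qed simp

text \<open>The measure is \<open>\<mu>\<close> restricted to the image of \<open>S\<close> and
  carried back by \<open>f\<close>. It is simplicial for a triangulation of \<open>S\<close> so fine
  that on each simplex \<open>k\<close> is affine with image in one simplex of \<open>\<S>\<close>;
  \<open>k\<close> followed by the embedding of the latter is the required embedding.\<close>

lemma simplicial_measure_pushforward:
  fixes M :: "'a::euclidean_space set" and S :: "'b::euclidean_space set"
  assumes M: "compact_pl_manifold TYPE('b) M" and \<mu>: "simplicial_measure TYPE('b) M \<mu>"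
    and S: "polytope S" and k: "pw_affine S k" "k ` S \<subseteq> M" and fk: "\<And>v. v \<in> S \<Longrightarrow> f (k v) = v"
  obtains \<nu> where "simplicial_measure TYPE('b) S \<nu>" "sets \<nu> = sets (restrict_space borel S)"
    "\<And>B. B \<in> sets borel \<Longrightarrow> B \<subseteq> S \<Longrightarrow> emeasure \<nu> B = emeasure \<mu> (k ` B)"
proof -
  obtain \<S> where \<S>: "simplicial_measure_rel TYPE('b) M \<S> \<mu>" using \<mu> by (auto simp: simplicial_measure_def)
  note sets_\<mu> = simplicial_measure_sets [OF \<S>]
  let ?C = "k ` S"
  have cS: "compact S" "S \<in> sets borel"
    using S by (auto intro: polytope_imp_compact borel_closed polytope_imp_closed)
  have inj: "inj_on k S" by (rule inj_on_inverseI [of _ f]) (rule fk)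
  have kB: "k ` B \<in> sets borel" "k ` B \<in> sets \<mu>" if "B \<in> sets borel" "B \<subseteq> S" for B
  proof -
    show "k ` B \<in> sets borel" using cS k that inj
      by (intro compact_injective_image_borel [of S] pw_affine_continuous)
    then show "k ` B \<in> sets \<mu>" using that k by (auto simp: sets_\<mu>)
  qed
  have C: "?C \<in> sets \<mu>" using kB cS by simp
  have pre: "f -` B \<inter> ?C = k ` B" if "B \<subseteq> S" for B using that fk by force
  define \<nu> where "\<nu> = distr (restrict_space \<mu> ?C) (restrict_space borel S) f"
  have sp: "space (restrict_space \<mu> ?C) = ?C" using k(2) by (auto simp: space_restrict_space sets_\<mu>)
  have sB: "B \<in> sets (restrict_space borel S) \<longleftrightarrow> B \<in> sets borel \<and> B \<subseteq> S" for B
    using cS by (subst sets_restrict_space_iff) auto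
  have sC: "A \<in> sets (restrict_space \<mu> ?C) \<longleftrightarrow> A \<in> sets \<mu> \<and> A \<subseteq> ?C" for A
    using C k(2) by (subst sets_restrict_space_iff) (auto simp: sets_\<mu>)
  have meas: "f \<in> measurable (restrict_space \<mu> ?C) (restrict_space borel S)"
  proof (rule measurableI)
    show "f x \<in> space (restrict_space borel S)" if "x \<in> space (restrict_space \<mu> ?C)" for x
      using that fk by (auto simp: sp space_restrict_space)
    show "f -` B \<inter> space (restrict_space \<mu> ?C) \<in> sets (restrict_space \<mu> ?C)" if "B \<in> sets (restrict_space borel S)" for B
      using that pre [of B] kB [of B] by (auto simp: sp sB sC)
  qed
  have \<nu>: "emeasure \<nu> B = emeasure \<mu> (k ` B)" if "B \<in> sets borel" "B \<subseteq> S" for B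
  proof -
    have "emeasure \<nu> B = emeasure (restrict_space \<mu> ?C) (k ` B)"
      unfolding \<nu>_def using that pre [of B] by (subst emeasure_distr [OF meas]) (auto simp: sB sp)
    also have "\<dots> = emeasure \<mu> (k ` B)"
      using that C k(2) by (intro emeasure_restrict_space) (auto simp: sets_\<mu> inf_absorb1)
    finally show ?thesis .
  qed
  have sets_\<nu>: "sets \<nu> = sets (restrict_space borel S)" by (simp add: \<nu>_def)
  have \<S>': "finite \<S>" "\<Union>\<S> = M" "\<And>Y. Y \<in> \<S> \<Longrightarrow> polytope Y"
    using \<S> by (auto simp: simplicial_measure_rel_def triangulation_def intro: simplex_imp_polytope)
  obtain \<P> where \<P>: "finite \<P>" "S = \<Union>\<P>" "\<And>P. P \<in> \<P> \<Longrightarrow> polytope P" "\<And>P. P \<in> \<P> \<Longrightarrow> affine_on P k"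
    by (rule pw_affineE [OF k(1)]) (rule that; assumption)
  let ?Q = "(\<lambda>(P,Y). {v \<in> P. k v \<in> Y}) ` (\<P> \<times> \<S>)"
  have cov: "S \<subseteq> \<Union>?Q"
  proof
    fix v assume v: "v \<in> S"
    then obtain P where "P \<in> \<P>" "v \<in> P" using \<P>(2) by blast
    moreover obtain Y where "Y \<in> \<S>" "k v \<in> Y" using v k(2) \<S>'(2) by blast
    ultimately show "v \<in> \<Union>?Q" by (intro UnionI [of "{v \<in> P. k v \<in> Y}"]) auto
  qed
  have polyQ: "polytope Q" if "Q \<in> ?Q" for Q
    using that \<P>(3,4) \<S>'(3) by (auto intro!: polytope_affine_preimage)
  obtain \<T> where \<T>: "triangulation \<T>" "\<Union>\<T> = S" "\<And>X. X \<in> \<T> \<Longrightarrow> X \<noteq> {} \<Longrightarrow> \<exists>Q\<in>?Q. X \<subseteq> Q"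
    by (rule polytope_triangulation [OF S, of ?Q]) (use \<P>(1) \<S>'(1) polyQ cov in \<open>auto intro: that\<close>)
  have "\<exists>\<phi>::'b \<Rightarrow> 'b. affine_on X \<phi> \<and> inj_on \<phi> X \<and>
      (\<forall>A\<in>sets \<nu>. A \<subseteq> X \<longrightarrow> emeasure \<nu> A = emeasure lebesgue (\<phi> ` A))"
    if X: "X \<in> \<T>" "aff_dim X = int DIM('b)" for X
  proof -
    have "X \<noteq> {}" using X(2) by auto
    then obtain P Y where PY: "P \<in> \<P>" "Y \<in> \<S>" "X \<subseteq> P" "k ` X \<subseteq> Y" using \<T>(3) [OF X(1)] by auto
    have XS: "X \<subseteq> S" using X(1) \<T>(2) by blast
    have "convex X" using X(1) \<T>(1) by (auto simp: triangulation_def intro: convex_simplex)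
    have kX: "affine_on X k" "inj_on k X"
      using affine_on_subset [OF \<P>(4) [OF PY(1)] PY(3)] inj_on_subset [OF inj XS] by auto
    \<comment> \<open>Only top-dimensional simplices come with an embedding; \<open>Y\<close> is one
      because it contains an image of dimension \<open>DIM('b)\<close>.\<close>
    have "aff_dim (k ` X) = int DIM('b)" using aff_dim_affine_injective_image [OF \<open>convex X\<close> kX] X(2) by simp
    then have "aff_dim Y \<ge> int DIM('b)" using aff_dim_subset [OF PY(4)] by simp
    moreover have "aff_dim Y \<le> int DIM('b)"
      using PY(2) \<S>' by (intro manifold_aff_dim_le [OF M] polytope_imp_convex) auto
    ultimately obtain \<phi> :: "'a \<Rightarrow> 'b" where \<phi>: "affine_on Y \<phi>" "inj_on \<phi> Y"
      "\<forall>A\<in>sets \<mu>. A \<subseteq> Y \<longrightarrow> emeasure \<mu> A = emeasure lebesgue (\<phi> ` A)"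
      using \<S> PY(2) unfolding simplicial_measure_rel_def by (metis order.antisym)
    show ?thesis
    proof (intro exI conjI ballI impI)
      show "affine_on X (\<lambda>v. \<phi> (k v))" by (rule affine_on_compose [OF kX(1) \<phi>(1) PY(4)])
      show "inj_on (\<lambda>v. \<phi> (k v)) X"
        using kX(2) inj_on_subset [OF \<phi>(2) PY(4)] comp_inj_on [of k X \<phi>] by (simp add: o_def)
      show "emeasure \<nu> A = emeasure lebesgue ((\<lambda>v. \<phi> (k v)) ` A)" if A: "A \<in> sets \<nu>" "A \<subseteq> X" for A
      proof -
        have A': "A \<in> sets borel" "A \<subseteq> S" using A(1) by (auto simp: sets_\<nu> sB)
        have "k ` A \<subseteq> Y" using A(2) PY(4) by blast
        then have "emeasure \<mu> (k ` A) = emeasure lebesgue (\<phi> ` k ` A)" using \<phi>(3) kB(2) [OF A'] by blast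
        then show ?thesis by (simp add: \<nu> [OF A'] image_image)
      qed
    qed
  qed
  then have "simplicial_measure TYPE('b) S \<nu>"
    using \<T> sets_\<nu> unfolding simplicial_measure_def simplicial_measure_rel_def by blast
  then show thesis using sets_\<nu> \<nu> by (rule that)
qed

text \<open>The density is written as a power so that the dilation by \<open>\<kappa>\<close> is an
  affine embedding that realises it on every simplex.\<close>

lemma simplicial_measure_scaled_lebesgue:
  fixes S :: "'b::euclidean_space set"
  assumes S: "polytope S" and \<kappa>: "\<kappa> > 0"
  obtains \<nu> where "simplicial_measure TYPE('b) S \<nu>" "sets \<nu> = sets (restrict_space borel S)"
    "\<And>B. B \<in> sets borel \<Longrightarrow> B \<subseteq> S \<Longrightarrow> emeasure \<nu> B = ennreal (\<kappa> ^ DIM('b)) * emeasure lborel B"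
proof -
  define \<nu> where "\<nu> = scale_measure (ennreal (\<kappa> ^ DIM('b))) (restrict_space (lborel :: 'b measure) S)"
  have Sb: "S \<in> sets borel" using S by (auto intro: borel_closed polytope_imp_closed)
  have sets_\<nu>: "sets \<nu> = sets (restrict_space borel S)"
    by (simp add: \<nu>_def sets_restrict_space)
  have \<nu>: "emeasure \<nu> B = ennreal (\<kappa> ^ DIM('b)) * emeasure lborel B" if "B \<in> sets borel" "B \<subseteq> S" for B
    using that Sb by (simp add: \<nu>_def emeasure_restrict_space)
  obtain \<T> where \<T>: "triangulation \<T>" "\<Union>\<T> = S"
    by (rule polytope_triangulation [OF S, of "{S}"]) (use S in \<open>auto intro: that\<close>)
  have "\<exists>\<phi>::'b \<Rightarrow> 'b. affine_on X \<phi> \<and> inj_on \<phi> X \<and>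
      (\<forall>A\<in>sets \<nu>. A \<subseteq> X \<longrightarrow> emeasure \<nu> A = emeasure lebesgue (\<phi> ` A))" for X
  proof (intro exI conjI ballI impI)
    show "affine_on X (\<lambda>x. \<kappa> *\<^sub>R x + 0)"
      by (rule affine_onI [of "\<lambda>x. \<kappa> *\<^sub>R x" _ _ 0]) (auto intro!: linearI simp: algebra_simps)
    show "inj_on (\<lambda>x. \<kappa> *\<^sub>R x + 0) X" using \<kappa> by (auto simp: inj_on_def)
    show "emeasure \<nu> A = emeasure lebesgue ((\<lambda>x. \<kappa> *\<^sub>R x + 0) ` A)" if "A \<in> sets \<nu>" for A
    proof -
      have A: "A \<in> sets borel" "A \<subseteq> S" using that Sb unfolding sets_\<nu> by (auto simp: sets_restrict_space_iff)
      show ?thesis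
        unfolding emeasure_lebesgue_affine [of \<kappa> 0] using A \<kappa> by (simp add: \<nu> ennreal_power)
    qed
  qed
  then have "simplicial_measure TYPE('b) S \<nu>"
    using \<T> sets_\<nu> unfolding simplicial_measure_def simplicial_measure_rel_def by blast
  then show thesis using sets_\<nu> \<nu> by (rule that)
qed

text \<open>The chart is \<open>r \<circ> h \<circ> f\<close>: \<open>f\<close> reads a
  neighbourhood of \<open>x\<close> in a box \<open>S\<close>, \<open>h\<close> turns the
  transported measure into a constant multiple of Lebesgue measure, and the dilation in
  \<open>r\<close> absorbs the constant. The position of \<open>h (f x)\<close> in the box is not
  controlled, so the corner chart is taken at that point.\<close>

lemma simplicial_measure_locally_lebesgue:
  fixes M :: "'a::euclidean_space set"
  assumes M: "compact_pl_manifold TYPE('b::euclidean_space) M" and \<mu>: "simplicial_measure TYPE('b) M \<mu>"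
    and x: "x \<in> M"
  shows "\<exists>U (V::'b set) g g'. openin (top_of_set M) U \<and> x \<in> U \<and> openin (top_of_set orthant) V \<and>
     pl_homeomorphism U V g g' \<and> (\<forall>A\<in>sets \<mu>. A \<subseteq> U \<longrightarrow> emeasure \<mu> A = emeasure lebesgue (g ` A))"
proof -
  obtain a b :: 'b and k f W where ab: "box a b \<noteq> {}" and k: "pw_affine (cbox a b) k"
    and f: "pw_affine (k ` cbox a b) f" and fk: "\<And>v. v \<in> cbox a b \<Longrightarrow> f (k v) = v" and kM: "k ` cbox a b \<subseteq> M"
    and W: "open W" "x \<in> W" "M \<inter> W \<subseteq> k ` cbox a b"
    by (rule manifold_box_chart [OF M x]) (rule that; assumption)
  define S where "S = cbox a b"
  define C where "C = k ` S"
  note fold_S = S_def [symmetric] C_def [symmetric]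
  note k = k [unfolded fold_S] and f = f [unfolded fold_S] and fk = fk [unfolded fold_S]
    and kM = kM [unfolded fold_S] and W = W [unfolded fold_S]
  have PS: "polytope S" by (simp add: S_def polytope_interval)
  then have Sb: "S \<in> sets borel" by (intro borel_closed polytope_imp_closed)
  have S: "compact_pl_manifold TYPE('b) S" "connected S" "S \<noteq> {}"
    using compact_pl_manifold_box [OF ab] ab box_subset_cbox [of a b]
    by (auto simp: S_def intro: convex_connected)
  obtain \<nu> where \<nu>: "simplicial_measure TYPE('b) S \<nu>" "sets \<nu> = sets (restrict_space borel S)"
    "\<And>B. B \<in> sets borel \<Longrightarrow> B \<subseteq> S \<Longrightarrow> emeasure \<nu> B = emeasure \<mu> (k ` B)"
    by (rule simplicial_measure_pushforward [OF M \<mu> PS k _ fk]) (use kM in \<open>auto simp: C_def intro: that\<close>)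
  obtain t where t: "emeasure \<nu> S = ennreal t" "t > 0"
    by (rule ennreal_positive_finiteE [OF simplicial_measure_total_positive_finite [OF S(1,2) \<nu>(1) S(3)]])
  obtain u where u: "emeasure lborel S = ennreal u" "u > 0"
  proof (rule ennreal_positive_finiteE)
    have "0 < emeasure lborel (box a b)" using ab by (intro emeasure_lborel_open_pos) auto
    also have "\<dots> \<le> emeasure lborel S" using Sb box_subset_cbox by (intro emeasure_mono) (auto simp: S_def)
    finally show "0 < emeasure lborel S" .
    show "emeasure lborel S < \<infinity>" using polytope_imp_bounded [OF PS] by (rule emeasure_bounded_finite)
  qed
  \<comment> \<open>Chosen so that \<open>\<kappa> ^ DIM('b)\<close> times the volume
    \<open>u\<close> of the box is the total \<open>t\<close> of the transported measure.\<close>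
  define \<kappa> where "\<kappa> = root DIM('b) (t / u)"
  have \<kappa>: "\<kappa> > 0" "\<kappa> ^ DIM('b) = t / u" using t u by (simp_all add: \<kappa>_def)
  obtain \<nu>' where \<nu>': "simplicial_measure TYPE('b) S \<nu>'" "sets \<nu>' = sets (restrict_space borel S)"
    "\<And>B. B \<in> sets borel \<Longrightarrow> B \<subseteq> S \<Longrightarrow> emeasure \<nu>' B = ennreal (\<kappa> ^ DIM('b)) * emeasure lborel B"
    by (rule simplicial_measure_scaled_lebesgue [OF PS \<kappa>(1)]) (rule that; assumption)
  have "emeasure \<nu> S = emeasure \<nu>' S"
    using t u by (simp add: \<nu>'(3) [OF Sb] \<kappa>(2) flip: ennreal_mult)
  then obtain h h' where h: "pw_affine S h" "pw_affine S h'" "h ` S \<subseteq> S" "h' ` S \<subseteq> S"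
     "\<And>x. x \<in> S \<Longrightarrow> h' (h x) = x" "\<And>x. x \<in> S \<Longrightarrow> h (h' x) = x"
     "\<And>A. A \<in> sets \<nu>' \<Longrightarrow> emeasure \<nu> (h -` A \<inter> S) = emeasure \<nu>' A"
    by (rule simplicial_measures_equivalent [OF S(1,2) \<nu>(1) \<nu>'(1)]) (rule that; assumption)
  have xC: "x \<in> C" using x W by blast
  have fC: "f z \<in> S" "k (f z) = z" if "z \<in> C" for z using that fk by (auto simp: C_def)
  have hS: "h v \<in> S" "h' v \<in> S" if "v \<in> S" for v using that h by auto
  define y where "y = h (f x)"
  have yS: "y \<in> cbox a b" using hS fC xC by (simp add: y_def flip: S_def)
  obtain W2 and r r' :: "'b \<Rightarrow> 'b" where r: "affine_on UNIV r" "affine_on UNIV r'" "\<And>z. r' (r z) = z" "open W2" "y \<in> W2"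
    "\<And>V. open V \<Longrightarrow> V \<subseteq> W2 \<Longrightarrow> openin (top_of_set orthant) (r ` (cbox a b \<inter> V))"
    "\<And>A. A \<in> sets borel \<Longrightarrow> emeasure lborel (r ` A) = ennreal (\<kappa> ^ DIM('b)) * emeasure lborel A"
    by (rule box_corner_chart [OF ab yS \<kappa>(1)]) (rule that; assumption)
  have ar: "affine_on X r" "affine_on X r'" for X using r(1,2) affine_on_subset by blast+
  have hf: "pw_affine C (\<lambda>z. h (f z))"
    by (rule pw_affine_compose [OF f h(1)]) (use fC in auto)
  define g where "g z = r (h (f z))" for z
  define g' where "g' v = k (h' (r' v))" for v
  have pg: "pw_affine C g"
    unfolding g_def by (rule pw_affine_compose [OF hf pw_affine_polytope [OF PS ar(1)]]) (use fC hS in auto)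
  have "pw_affine (r ` S) (\<lambda>v. h' (r' v))"
    by (rule pw_affine_compose [OF pw_affine_polytope [OF polytope_affine_image [OF PS ar(1)] ar(2)] h(2)])
       (use r(3) in auto)
  then have pg': "pw_affine (r ` S) g'"
    unfolding g'_def by (rule pw_affine_compose [OF _ k]) (use r(3) hS in auto)
  have "openin (top_of_set C) (C \<inter> (\<lambda>z. h (f z)) -` W2)"
    using r(4) pw_affine_continuous [OF hf] by (intro continuous_openin_preimage_gen)
  then obtain W3 where W3: "open W3" "C \<inter> (\<lambda>z. h (f z)) -` W2 = C \<inter> W3" by (auto simp: openin_open)
  have W3_iff: "z \<in> W3 \<longleftrightarrow> h (f z) \<in> W2" if "z \<in> C" for z using W3(2) that by blast
  \<comment> \<open>\<open>W\<close> keeps \<open>U\<close> inside the image of the box, and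
    \<open>W3\<close> keeps its image under \<open>h \<circ> f\<close> inside the domain
    \<open>W2\<close> of the corner chart.\<close>
  define U where "U = M \<inter> (W \<inter> W3)"
  have UC: "U \<subseteq> C" using W(3) by (auto simp: U_def)
  have Uop: "openin (top_of_set M) U" unfolding U_def using W(1) W3(1) by (intro openin_open_Int open_Int)
  have xU: "x \<in> U" using x W(2) r(5) W3_iff [OF xC] by (simp add: U_def y_def)
  define V where "V = g ` U"
  have kh': "pw_affine S (\<lambda>v. k (h' v))"
    by (rule pw_affine_compose [OF h(2) k h(4)])
  \<comment> \<open>For the openness of \<open>V\<close> the neighbourhood is pulled back to the box
    along \<open>k \<circ> h'\<close>, the inverse of \<open>h \<circ> f\<close>.\<close>
  have "openin (top_of_set S) (S \<inter> (\<lambda>v. k (h' v)) -` (W \<inter> W3))"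
    using W(1) W3(1) pw_affine_continuous [OF kh'] by (intro continuous_openin_preimage_gen open_Int)
  then obtain W5 where W5: "open W5" "S \<inter> (\<lambda>v. k (h' v)) -` (W \<inter> W3) = S \<inter> W5" by (auto simp: openin_open)
  have W5_iff: "v \<in> W5 \<longleftrightarrow> k (h' v) \<in> W \<inter> W3" if "v \<in> S" for v using W5(2) that by blast
  have img: "(\<lambda>z. h (f z)) ` U = S \<inter> (W5 \<inter> W2)"
  proof (intro set_eqI iffI)
    fix v assume "v \<in> (\<lambda>z. h (f z)) ` U"
    then obtain z where z: "z \<in> U" "v = h (f z)" by blast
    then have zC: "z \<in> C" using UC by blast
    have "v \<in> S" "k (h' v) = z" using z(2) zC hS fC h(5) by auto
    moreover have "z \<in> W \<inter> W3" using z(1) by (simp add: U_def)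
    ultimately show "v \<in> S \<inter> (W5 \<inter> W2)" using W5_iff W3_iff [OF zC] z(2) by auto
  next
    fix v assume v: "v \<in> S \<inter> (W5 \<inter> W2)"
    then have z: "k (h' v) \<in> U" using W5_iff kM hS(2) by (auto simp: U_def C_def)
    have "h (f (k (h' v))) = v" using v fk hS(2) h(6) by auto
    then show "v \<in> (\<lambda>z. h (f z)) ` U" using z by (intro rev_image_eqI [of "k (h' v)"]) auto
  qed
  have Vimg: "V = r ` (cbox a b \<inter> (W5 \<inter> W2))"
    unfolding V_def S_def [symmetric] img [symmetric] by (simp add: g_def image_image)
  have Vop: "openin (top_of_set orthant) V"
    unfolding Vimg using W5(1) r(4) by (intro r(6)) auto
  have "pl_homeomorphism U V g g'"
  proof (rule pl_homeomorphism_restrict [OF pg pg' UC])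
    show "g ` U = V" by (simp add: V_def)
    show "V \<subseteq> r ` S" unfolding Vimg S_def by blast
    show "g' (g z) = z" if "z \<in> U" for z
    proof -
      have "z \<in> C" using that UC by blast
      then show ?thesis by (simp add: g_def g'_def r(3) h(5) fC)
    qed
  qed
  moreover have "emeasure \<mu> A = emeasure lebesgue (g ` A)" if A: "A \<in> sets \<mu>" "A \<subseteq> U" for A
  proof -
    obtain \<S> where \<S>: "simplicial_measure_rel TYPE('b) M \<S> \<mu>" using \<mu> by (auto simp: simplicial_measure_def)
    have Ab: "A \<in> sets borel" using A(1) simplicial_measure_sets(1) [OF \<S>] by blast
    have AC: "A \<subseteq> C" using A(2) UC by blast
    have cS: "compact S" using PS by (rule polytope_imp_compact)
    have cC: "compact C" using pw_affine_compact [OF f] .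
    have injf: "inj_on f C" by (rule inj_on_inverseI [of _ k]) (rule fC)
    have injh: "inj_on h S" by (rule inj_on_inverseI [of _ h']) (rule h)
    have B: "f ` A \<in> sets borel" "f ` A \<subseteq> S"
      using cC f injf Ab AC fC by (auto intro!: compact_injective_image_borel [of C] pw_affine_continuous)
    have D: "h ` f ` A \<in> sets borel" "h ` f ` A \<subseteq> S"
      using cS h(1) injh B hS by (auto intro!: compact_injective_image_borel [of S] pw_affine_continuous)
    have D': "h ` f ` A \<in> sets \<nu>'" using D Sb by (simp add: \<nu>'(2) sets_restrict_space_iff)
    have "k ` f ` A = A" unfolding image_image using AC fC by force
    then have "emeasure \<mu> A = emeasure \<nu> (f ` A)" using \<nu>(3) [OF B] by simp
    also have "f ` A = h -` (h ` f ` A) \<inter> S" using B(2) injh by (auto simp: inj_on_def)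
    also have "emeasure \<nu> \<dots> = emeasure \<nu>' (h ` f ` A)" by (rule h(7) [OF D'])
    also have "\<dots> = emeasure lborel (r ` h ` f ` A)" by (simp add: \<nu>'(3) [OF D] r(7) [OF D(1)])
    also have "\<dots> = emeasure lebesgue (r ` h ` f ` A)"
    proof -
      have "r ` h ` f ` A \<in> sets borel"
        by (rule compact_injective_image_borel [OF cS affine_on_continuous [OF ar(1)] _ D])
           (rule inj_on_inverseI [of _ r'], rule r(3))
      then show ?thesis by simp
    qed
    also have "r ` h ` f ` A = g ` A" by (simp add: g_def image_image)
    finally show ?thesis .
  qed
  ultimately show ?thesis using Uop xU Vop by blast
qed

theorem theorem3:
  fixes M :: "'a::euclidean_space set"
    and \<mu>1 \<mu>2 :: "'a measure"
  assumes "compact_pl_manifold TYPE('b::euclidean_space) M"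
    and "connected M"
    and "simplicial_measure TYPE('b) M \<mu>1"
    and "simplicial_measure TYPE('b) M \<mu>2"
    and "emeasure \<mu>1 M = emeasure \<mu>2 M"
  shows "(\<exists>h h'. pl_homeomorphism M M h h' \<and>
            (\<forall>A\<in>sets \<mu>2. emeasure \<mu>1 (h -` A \<inter> M) = emeasure \<mu>2 A))
       \<and> (\<forall>\<mu>. simplicial_measure TYPE('b) M \<mu> \<longrightarrow>
            (\<forall>x\<in>M. \<exists>U (V::'b set) g g'. openin (top_of_set M) U \<and> x \<in> U \<and>
               (open V \<or> openin (top_of_set orthant) V) \<and> pl_homeomorphism U V g g' \<and>
               (\<forall>A\<in>sets \<mu>. A \<subseteq> U \<longrightarrow> emeasure \<mu> A = emeasure lebesgue (g ` A))))"
proof (intro conjI allI impI ballI)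
  obtain h h' where "pw_affine M h" "pw_affine M h'" "h ` M \<subseteq> M" "h' ` M \<subseteq> M"
     "\<And>x. x \<in> M \<Longrightarrow> h' (h x) = x" "\<And>x. x \<in> M \<Longrightarrow> h (h' x) = x"
     and h: "\<And>A. A \<in> sets \<mu>2 \<Longrightarrow> emeasure \<mu>1 (h -` A \<inter> M) = emeasure \<mu>2 A"
    by (rule simplicial_measures_equivalent [OF assms]) (rule that; assumption)
  then have "pl_homeomorphism M M h h'" by (intro pl_homeomorphismI)
  then show "\<exists>h h'. pl_homeomorphism M M h h' \<and>
      (\<forall>A\<in>sets \<mu>2. emeasure \<mu>1 (h -` A \<inter> M) = emeasure \<mu>2 A)"
    using h by blast
next
  fix \<mu> x assume "simplicial_measure TYPE('b) M \<mu>" "x \<in> M"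
  from simplicial_measure_locally_lebesgue [OF assms(1) this]
  show "\<exists>U (V::'b set) g g'. openin (top_of_set M) U \<and> x \<in> U \<and>
      (open V \<or> openin (top_of_set orthant) V) \<and> pl_homeomorphism U V g g' \<and>
      (\<forall>A\<in>sets \<mu>. A \<subseteq> U \<longrightarrow> emeasure \<mu> A = emeasure lebesgue (g ` A))"
    by (elim exE conjE) (intro exI conjI disjI2; assumption)
qed

end
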